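(* Let $A$ be a generalized Cartan matrix of finite, untwisted affine or hyperbolic type, and let $B$ be a symmetrizable generalized Cartan matrix such that $A \preceq B$ and $B \preceq A$. Then $B$ coincides with $A$ up to a simultaneous permutation of rows and columns.
   Context: A generalized Cartan matrix (GCM) is an $n\times n$ integer matrix $A=(a_{ij})$ with $a_{ii}=2$, $a_{ij}\le 0$ for $i\ne j$, and $a_{ij}=0$ whenever $a_{ji}=0$. It is symmetrizable if $DA$ is symmetric for some diagonal $D$ with positive rational diagonal entries. $\mathfrak g(A)$ denotes the associated Kac-Moody algebra, with root system $\Delta(A)$ and real roots $\Delta^{re}(A)$; the coroot of a real root $\alpha$ is denoted $\alpha^\vee$. The types finite, affine, indefinite are those of Kac's trichotomy for indecomposable GCMs; untwisted affine means one of the types $X_\ell^{(1)}$; hyperbolic type means indecomposable of indefinite type such that every proper connected subdiagram of the Dynkin diagram is of finite or affine type. A $\pi$-system in $A$ is a finite set of distinct real roots $\{\beta_i\}_{i=1}^m$ of $\mathfrak g(A)$ such that $\beta_i-\beta_j$ is not a root for any $i\neq j$. Its type is the GCM $[\langle \beta_i^\vee,\beta_j\rangle]_{i,j=1}^m$. For symmetrizable GCMs $A,B$ (of possibly different sizes, considered up to simultaneous permutation of rows and columns), $B\preceq A$ means that there is a linearly independent $\pi$-system of type $B$ in $A$. *)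

theory Defs
  imports
    "Jordan_Normal_Form.DL_Rank_Submatrix"
    "HOL-Combinatorics.Permutations"
begin

definition gcm :: "int mat \<Rightarrow> bool" where
  "gcm A \<longleftrightarrow> dim_col A = dim_row A \<and>
     (\<forall>i<dim_row A. A $$ (i,i) = 2) \<and>
     (\<forall>i<dim_row A. \<forall>j<dim_row A. i \<noteq> j \<longrightarrow> A $$ (i,j) \<le> 0) \<and>
     (\<forall>i<dim_row A. \<forall>j<dim_row A. A $$ (j,i) = 0 \<longrightarrow> A $$ (i,j) = 0)"

definition symmetrizable :: "int mat \<Rightarrow> bool" where
  "symmetrizable A \<longleftrightarrow>
     (\<exists>D :: rat mat. D \<in> carrier_mat (dim_row A) (dim_row A) \<and> diagonal_mat D \<and>
        (\<forall>i<dim_row A. D $$ (i,i) > 0) \<and>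
        transpose_mat (D * map_mat rat_of_int A) = D * map_mat rat_of_int A)"

definition permutation_equivalent :: "int mat \<Rightarrow> int mat \<Rightarrow> bool" where
  "permutation_equivalent B A \<longleftrightarrow>
     (\<exists>p. p permutes {..<dim_row A} \<and>
        B = mat (dim_row A) (dim_col A) (\<lambda>(i,j). A $$ (p i, p j)))"

definition indecomposable :: "int mat \<Rightarrow> bool" where
  "indecomposable A \<longleftrightarrow> dim_row A > 0 \<and>
     \<not> (\<exists>S. S \<noteq> {} \<and> S \<subset> {..<dim_row A} \<and>
          (\<forall>i\<in>S. \<forall>j\<in>{..<dim_row A} - S. A $$ (i,j) = 0 \<and> A $$ (j,i) = 0))"


text \<open>The classes (Fin), (Aff), (Ind) of Kac's trichotomy for indecomposable matrices. The order
  \<open>\<le>\<close> on vectors is the componentwise one; Kac's \<open>v > 0\<close> means that all entries are positive,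
  which is stronger than the strict part of \<open>\<le>\<close>.\<close>

definition pos_vec :: "real vec \<Rightarrow> bool" where
  "pos_vec v \<longleftrightarrow> (\<forall>i<dim_vec v. v $ i > 0)"

abbreviation real_mat :: "int mat \<Rightarrow> real mat" where
  "real_mat A \<equiv> map_mat real_of_int A"

definition finite_type :: "int mat \<Rightarrow> bool" where
  "finite_type A \<longleftrightarrow> gcm A \<and> indecomposable A \<and>
     (let n = dim_row A in
       det (real_mat A) \<noteq> 0 \<and>
       (\<exists>u \<in> carrier_vec n. pos_vec u \<and> pos_vec (real_mat A *\<^sub>v u)) \<and>
       (\<forall>v \<in> carrier_vec n. real_mat A *\<^sub>v v \<ge> 0\<^sub>v n \<longrightarrow> pos_vec v \<or> v = 0\<^sub>v n))"

definition affine_type :: "int mat \<Rightarrow> bool" where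
  "affine_type A \<longleftrightarrow> gcm A \<and> indecomposable A \<and>
     (let n = dim_row A in
       vec_space.rank n (real_mat A) + 1 = n \<and>
       (\<exists>u \<in> carrier_vec n. pos_vec u \<and> real_mat A *\<^sub>v u = 0\<^sub>v n) \<and>
       (\<forall>v \<in> carrier_vec n. real_mat A *\<^sub>v v \<ge> 0\<^sub>v n \<longrightarrow> real_mat A *\<^sub>v v = 0\<^sub>v n))"

definition indefinite_type :: "int mat \<Rightarrow> bool" where
  "indefinite_type A \<longleftrightarrow> gcm A \<and> indecomposable A \<and>
     (let n = dim_row A in
       (\<exists>u \<in> carrier_vec n. pos_vec u \<and> pos_vec (- (real_mat A *\<^sub>v u))) \<and>
       (\<forall>v \<in> carrier_vec n. real_mat A *\<^sub>v v \<ge> 0\<^sub>v n \<and> v \<ge> 0\<^sub>v n \<longrightarrow> v = 0\<^sub>v n))"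

text \<open>Subdiagrams are full: they correspond to sets \<open>S\<close> of vertices and hence to principal
  submatrices.\<close>

definition hyperbolic_type :: "int mat \<Rightarrow> bool" where
  "hyperbolic_type A \<longleftrightarrow> indefinite_type A \<and>
     (\<forall>S. S \<noteq> {} \<and> S \<subset> {..<dim_row A} \<and> indecomposable (submatrix A S S) \<longrightarrow>
        finite_type (submatrix A S S) \<or> affine_type (submatrix A S S))"


text \<open>A Dynkin diagram is given by its number of vertices and a list of edges; the edge
  \<open>(i, j, p, q)\<close> stands for \<open>a\<^sub>i\<^sub>j = - p\<close> and \<open>a\<^sub>j\<^sub>i = - q\<close>. As \<open>a\<^sub>i\<^sub>j\<close> is the value of the root
  \<open>\<alpha>\<^sub>j\<close> on the coroot of \<open>\<alpha>\<^sub>i\<close>, for \<open>p < q\<close> the root \<open>\<alpha>\<^sub>j\<close> is shorter than \<open>\<alpha>\<^sub>i\<close>, i.e. the arrow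
  points from \<open>i\<close> to \<open>j\<close>.\<close>

type_synonym edge = "nat \<times> nat \<times> int \<times> int"

definition diagram_mat :: "nat \<Rightarrow> edge list \<Rightarrow> int mat" where
  "diagram_mat n es = mat n n (\<lambda>(i,j). if i = j then 2 else
     - (\<Sum>(k,l,p,q)\<leftarrow>es. (if (k,l) = (i,j) then p else if (k,l) = (j,i) then q else 0)))"

definition chain :: "nat \<Rightarrow> nat \<Rightarrow> edge list" where
  "chain a b = map (\<lambda>i. (i, Suc i, 1, 1)) [a..<b]"

text \<open>The types \<open>X\<^sub>l\<^sup>(\<^sup>1\<^sup>)\<close>. In the classical series, \<open>F\<^sub>4\<close> and \<open>G\<^sub>2\<close>, the vertex \<open>0\<close> is the affine
  one; in \<open>E\<^sub>6\<close>, \<open>E\<^sub>7\<close>, \<open>E\<^sub>8\<close> the vertices of a longest chain come first, and the remaining ones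
  form the branch.\<close>

inductive_set untwisted_affine_diagrams :: "(nat \<times> edge list) set" where
  A1: "(2, [(0, 1, 2, 2)]) \<in> untwisted_affine_diagrams"
| A: "l \<ge> 2 \<Longrightarrow> (l + 1, chain 0 l @ [(l, 0, 1, 1)]) \<in> untwisted_affine_diagrams"
| B: "l \<ge> 3 \<Longrightarrow>
    (l + 1, (0, 2, 1, 1) # chain 1 (l - 1) @ [(l - 1, l, 1, 2)]) \<in> untwisted_affine_diagrams"
| C: "l \<ge> 2 \<Longrightarrow>
    (l + 1, (0, 1, 1, 2) # chain 1 (l - 1) @ [(l - 1, l, 2, 1)]) \<in> untwisted_affine_diagrams"
| D: "l \<ge> 4 \<Longrightarrow>
    (l + 1, (0, 2, 1, 1) # chain 1 (l - 1) @ [(l - 2, l, 1, 1)]) \<in> untwisted_affine_diagrams"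
| E6: "(7, chain 0 4 @ [(2, 5, 1, 1), (5, 6, 1, 1)]) \<in> untwisted_affine_diagrams"
| E7: "(8, chain 0 6 @ [(3, 7, 1, 1)]) \<in> untwisted_affine_diagrams"
| E8: "(9, chain 0 7 @ [(5, 8, 1, 1)]) \<in> untwisted_affine_diagrams"
| F4: "(5, chain 0 2 @ [(2, 3, 1, 2), (3, 4, 1, 1)]) \<in> untwisted_affine_diagrams"
| G2: "(3, [(0, 1, 1, 1), (1, 2, 1, 3)]) \<in> untwisted_affine_diagrams"

definition untwisted_affine_type :: "int mat \<Rightarrow> bool" where
  "untwisted_affine_type A \<longleftrightarrow>
     (\<exists>(n, es) \<in> untwisted_affine_diagrams. permutation_equivalent A (diagram_mat n es))"


text \<open>The Cartan subalgebra \<open>\<hh>\<close> is taken to be \<open>\<complex>\<^sup>n \<oplus> ker A\<close>, with coroots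
  \<open>\<alpha>\<^sub>i\<^sup>\<or> = (e\<^sub>i, 0)\<close> and roots \<open>\<alpha>\<^sub>j(x, d) = \<Sum>\<^sub>i x\<^sub>i a\<^sub>i\<^sub>j + d\<^sub>j\<close>. This is a (minimal) realization of \<open>A\<close>
  over \<open>\<complex>\<close>, hence the realization up to isomorphism: \<open>dim \<hh> = 2 n - rank A\<close>, the coroots are
  obviously linearly independent, and if \<open>\<Sum>\<^sub>j c\<^sub>j \<alpha>\<^sub>j = 0\<close>, then \<open>c\<close> lies in \<open>ker A\<close> and is orthogonal
  to \<open>ker A\<close>; since \<open>A\<close> is real, \<open>ker A\<close> is stable under conjugation, so \<open>c = 0\<close>.\<close>

type_synonym cvec = "complex vec \<times> complex vec"

definition cartan :: "int mat \<Rightarrow> cvec set" where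
  "cartan A = {(x, d). x \<in> carrier_vec (dim_row A) \<and> d \<in> carrier_vec (dim_row A) \<and>
     map_mat complex_of_int A *\<^sub>v d = 0\<^sub>v (dim_row A)}"

fun cartan_add :: "cvec \<Rightarrow> cvec \<Rightarrow> cvec" where
  "cartan_add (x, d) (x', d') = (x + x', d + d')"

fun cartan_smult :: "complex \<Rightarrow> cvec \<Rightarrow> cvec" where
  "cartan_smult c (x, d) = (c \<cdot>\<^sub>v x, c \<cdot>\<^sub>v d)"

definition simple_coroot :: "int mat \<Rightarrow> nat \<Rightarrow> cvec" where
  "simple_coroot A i = (unit_vec (dim_row A) i, 0\<^sub>v (dim_row A))"

fun simple_root :: "int mat \<Rightarrow> nat \<Rightarrow> cvec \<Rightarrow> complex" where
  "simple_root A j (x, d) = (\<Sum>i<dim_row A. x $ i * of_int (A $$ (i,j))) + d $ j"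

lemma simple_root_simple_coroot:
  assumes "i < dim_row A" "j < dim_row A"
  shows "simple_root A j (simple_coroot A i) = of_int (A $$ (i,j))"
proof -
  have "(\<Sum>k<dim_row A. unit_vec (dim_row A) i $ k * complex_of_int (A $$ (k,j)))
      = (\<Sum>k<dim_row A. if k = i then of_int (A $$ (k,j)) else 0)"
    using assms by (intro sum.cong) auto
  then show ?thesis using assms by (simp add: simple_coroot_def)
qed

text \<open>An element \<open>\<beta> = \<Sum>\<^sub>j b\<^sub>j \<alpha>\<^sub>j\<close> of the root lattice is represented by its coordinate vector
  \<open>b \<in> \<int>\<^sup>n\<close>, and likewise an element of the coroot lattice by its coordinates with respect to the
  \<open>\<alpha>\<^sub>i\<^sup>\<or>\<close>; \<open>functional A b\<close> is the element of \<open>\<hh>\<^sup>*\<close> that \<open>b\<close> represents.\<close>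

definition functional :: "int mat \<Rightarrow> int vec \<Rightarrow> cvec \<Rightarrow> complex" where
  "functional A b h = (\<Sum>j<dim_row A. of_int (b $ j) * simple_root A j h)"


text \<open>The Lie algebra \<open>\<gg>~(A)\<close> generated by \<open>e\<^sub>i\<close>, \<open>f\<^sub>i\<close> and \<open>\<hh>\<close> subject to
  \<open>[e\<^sub>i, f\<^sub>j] = \<delta>\<^sub>i\<^sub>j \<alpha>\<^sub>i\<^sup>\<or>\<close>, \<open>[h, h'] = 0\<close>, \<open>[h, e\<^sub>i] = \<alpha>\<^sub>i(h) e\<^sub>i\<close>, \<open>[h, f\<^sub>i] = - \<alpha>\<^sub>i(h) f\<^sub>i\<close>
  is the set of formal expressions \<open>lie_terms A\<close> modulo \<open>tilde_eq A\<close>, the congruence generated by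
  the axioms of a complex Lie algebra, the vector space structure of \<open>\<hh>\<close> and these relations.\<close>

datatype lie_term =
    Gen_e nat
  | Gen_f nat
  | Gen_h cvec
  | Zero
  | Add lie_term lie_term
  | Smult complex lie_term
  | Bracket lie_term lie_term

inductive_set lie_terms :: "int mat \<Rightarrow> lie_term set" for A where
  "i < dim_row A \<Longrightarrow> Gen_e i \<in> lie_terms A"
| "i < dim_row A \<Longrightarrow> Gen_f i \<in> lie_terms A"
| "h \<in> cartan A \<Longrightarrow> Gen_h h \<in> lie_terms A"
| "Zero \<in> lie_terms A"
| "x \<in> lie_terms A \<Longrightarrow> y \<in> lie_terms A \<Longrightarrow> Add x y \<in> lie_terms A"
| "x \<in> lie_terms A \<Longrightarrow> Smult c x \<in> lie_terms A"
| "x \<in> lie_terms A \<Longrightarrow> y \<in> lie_terms A \<Longrightarrow> Bracket x y \<in> lie_terms A"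

inductive tilde_eq :: "int mat \<Rightarrow> lie_term \<Rightarrow> lie_term \<Rightarrow> bool" for A where
  refl: "x \<in> lie_terms A \<Longrightarrow> tilde_eq A x x"
| sym: "tilde_eq A x y \<Longrightarrow> tilde_eq A y x"
| trans: "tilde_eq A x y \<Longrightarrow> tilde_eq A y z \<Longrightarrow> tilde_eq A x z"
| Add_cong: "tilde_eq A x x' \<Longrightarrow> tilde_eq A y y' \<Longrightarrow> tilde_eq A (Add x y) (Add x' y')"
| Smult_cong: "tilde_eq A x x' \<Longrightarrow> tilde_eq A (Smult c x) (Smult c x')"
| Bracket_cong:
    "tilde_eq A x x' \<Longrightarrow> tilde_eq A y y' \<Longrightarrow> tilde_eq A (Bracket x y) (Bracket x' y')"
| Add_assoc: "x \<in> lie_terms A \<Longrightarrow> y \<in> lie_terms A \<Longrightarrow> z \<in> lie_terms A \<Longrightarrow>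
    tilde_eq A (Add (Add x y) z) (Add x (Add y z))"
| Add_commute: "x \<in> lie_terms A \<Longrightarrow> y \<in> lie_terms A \<Longrightarrow> tilde_eq A (Add x y) (Add y x)"
| Add_Zero: "x \<in> lie_terms A \<Longrightarrow> tilde_eq A (Add x Zero) x"
| Add_neg: "x \<in> lie_terms A \<Longrightarrow> tilde_eq A (Add x (Smult (-1) x)) Zero"
| Smult_one: "x \<in> lie_terms A \<Longrightarrow> tilde_eq A (Smult 1 x) x"
| Smult_mult: "x \<in> lie_terms A \<Longrightarrow> tilde_eq A (Smult (a * b) x) (Smult a (Smult b x))"
| Smult_add_left:
    "x \<in> lie_terms A \<Longrightarrow> tilde_eq A (Smult (a + b) x) (Add (Smult a x) (Smult b x))"
| Smult_add_right: "x \<in> lie_terms A \<Longrightarrow> y \<in> lie_terms A \<Longrightarrow>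
    tilde_eq A (Smult a (Add x y)) (Add (Smult a x) (Smult a y))"
| Bracket_Add_left: "x \<in> lie_terms A \<Longrightarrow> y \<in> lie_terms A \<Longrightarrow> z \<in> lie_terms A \<Longrightarrow>
    tilde_eq A (Bracket (Add x y) z) (Add (Bracket x z) (Bracket y z))"
| Bracket_Add_right: "x \<in> lie_terms A \<Longrightarrow> y \<in> lie_terms A \<Longrightarrow> z \<in> lie_terms A \<Longrightarrow>
    tilde_eq A (Bracket x (Add y z)) (Add (Bracket x y) (Bracket x z))"
| Bracket_Smult_left: "x \<in> lie_terms A \<Longrightarrow> y \<in> lie_terms A \<Longrightarrow>
    tilde_eq A (Bracket (Smult c x) y) (Smult c (Bracket x y))"
| Bracket_Smult_right: "x \<in> lie_terms A \<Longrightarrow> y \<in> lie_terms A \<Longrightarrow>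
    tilde_eq A (Bracket x (Smult c y)) (Smult c (Bracket x y))"
| Bracket_self: "x \<in> lie_terms A \<Longrightarrow> tilde_eq A (Bracket x x) Zero"
| Jacobi: "x \<in> lie_terms A \<Longrightarrow> y \<in> lie_terms A \<Longrightarrow> z \<in> lie_terms A \<Longrightarrow>
    tilde_eq A
      (Add (Bracket x (Bracket y z)) (Add (Bracket y (Bracket z x)) (Bracket z (Bracket x y)))) Zero"
| h_Add: "h \<in> cartan A \<Longrightarrow> h' \<in> cartan A \<Longrightarrow>
    tilde_eq A (Add (Gen_h h) (Gen_h h')) (Gen_h (cartan_add h h'))"
| h_Smult: "h \<in> cartan A \<Longrightarrow> tilde_eq A (Smult c (Gen_h h)) (Gen_h (cartan_smult c h))"
| e_f: "i < dim_row A \<Longrightarrow> j < dim_row A \<Longrightarrow>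
    tilde_eq A (Bracket (Gen_e i) (Gen_f j)) (if i = j then Gen_h (simple_coroot A i) else Zero)"
| h_h: "h \<in> cartan A \<Longrightarrow> h' \<in> cartan A \<Longrightarrow> tilde_eq A (Bracket (Gen_h h) (Gen_h h')) Zero"
| h_e: "h \<in> cartan A \<Longrightarrow> i < dim_row A \<Longrightarrow>
    tilde_eq A (Bracket (Gen_h h) (Gen_e i)) (Smult (simple_root A i h) (Gen_e i))"
| h_f: "h \<in> cartan A \<Longrightarrow> i < dim_row A \<Longrightarrow>
    tilde_eq A (Bracket (Gen_h h) (Gen_f i)) (Smult (- simple_root A i h) (Gen_f i))"

definition lie_ideal :: "int mat \<Rightarrow> lie_term set \<Rightarrow> bool" where
  "lie_ideal A J \<longleftrightarrow> J \<subseteq> lie_terms A \<and> Zero \<in> J \<and>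
     (\<forall>x\<in>J. \<forall>y. tilde_eq A x y \<longrightarrow> y \<in> J) \<and>
     (\<forall>x\<in>J. \<forall>y\<in>J. Add x y \<in> J) \<and>
     (\<forall>c. \<forall>x\<in>J. Smult c x \<in> J) \<and>
     (\<forall>x\<in>lie_terms A. \<forall>y\<in>J. Bracket x y \<in> J)"

text \<open>The largest ideal of \<open>\<gg>~(A)\<close> that intersects \<open>\<hh>\<close> trivially; the sum of all such ideals again
  is such an ideal, and so it equals their union.\<close>

definition max_ideal :: "int mat \<Rightarrow> lie_term set" where
  "max_ideal A = \<Union> {J. lie_ideal A J \<and>
     (\<forall>h\<in>cartan A. Gen_h h \<in> J \<longrightarrow> tilde_eq A (Gen_h h) Zero)}"

text \<open>The Kac-Moody algebra \<open>\<gg>(A)\<close> is the quotient of \<open>\<gg>~(A)\<close> by this ideal: its elements are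
  represented by those of \<open>lie_terms A\<close>, and equality of the represented elements is \<open>km_eq A\<close>.\<close>

definition km_eq :: "int mat \<Rightarrow> lie_term \<Rightarrow> lie_term \<Rightarrow> bool" where
  "km_eq A x y \<longleftrightarrow> x \<in> lie_terms A \<and> y \<in> lie_terms A \<and> Add x (Smult (-1) y) \<in> max_ideal A"

definition root_space :: "int mat \<Rightarrow> int vec \<Rightarrow> lie_term set" where
  "root_space A b = {x \<in> lie_terms A.
     \<forall>h\<in>cartan A. km_eq A (Bracket (Gen_h h) x) (Smult (functional A b h) x)}"

definition roots :: "int mat \<Rightarrow> int vec set" where
  "roots A = {b \<in> carrier_vec (dim_row A). b \<noteq> 0\<^sub>v (dim_row A) \<and>
     (\<exists>x\<in>root_space A b. \<not> km_eq A x Zero)}"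


text \<open>The simple reflections in coordinates: \<open>r\<^sub>i(\<beta>) = \<beta> - \<beta>(\<alpha>\<^sub>i\<^sup>\<or>) \<alpha>\<^sub>i\<close> on the root lattice and
  \<open>r\<^sub>i(h) = h - \<alpha>\<^sub>i(h) \<alpha>\<^sub>i\<^sup>\<or>\<close> on the coroot lattice. An element of the Weyl group is given by a word
  in the simple reflections.\<close>

definition reflect :: "int mat \<Rightarrow> nat \<Rightarrow> int vec \<Rightarrow> int vec" where
  "reflect A i b = b - ((A *\<^sub>v b) $ i) \<cdot>\<^sub>v unit_vec (dim_row A) i"

definition coreflect :: "int mat \<Rightarrow> nat \<Rightarrow> int vec \<Rightarrow> int vec" where
  "coreflect A i c = c - ((transpose_mat A *\<^sub>v c) $ i) \<cdot>\<^sub>v unit_vec (dim_row A) i"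

definition real_roots :: "int mat \<Rightarrow> int vec set" where
  "real_roots A = {foldr (reflect A) w (unit_vec (dim_row A) i) | w i.
     set w \<subseteq> {..<dim_row A} \<and> i < dim_row A}"

text \<open>The coroot of \<open>\<beta> = w(\<alpha>\<^sub>i)\<close> is \<open>w(\<alpha>\<^sub>i\<^sup>\<or>)\<close>, which does not depend on the choice of \<open>w\<close> and \<open>i\<close>.\<close>

definition coroot :: "int mat \<Rightarrow> int vec \<Rightarrow> int vec" where
  "coroot A b = (THE c. \<exists>w i. set w \<subseteq> {..<dim_row A} \<and> i < dim_row A \<and>
     b = foldr (reflect A) w (unit_vec (dim_row A) i) \<and>
     c = foldr (coreflect A) w (unit_vec (dim_row A) i))"

definition pairing :: "int mat \<Rightarrow> int vec \<Rightarrow> int vec \<Rightarrow> int" where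
  "pairing A c b = c \<bullet> (A *\<^sub>v b)"


text \<open>A \<open>\<pi>\<close>-system is given by an enumeration of it, so that its type is a matrix rather than a
  matrix up to simultaneous permutation of rows and columns.\<close>

definition pi_system :: "int mat \<Rightarrow> int vec list \<Rightarrow> bool" where
  "pi_system A bs \<longleftrightarrow> distinct bs \<and> set bs \<subseteq> real_roots A \<and>
     (\<forall>i<length bs. \<forall>j<length bs. i \<noteq> j \<longrightarrow> bs ! i - bs ! j \<notin> roots A)"

definition pi_type :: "int mat \<Rightarrow> int vec list \<Rightarrow> int mat" where
  "pi_type A bs =
     mat (length bs) (length bs) (\<lambda>(i,j). pairing A (coroot A (bs ! i)) (bs ! j))"

text \<open>Linear independence in \<open>\<hh>\<^sup>*\<close>.\<close>

definition lin_independent :: "int mat \<Rightarrow> int vec list \<Rightarrow> bool" where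
  "lin_independent A bs \<longleftrightarrow>
     (\<forall>c :: nat \<Rightarrow> complex. (\<forall>h\<in>cartan A. (\<Sum>i<length bs. c i * functional A (bs ! i) h) = 0) \<longrightarrow>
        (\<forall>i<length bs. c i = 0))"

text \<open>The relation is defined between symmetrizable generalized Cartan matrices only.\<close>

definition gcm_preceq :: "int mat \<Rightarrow> int mat \<Rightarrow> bool" (infix "\<preceq>\<^sub>\<pi>" 50) where
  "B \<preceq>\<^sub>\<pi> A \<longleftrightarrow> gcm A \<and> symmetrizable A \<and> gcm B \<and> symmetrizable B \<and>
     (\<exists>bs. pi_system A bs \<and> lin_independent A bs \<and> pi_type A bs = B)"

end

theory Submission
  imports Defs "HOL-Library.Function_Algebras"
begin

text \<open>The real roots of \<open>A\<close> are the orbit of the simple roots under the Weyl group, and each is a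
  nonnegative or a nonpositive combination of simple roots. A linearly independent \<open>\<pi>\<close>-system of
  type \<open>B\<close> in \<open>A\<close> and one of type \<open>A\<close> in \<open>B\<close> force equal ranks and compose to real roots
  \<open>\<rho>\<^sub>1, \<dots>, \<rho>\<^sub>n\<close> of \<open>A\<close> that are themselves of type \<open>A\<close>. If they are simple, so are the two families,
  up to the Weyl group.

  If \<open>A\<close> is of finite or hyperbolic type, the form is nondegenerate and the inverse of \<open>A\<close> has entries
  of one sign. An element of the Weyl group makes the \<open>\<rho>\<^sub>j\<close> positive. The integral
  coordinate matrices of the \<open>\<rho>\<^sub>j\<close> and of their coroots then transform the inverse of \<open>A\<close> into itself,
  and comparing the sums of the entries shows that the \<open>\<rho>\<^sub>j\<close> are simple.

  If \<open>A\<close> is untwisted affine, the composite permutes the finite set of real roots modulo \<open>\<delta>\<close>.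
  Hence the members of the \<open>\<pi>\<close>-system, shifted by suitable multiples of \<open>\<delta>\<close>, form a basis of the root
  lattice. As their differences are not roots, all real roots have coordinates of one sign in this
  basis, so a Weyl group element maps it to the set of simple roots. Only this case
  involves the Lie algebra: real roots have to be roots of it, which follows from an
  \<open>\<ss>\<ll>\<^sub>2\<close>-argument modulo the maximal ideal.\<close>

section \<open>Real roots of a generalized Cartan matrix\<close>

text \<open>All that is known about \<open>B\<close> comes from the two embeddings. The element of
  the Weyl group that makes a family positive is found by moving a vector on which all coroots of
  the family are positive into the dominant chamber; this stops if the orbit is bounded against a
  strictly dominant vector. In finite type the form is definite and such vectors exist. In
  hyperbolic type they have negative norm, and one must control in which half of the cone they lie,
  possibly replacing the family by its negative. For \<open>B\<close> such a vector comes from a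
  general fact: a symmetric matrix with nonpositive off-diagonal entries that is not semidefinite
  maps some nonnegative vector to a nonzero nonpositive one.

  In affine type the matrix is singular and the composite need not be conjugate to the simple roots:
  in A_1^(1) the roots \<alpha> and 3\<delta> - \<alpha> again have type A_1^(1). The type only sees
  roots modulo \<delta>, so multiples of \<delta> must be corrected first.\<close>

definition ev :: "nat \<Rightarrow> nat \<Rightarrow> int" where
  "ev i = (\<lambda>k. if k = i then 1 else 0)"

lemma ev_apply [simp]: "ev i i = 1" "k \<noteq> i \<Longrightarrow> ev i k = 0"
  by (auto simp: ev_def)

lemma ev_inject [simp]: "ev i = ev j \<longleftrightarrow> i = j"
  by (metis ev_apply zero_neq_one)

lemma sum_mult_ev [simp]: "i < n \<Longrightarrow> (\<Sum>k<n. f k * ev i k) = f i"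
  by (simp add: ev_def if_distrib cong: if_cong)

lemma sum_ev_mult [simp]: "i < n \<Longrightarrow> (\<Sum>k<n. ev i k * f k) = f i"
  using sum_mult_ev[of i n f] by (simp add: mult.commute)

definition nonneg :: "(nat \<Rightarrow> int) \<Rightarrow> bool" where
  "nonneg x \<longleftrightarrow> (\<forall>k. x k \<ge> 0)"

text \<open>Lattice vectors are total functions on the naturals that vanish from \<open>n\<close>
  on. All ranks then share one type, and equality of vectors is equality of functions.\<close>

definition supported :: "nat \<Rightarrow> (nat \<Rightarrow> int) \<Rightarrow> bool" where
  "supported n x \<longleftrightarrow> (\<forall>k\<ge>n. x k = 0)"

definition height :: "nat \<Rightarrow> (nat \<Rightarrow> int) \<Rightarrow> int" where
  "height n x = (\<Sum>k<n. x k)"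

lemma supportedD: "supported n x \<Longrightarrow> k \<ge> n \<Longrightarrow> x k = 0"
  by (simp add: supported_def)

lemma supported_ev [simp]: "i < n \<Longrightarrow> supported n (ev i)"
  by (simp add: supported_def)

lemma supported_uminus [simp]: "supported n (- x) \<longleftrightarrow> supported n x"
  by (simp add: supported_def)

lemma supported_add: "supported n x \<Longrightarrow> supported n y \<Longrightarrow> supported n (x + y)"
  by (simp add: supported_def)

lemma supported_diff: "supported n x \<Longrightarrow> supported n y \<Longrightarrow> supported n (x - y)"
  by (simp add: supported_def)

lemma supported_scale: "supported n x \<Longrightarrow> supported n (\<lambda>k. c * x k)"
  by (simp add: supported_def)

lemma nonneg_ev [simp]: "nonneg (ev i)"
  by (simp add: nonneg_def ev_def)

lemma nonnegD: "nonneg x \<Longrightarrow> 0 \<le> x k"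
  by (simp add: nonneg_def)

lemma height_pos:
  assumes "nonneg x" "supported n x" "x \<noteq> 0"
  shows "height n x > 0"
proof -
  obtain k where k: "x k \<noteq> 0" using assms(3) by (auto simp: fun_eq_iff)
  then have "k < n" using assms(2) by (meson not_le supportedD)
  then show ?thesis unfolding height_def
    using assms(1) k by (intro sum_pos2[of _ k]) (auto simp: nonneg_def order.order_iff_strict)
qed

lemma nonneg_height_one:
  assumes "nonneg x" "supported n x" "height n x = 1"
  obtains i where "i < n" "x = ev i"
proof -
  have "\<exists>i<n. x i \<noteq> 0"
    using assms(3) by (metis height_def lessThan_iff sum.neutral zero_neq_one)
  then obtain i where i: "i < n" "x i \<noteq> 0" by blast
  have xi: "x i \<ge> 1" using i(2) nonnegD[OF assms(1), of i] by linarith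
  have "(\<Sum>k\<in>{..<n}-{i}. x k) = 1 - x i"
    using assms(3) i(1) by (simp add: height_def sum_diff1)
  moreover have "(\<Sum>k\<in>{..<n}-{i}. x k) \<ge> 0"
    using assms(1) by (intro sum_nonneg) (auto simp: nonneg_def)
  ultimately have x1: "x i = 1" and s0: "(\<Sum>k\<in>{..<n}-{i}. x k) = 0" using xi by linarith+
  have "x k = 0" if "k \<noteq> i" for k
  proof (cases "k < n")
    case True
    with s0 that assms(1) show ?thesis
      by (subst (asm) sum_nonneg_eq_0_iff) (auto simp: nonneg_def)
  qed (use assms(2) in \<open>auto simp: supported_def\<close>)
  then have "x = ev i" using x1 by (auto simp: ev_def)
  then show ?thesis using i(1) that by blast
qed

section \<open>Simple reflections and the signs of real roots\<close>

locale gcm_system =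
  fixes n :: nat and a :: "nat \<Rightarrow> nat \<Rightarrow> int"
  assumes diag: "i < n \<Longrightarrow> a i i = 2"
    and offdiag: "i < n \<Longrightarrow> j < n \<Longrightarrow> i \<noteq> j \<Longrightarrow> a i j \<le> 0"
    and zero_sym: "i < n \<Longrightarrow> j < n \<Longrightarrow> a j i = 0 \<Longrightarrow> a i j = 0"
begin

text \<open>\<open>pr i x\<close> is the value of the element \<open>x\<close> of the root lattice on the simple coroot \<open>\<alpha>\<^sub>i\<^sup>\<or>\<close>.\<close>

definition pr :: "nat \<Rightarrow> (nat \<Rightarrow> int) \<Rightarrow> int" where
  "pr i x = (\<Sum>j<n. a i j * x j)"

definition refl :: "nat \<Rightarrow> (nat \<Rightarrow> int) \<Rightarrow> nat \<Rightarrow> int" where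
  "refl i x = x(i := x i - pr i x)"

lemma pr_diff: "pr i (x - y) = pr i x - pr i y"
  by (simp add: pr_def sum_subtractf algebra_simps)

lemma pr_uminus: "pr i (- x) = - pr i x"
  by (simp add: pr_def sum_negf)

lemma pr_zero [simp]: "pr i 0 = 0"
  by (simp add: pr_def)

lemma pr_scale: "pr i (\<lambda>k. c * x k) = c * pr i x"
  by (simp add: pr_def sum_distrib_left algebra_simps)

lemma pr_ev [simp]: "j < n \<Longrightarrow> pr i (ev j) = a i j"
  by (simp add: pr_def)

lemma pr_sum: "pr i (\<lambda>k. \<Sum>j<m. x j * b j k) = (\<Sum>j<m. x j * pr i (b j))"
  unfolding pr_def sum_distrib_left by (subst sum.swap) (simp add: algebra_simps)

lemma refl_eq: "refl i x = x - (\<lambda>k. pr i x * ev i k)"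
  by (auto simp: refl_def ev_def)

lemma pr_refl: "i < n \<Longrightarrow> pr j (refl i x) = pr j x - pr i x * a j i"
  by (simp add: refl_eq pr_diff pr_scale)

lemma refl_refl [simp]: "i < n \<Longrightarrow> refl i (refl i x) = x"
  using pr_refl[of i i x] by (auto simp: refl_def diag)

lemma refl_uminus: "refl i (- x) = - refl i x"
  by (auto simp: refl_eq pr_uminus)

lemma refl_diff: "refl i (x - y) = refl i x - refl i y"
  by (auto simp: refl_eq pr_diff algebra_simps)

lemma refl_scale: "refl i (\<lambda>k. c * x k) = (\<lambda>k. c * refl i x k)"
  by (auto simp: refl_eq pr_scale algebra_simps)

lemma refl_ev: "i < n \<Longrightarrow> refl i (ev i) = - ev i"
  by (rule ext) (simp add: refl_eq diag)

lemma supported_refl: "i < n \<Longrightarrow> supported n x \<Longrightarrow> supported n (refl i x)"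
  by (auto simp: supported_def refl_def)

lemma height_refl: "i < n \<Longrightarrow> height n (refl i x) = height n x - pr i x"
  by (simp add: refl_eq height_def sum_subtractf flip: sum_distrib_left)
    (simp add: ev_def)

inductive_set rts :: "(nat \<Rightarrow> int) set" where
  rts_simple: "i < n \<Longrightarrow> ev i \<in> rts"
| rts_refl: "x \<in> rts \<Longrightarrow> i < n \<Longrightarrow> refl i x \<in> rts"

text \<open>Roots reached from simple ones by reflections that raise the height, hence positive by
  construction. That every positive real root arises in this way rests on
  \<open>asc_descend\<close>.\<close>

inductive_set asc :: "(nat \<Rightarrow> int) set" where
  asc_simple: "i < n \<Longrightarrow> ev i \<in> asc"
| asc_refl: "x \<in> asc \<Longrightarrow> i < n \<Longrightarrow> pr i x < 0 \<Longrightarrow> refl i x \<in> asc"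

lemma asc_props:
  assumes "x \<in> asc"
  shows "nonneg x" "supported n x" "x \<noteq> 0"
proof -
  have "nonneg x \<and> supported n x \<and> x \<noteq> 0"
    using assms
  proof induction
    case (asc_simple i)
    have "ev i \<noteq> 0" by (metis ev_apply(1) zero_fun_apply zero_neq_one)
    then show ?case using asc_simple supported_ev nonneg_ev by blast
  next
    case (asc_refl x i)
    then have "refl i x k \<ge> x k" for k by (simp add: refl_def)
    moreover have "supported n (refl i x)" using asc_refl by (simp add: supported_refl)
    moreover obtain k where "x k > 0"
      using asc_refl.IH by (metis nonneg_def order.order_iff_strict zero_fun_apply ext)
    ultimately show ?case using asc_refl.IH unfolding nonneg_def
      by (metis order.trans order.strict_trans2 less_irrefl zero_fun_apply)
  qed
  then show "nonneg x" "supported n x" "x \<noteq> 0" by auto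
qed

text \<open>Coordinates (s, t) on the coset of \<open>x\<close> modulo \<alpha>_i and \<alpha>_j,
  which contains the orbit of \<open>x\<close> under the dihedral group generated by the two
  reflections.\<close>

definition shift :: "nat \<Rightarrow> nat \<Rightarrow> (nat \<Rightarrow> int) \<Rightarrow> int \<Rightarrow> int \<Rightarrow> nat \<Rightarrow> int" where
  "shift i j x s t = (\<lambda>k. x k - s * ev i k - t * ev j k)"

lemma pr_shift: "i < n \<Longrightarrow> j < n \<Longrightarrow> pr k (shift i j x s t) = pr k x - s * a k i - t * a k j"
  using pr_diff[of k "x - (\<lambda>k. s * ev i k)" "\<lambda>k. t * ev j k"] pr_diff[of k x "\<lambda>k. s * ev i k"]
  by (simp add: shift_def pr_scale fun_diff_def)

lemma refl_shift_left:
  assumes "i < n" "j < n"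
  shows "refl i (shift i j x s t) = shift i j x (s + pr i (shift i j x s t)) t"
  by (rule ext) (simp add: refl_eq, simp add: shift_def algebra_simps)

lemma refl_shift_right:
  assumes "i < n" "j < n"
  shows "refl j (shift i j x s t) = shift i j x s (t + pr j (shift i j x s t))"
  by (rule ext) (simp add: refl_eq, simp add: shift_def algebra_simps)

lemma height_shift: "i < n \<Longrightarrow> j < n \<Longrightarrow> height n (shift i j x s t) = height n x - s - t"
  by (simp add: shift_def height_def sum_subtractf flip: sum_distrib_left) (simp add: ev_def)

text \<open>Reflecting alternately in \<open>i\<close> and \<open>j\<close> lowers the height each
  time, and the last inequality on \<open>y\<close> reproduces itself with \<open>i\<close> and
  \<open>j\<close> exchanged because a_ij a_ji \<ge> 4. It also keeps \<open>y\<close> from being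
  \<open>ev i\<close>, where the descent would stop. Heights in \<open>asc\<close> are positive, so
  this cannot go on.\<close>

lemma no_infinite_dihedral_descent:
  assumes ij: "i < n" "j < n" "i \<noteq> j" and ab: "a i j * a j i \<ge> 4"
    and down: "\<And>y k. y \<in> asc \<Longrightarrow> height n y < h \<Longrightarrow> k < n \<Longrightarrow> pr k y > 0 \<Longrightarrow> y = ev k \<or> refl k y \<in> asc"
    and y: "y \<in> asc" "height n y < h" "pr i y > 0" "pr j y \<le> 0" "2 * pr i y > a i j * pr j y"
  shows False
  using ij ab y
proof (induction "nat (height n y)" arbitrary: y i j rule: less_induct)
  case less
  define p q where "p = pr i y" and "q = pr j y"
  have neg: "a i j < 0" "a j i < 0"
    using less.prems(1-4) offdiag[of i j] offdiag[of j i]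
    by (auto simp: order.order_iff_strict)
  have "y \<noteq> ev i"
  proof
    assume "y = ev i"
    then have "4 > a i j * a j i" using less.prems by (simp add: diag)
    then show False using less.prems by linarith
  qed
  then have y': "refl i y \<in> asc" using down less.prems by blast
  have pi: "pr i (refl i y) = - p" and pj: "pr j (refl i y) = q - p * a j i"
    using less.prems(1) by (simp_all add: pr_refl p_def q_def diag)
  have p: "p > 0" "q \<le> 0" "2 * p > a i j * q" using less.prems by (auto simp: p_def q_def)
  have "p * a j i < 0" using p neg by (simp add: mult_pos_neg)
  have "2 * (- p * a j i) > (a i j * a j i) * (- q)"
    using mult_strict_right_mono[of "a i j * q" "2 * p" "- a j i"] p neg by (simp add: algebra_simps)
  moreover have "(a i j * a j i) * (- q) \<ge> 4 * (- q)"
    using mult_right_mono[OF less.prems(4), of "- q"] p by simp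
  ultimately have key: "- p * a j i > 2 * (- q)" by linarith
  have "height n (refl i y) = height n y - p" using less.prems(1) by (simp add: height_refl p_def)
  moreover have "height n y > 0" using height_pos[OF asc_props[OF less.prems(5)]] .
  ultimately have *: "nat (height n (refl i y)) < nat (height n y)" "height n (refl i y) < h"
    using p less.prems by linarith+
  have "j \<noteq> i" "a j i * a i j \<ge> 4" using less.prems(3,4) by (simp_all add: mult.commute)
  moreover have "pr j (refl i y) > 0" "pr i (refl i y) \<le> 0" using pi pj p key by linarith+
  moreover have "2 * pr j (refl i y) > a j i * pr i (refl i y)"
    unfolding pi pj using key by (simp add: algebra_simps)
  ultimately show False using less.hyps[OF *(1) less.prems(2,1) _ _ y' *(2)] by blast
qed

text \<open>Induction on the height. If \<open>x\<close> was reached by r_j with j \<noteq> i, both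
  of its pairings are positive, and the dihedral orbit offers a second way round from r_j x to r_i x
  through elements lower than \<open>x\<close>, where the induction hypothesis applies.\<close>

lemma asc_descend:
  assumes "x \<in> asc" "i < n" "pr i x > 0"
  shows "x = ev i \<or> refl i x \<in> asc"
  using assms
proof (induction "nat (height n x)" arbitrary: x i rule: less_induct)
  case less
  define h where "h = height n x"
  have hpos: "h > 0" using height_pos[OF asc_props[OF less.prems(1)]] by (simp add: h_def)
  have down: "y = ev k \<or> refl k y \<in> asc" if "y \<in> asc" "height n y < h" "k < n" "pr k y > 0" for y k
  proof -
    have "height n y > 0" using height_pos[OF asc_props[OF that(1)]] .
    then show ?thesis using less.hyps[of y k] that hpos by (auto simp: h_def)
  qed
  from less.prems(1) show ?case
  proof cases
    case (asc_simple k)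
    then show ?thesis using less.prems offdiag[of i k] by (cases "i = k") auto
  next
    case (asc_refl u j)
    show ?thesis
    proof (cases "i = j")
      case True
      then show ?thesis using asc_refl by simp
    next
      case False
      note ij = less.prems(2) \<open>j < n\<close> False
      define p q A B where "p = pr i x" and "q = pr j x" and "A = - a i j" and "B = - a j i"
      have p: "p > 0" using less.prems by (simp add: p_def)
      have q: "q > 0" using asc_refl by (simp add: q_def pr_refl diag)
      have AB: "A \<ge> 0" "B \<ge> 0" "A = 0 \<longleftrightarrow> B = 0"
        using ij offdiag zero_sym unfolding A_def B_def by (metis neg_0_le_iff_le, metis neg_0_le_iff_le, metis neg_equal_0_iff_equal)
      \<comment> \<open>The walk starts at (0, q), which is r_j x, and has to reach (p, 0), which is
        r_i x. Every point that is reflected has s + t > 0, hence smaller height than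
        \<open>x\<close>.\<close>
      define g where "g s t \<longleftrightarrow> shift i j x s t \<in> asc" for s t
      have pi: "pr i (shift i j x s t) = p - 2 * s + A * t"
        and pj: "pr j (shift i j x s t) = q + B * s - 2 * t" for s t
        using ij by (simp_all add: pr_shift p_def q_def A_def B_def diag)
      have u: "u = shift i j x 0 q"
        using asc_refl ij refl_shift_right[of i j x 0 0] by (simp add: shift_def q_def)
      have start: "g 0 q" using asc_refl(2) u by (simp add: g_def)
      \<comment> \<open>The excluded pairings are those of \<alpha>_i, the one case in which
        \<open>down\<close> lets the reflection leave \<open>asc\<close>.\<close>
      have step_i: "g (p - s + A * t) t"
        if "g s t" "s + t > 0" "\<not> (p - 2 * s + A * t = 2 \<and> q + B * s - 2 * t = - B)" for s t
      proof -
        let ?y = "shift i j x s t"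
        have y: "?y \<in> asc" using that by (simp add: g_def)
        have "?y \<noteq> ev i"
        proof
          assume "?y = ev i"
          then have "pr i ?y = 2" "pr j ?y = - B" using ij by (simp_all add: diag B_def)
          then show False using that(3) by (simp add: pi pj)
        qed
        then have "refl i ?y \<in> asc"
        proof (cases "pr i ?y" "0::int" rule: linorder_cases)
          case less
          then show ?thesis using y ij by (simp add: asc.asc_refl)
        next
          case equal
          then have "refl i ?y = ?y" by (simp add: refl_def)
          then show ?thesis using y by simp
        next
          case greater
          then show ?thesis using down[OF y _ ij(1)] that(2) \<open>?y \<noteq> ev i\<close> ij
            by (auto simp: height_shift h_def)
        qed
        then show ?thesis using ij by (simp add: g_def refl_shift_left pi algebra_simps)
      qed
      have step_j: "g s (q - t + B * s)"
        if "g s t" "s + t > 0" "\<not> (q + B * s - 2 * t = 2 \<and> p - 2 * s + A * t = - A)" for s t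
      proof -
        let ?y = "shift i j x s t"
        have y: "?y \<in> asc" using that by (simp add: g_def)
        have "?y \<noteq> ev j"
        proof
          assume "?y = ev j"
          then have "pr j ?y = 2" "pr i ?y = - A" using ij by (simp_all add: diag A_def)
          then show False using that(3) by (simp add: pi pj)
        qed
        then have "refl j ?y \<in> asc"
        proof (cases "pr j ?y" "0::int" rule: linorder_cases)
          case less
          then show ?thesis using y ij by (simp add: asc.asc_refl)
        next
          case equal
          then have "refl j ?y = ?y" by (simp add: refl_def)
          then show ?thesis using y by simp
        next
          case greater
          then show ?thesis using down[OF y _ ij(2)] that(2) \<open>?y \<noteq> ev j\<close> ij
            by (auto simp: height_shift h_def)
        qed
        then show ?thesis using ij by (simp add: g_def refl_shift_right pj algebra_simps)
      qed
      have goal: "refl i x \<in> asc" if "g p 0"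
        using that ij refl_shift_left[of i j x 0 0] by (simp add: g_def shift_def p_def)
      \<comment> \<open>The dihedral group is infinite for A B \<ge> 4 and otherwise has order 4, 6,
        8 or 12; the finite orbits are walked explicitly.\<close>
      consider "A * B \<ge> 4" | "A = 0" "B = 0" | "A = 1" "B = 1" | "A = 1" "B = 2" | "A = 2" "B = 1"
        | "A = 1" "B = 3" | "A = 3" "B = 1"
      proof -
        have False if "A \<noteq> 0" "A * B < 4"
          "\<not> (A = 1 \<and> B = 1)" "\<not> (A = 1 \<and> B = 2)" "\<not> (A = 2 \<and> B = 1)" "\<not> (A = 1 \<and> B = 3)" "\<not> (A = 3 \<and> B = 1)"
        proof -
          have "A \<ge> 1" "B \<ge> 1" using AB that by linarith+
          then have "A \<le> A * B" "B \<le> A * B" by simp_all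
          then have "A \<le> 3" "B \<le> 3" using that by linarith+
          then have "A = 1 \<or> A = 2 \<or> A = 3" "B = 1 \<or> B = 2 \<or> B = 3"
            using \<open>A \<ge> 1\<close> \<open>B \<ge> 1\<close> by linarith+
          then show False using that by auto
        qed
        then show ?thesis using that AB(3) by (metis not_le)
      qed
      then show ?thesis
      proof cases
        case 1
        have False
        proof (cases "u = ev i")
          case True
          then have "pr i u = 2" "pr j u = - B" using ij by (simp_all add: diag B_def)
          then have "p + A * q = 2" "q = B" using u by (simp_all add: pi pj)
          then show False using 1 p by simp
        next
          case False
          have "pr j u = - q" "pr i u = p + A * q" using u by (simp_all add: pi pj)
          moreover have "height n u < h" using u ij q by (simp add: height_shift h_def)
          moreover have "A * q \<ge> 0" using AB q by simp
          ultimately show False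
            using no_infinite_dihedral_descent[of i j h u] ij 1 down asc_refl(2) p q
            by (auto simp: A_def B_def mult.commute[of q])
        qed
        then show ?thesis ..
      next
        case 2
        show ?thesis using step_j[OF step_i[OF start]] goal p q 2 by simp
      next
        case 3
        show ?thesis
        proof (cases "p = 1 \<and> q = 1")
          case True
          \<comment> \<open>Here \<open>u\<close> has the pairings of \<alpha>_i, so u = \<alpha>_i
            is possible; then x = \<alpha>_i + \<alpha>_j.\<close>
          then have "pr i u = 2" "pr j u = - 1" using u 3 by (simp_all add: pi pj)
          show ?thesis
          proof (cases "u = ev i")
            case True
            then have "x = (\<lambda>k. ev i k + ev j k)"
              using u \<open>p = 1 \<and> q = 1\<close> by (auto simp: shift_def fun_eq_iff algebra_simps)
            then have "refl i x = ev j" using \<open>p = 1 \<and> q = 1\<close> by (auto simp: refl_eq p_def)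
            then show ?thesis using ij asc_simple by simp
          next
            case False
            then have "refl i u \<in> asc"
              using down[OF asc_refl(2) _ ij(1)] u ij q \<open>pr i u = 2\<close> by (simp add: height_shift h_def)
            then have "g 2 1" using u ij True 3
              by (simp add: g_def refl_shift_left pi)
            then have "g 2 2" using step_j[of 2 1] 3 True by simp
            then have "g 1 2" using step_i[of 2 2] 3 True by simp
            then have "g 1 0" using step_j[of 1 2] 3 True by simp
            then show ?thesis using goal True by simp
          qed
        next
          case False
          have "p + q \<noteq> 2" using False p q by presburger
          then have "g (p + q) q" using step_i[OF start] 3 p q by simp
          then have "g (p + q) (p + q)" using step_j[of "p + q" q] 3 p q by simp
          then have "g p (p + q)" using step_i[of "p + q" "p + q"] 3 p q by simp
          then have "g p 0" using step_j[of p "p + q"] 3 p q by simp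
          then show ?thesis using goal by simp
        qed
      next
        case 4
        have "g (p + q) (q)" using step_i[OF start] 4 p q by simp
        then have "g (p + q) (2 * p + 2 * q)"
          using step_j[of "p + q" "q"] 4 p q by (simp add: algebra_simps)
        then have "g (2 * p + q) (2 * p + 2 * q)"
          using step_i[of "p + q" "2 * p + 2 * q"] 4 p q by (simp add: algebra_simps)
        then have "g (2 * p + q) (2 * p + q)"
          using step_j[of "2 * p + q" "2 * p + 2 * q"] 4 p q by (simp add: algebra_simps)
        then have "g (p) (2 * p + q)"
          using step_i[of "2 * p + q" "2 * p + q"] 4 p q by (simp add: algebra_simps)
        then have "g (p) (0)"
          using step_j[of "p" "2 * p + q"] 4 p q by (simp add: algebra_simps)
        then show ?thesis using goal by simp
      next
        case 5
        have "g (p + 2 * q) (q)" using step_i[OF start] 5 p q by simp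
        then have "g (p + 2 * q) (p + 2 * q)"
          using step_j[of "p + 2 * q" "q"] 5 p q by (simp add: algebra_simps)
        then have "g (2 * p + 2 * q) (p + 2 * q)"
          using step_i[of "p + 2 * q" "p + 2 * q"] 5 p q by (simp add: algebra_simps)
        then have "g (2 * p + 2 * q) (p + q)"
          using step_j[of "2 * p + 2 * q" "p + 2 * q"] 5 p q by (simp add: algebra_simps)
        then have "g (p) (p + q)"
          using step_i[of "2 * p + 2 * q" "p + q"] 5 p q by (simp add: algebra_simps)
        then have "g (p) (0)"
          using step_j[of "p" "p + q"] 5 p q by (simp add: algebra_simps)
        then show ?thesis using goal by simp
      next
        case 6
        have "g (p + q) (q)" using step_i[OF start] 6 p q by simp
        then have "g (p + q) (3 * p + 3 * q)"
          using step_j[of "p + q" "q"] 6 p q by (simp add: algebra_simps)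
        then have "g (3 * p + 2 * q) (3 * p + 3 * q)"
          using step_i[of "p + q" "3 * p + 3 * q"] 6 p q by (simp add: algebra_simps)
        then have "g (3 * p + 2 * q) (6 * p + 4 * q)"
          using step_j[of "3 * p + 2 * q" "3 * p + 3 * q"] 6 p q by (simp add: algebra_simps)
        then have "g (4 * p + 2 * q) (6 * p + 4 * q)"
          using step_i[of "3 * p + 2 * q" "6 * p + 4 * q"] 6 p q by (simp add: algebra_simps)
        then have "g (4 * p + 2 * q) (6 * p + 3 * q)"
          using step_j[of "4 * p + 2 * q" "6 * p + 4 * q"] 6 p q by (simp add: algebra_simps)
        then have "g (3 * p + q) (6 * p + 3 * q)"
          using step_i[of "4 * p + 2 * q" "6 * p + 3 * q"] 6 p q by (simp add: algebra_simps)
        then have "g (3 * p + q) (3 * p + q)"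
          using step_j[of "3 * p + q" "6 * p + 3 * q"] 6 p q by (simp add: algebra_simps)
        then have "g (p) (3 * p + q)"
          using step_i[of "3 * p + q" "3 * p + q"] 6 p q by (simp add: algebra_simps)
        then have "g (p) (0)"
          using step_j[of "p" "3 * p + q"] 6 p q by (simp add: algebra_simps)
        then show ?thesis using goal by simp
      next
        case 7
        have "g (p + 3 * q) (q)" using step_i[OF start] 7 p q by simp
        then have "g (p + 3 * q) (p + 3 * q)"
          using step_j[of "p + 3 * q" "q"] 7 p q by (simp add: algebra_simps)
        then have "g (3 * p + 6 * q) (p + 3 * q)"
          using step_i[of "p + 3 * q" "p + 3 * q"] 7 p q by (simp add: algebra_simps)
        then have "g (3 * p + 6 * q) (2 * p + 4 * q)"
          using step_j[of "3 * p + 6 * q" "p + 3 * q"] 7 p q by (simp add: algebra_simps)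
        then have "g (4 * p + 6 * q) (2 * p + 4 * q)"
          using step_i[of "3 * p + 6 * q" "2 * p + 4 * q"] 7 p q by (simp add: algebra_simps)
        then have "g (4 * p + 6 * q) (2 * p + 3 * q)"
          using step_j[of "4 * p + 6 * q" "2 * p + 4 * q"] 7 p q by (simp add: algebra_simps)
        then have "g (3 * p + 3 * q) (2 * p + 3 * q)"
          using step_i[of "4 * p + 6 * q" "2 * p + 3 * q"] 7 p q by (simp add: algebra_simps)
        then have "g (3 * p + 3 * q) (p + q)"
          using step_j[of "3 * p + 3 * q" "2 * p + 3 * q"] 7 p q by (simp add: algebra_simps)
        then have "g (p) (p + q)"
          using step_i[of "3 * p + 3 * q" "p + q"] 7 p q by (simp add: algebra_simps)
        then have "g (p) (0)"
          using step_j[of "p" "p + q"] 7 p q by (simp add: algebra_simps)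
        then show ?thesis using goal by simp
      qed
    qed
  qed
qed

text \<open>\<open>asc\<close> together with its negative is stable under simple reflections:
  raising ones by definition, lowering ones by \<open>asc_descend\<close>, and r_i exchanges
  \<alpha>_i and -\<alpha>_i.\<close>

lemma rts_asc:
  assumes "x \<in> rts"
  shows "x \<in> asc \<or> - x \<in> asc"
  using assms
proof induction
  case (rts_simple i)
  then show ?case by (simp add: asc_simple)
next
  case (rts_refl x i)
  have *: "refl i y \<in> asc \<or> - refl i y \<in> asc" if "y \<in> asc" for y
  proof (cases "pr i y" "0::int" rule: linorder_cases)
    case less
    then show ?thesis using that rts_refl.hyps asc_refl by blast
  next
    case equal
    then have "refl i y = y" by (simp add: refl_def)
    then show ?thesis using that by simp
  next
    case greater
    then show ?thesis using asc_descend[OF that rts_refl.hyps(2)] that rts_refl.hyps by (auto simp: refl_ev)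
  qed
  have "refl i x \<in> asc \<or> - refl i x \<in> asc"
    using rts_refl.IH *[of x] *[of "- x"] by (metis refl_uminus minus_minus)
  then show ?case .
qed

theorem rts_sign: "x \<in> rts \<Longrightarrow> nonneg x \<or> nonneg (- x)"
  using rts_asc asc_props by blast

lemma rts_supported: "x \<in> rts \<Longrightarrow> supported n x"
  using rts_asc[of x] asc_props(2)[of x] asc_props(2)[of "- x"] by auto

lemma rts_uminus: "x \<in> rts \<Longrightarrow> - x \<in> rts"
proof (induction rule: rts.induct)
  case (rts_simple i)
  then show ?case using rts.rts_refl[OF rts.rts_simple, of i i] refl_ev by metis
next
  case (rts_refl x i)
  then show ?case using rts.rts_refl[of "- x" i] refl_uminus by metis
qed

lemma rts_nonzero: "x \<in> rts \<Longrightarrow> x \<noteq> 0"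
  using rts_asc[of x] asc_props(3)[of x] asc_props(3)[of "- x"] by auto

definition act :: "nat list \<Rightarrow> (nat \<Rightarrow> int) \<Rightarrow> nat \<Rightarrow> int" where
  "act ws = foldr refl ws"

lemma act_Nil [simp]: "act [] x = x"
  and act_Cons [simp]: "act (i # ws) x = refl i (act ws x)"
  and act_append: "act (us @ ws) x = act us (act ws x)"
  by (simp_all add: act_def)

lemma act_rts: "set ws \<subseteq> {..<n} \<Longrightarrow> x \<in> rts \<Longrightarrow> act ws x \<in> rts"
  by (induction ws) (auto intro: rts_refl)

lemma act_rev: "set ws \<subseteq> {..<n} \<Longrightarrow> act (rev ws) (act ws x) = x"
  by (induction ws arbitrary: x) (auto simp: act_append)

lemma act_supported: "set ws \<subseteq> {..<n} \<Longrightarrow> supported n x \<Longrightarrow> supported n (act ws x)"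
  by (induction ws) (auto simp: supported_refl)

lemma refl_sum: "refl i (\<lambda>k. \<Sum>j<m. x j * b j k) = (\<lambda>k. \<Sum>j<m. x j * refl i (b j) k)"
  by (rule ext) (simp add: refl_eq pr_sum sum_subtractf algebra_simps sum_distrib_left)

lemma act_sum: "act ws (\<lambda>k. \<Sum>j<m. x j * b j k) = (\<lambda>k. \<Sum>j<m. x j * act ws (b j) k)"
  by (induction ws) (simp_all add: refl_sum)

end

section \<open>Linear independence over the integers\<close>

lemma square_independent:
  fixes b :: "nat \<Rightarrow> nat \<Rightarrow> int"
  assumes indep: "\<And>x. supported n x \<Longrightarrow> (\<And>k. k < n \<Longrightarrow> (\<Sum>j<n. x j * b j k) = 0) \<Longrightarrow> x = 0"
  obtains d where "d > 0"
    "\<And>y. \<exists>x. supported n x \<and> (\<forall>k<n. (\<Sum>j<n. x j * b j k) = d * y k)"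
proof -
  define M where "M = mat n n (\<lambda>(k,j). b j k)"
  have M: "M \<in> carrier_mat n n" by (simp add: M_def)
  have "det M \<noteq> 0"
  proof
    assume "det M = 0"
    then obtain v where v: "v \<in> carrier_vec n" "v \<noteq> 0\<^sub>v n" "M *\<^sub>v v = 0\<^sub>v n"
      using det_0_iff_vec_prod_zero[OF M] by auto
    define x where "x k = (if k < n then v $ k else 0)" for k
    have "supported n x" by (simp add: supported_def x_def)
    moreover have "(\<Sum>j<n. x j * b j k) = 0" if "k < n" for k
    proof -
      have "(M *\<^sub>v v) $ k = 0" using v(3) that by simp
      then have "(\<Sum>j\<in>{0..<n}. b j k * v $ j) = 0"
        using v(1) that by (simp add: M_def scalar_prod_def)
      then show ?thesis by (simp add: x_def atLeast0LessThan mult.commute)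
    qed
    ultimately have "x = 0" using indep by blast
    then have "v $ k = 0" if "k < n" for k using that by (simp add: x_def fun_eq_iff) metis
    then have "v = 0\<^sub>v n" using v(1) by (intro eq_vecI) auto
    then show False using v(2) by simp
  qed
  \<comment> \<open>By Cramer's rule the adjugate inverts \<open>M\<close> up to the determinant, so
    \<open>d\<close> times any integral vector is an integral combination.\<close>
  define d where "d = \<bar>det M\<bar>"
  have "\<exists>x. supported n x \<and> (\<forall>k<n. (\<Sum>j<n. x j * b j k) = d * y k)" for y :: "nat \<Rightarrow> int"
  proof -
    define z where "z = vec n (\<lambda>k. sgn (det M) * y k)"
    define w where "w = adj_mat M *\<^sub>v z"
    define x where "x k = (if k < n then w $ k else 0)" for k
    have adj: "adj_mat M \<in> carrier_mat n n" using adj_mat[OF M] by simp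
    have "M *\<^sub>v w = (M * adj_mat M) *\<^sub>v z"
      using assoc_mult_mat_vec[OF M adj, of z] by (simp add: w_def z_def)
    then have Mw: "M *\<^sub>v w = det M \<cdot>\<^sub>v z"
      using adj_mat(2)[OF M] by (auto simp: z_def)
    have "(\<Sum>j<n. x j * b j k) = d * y k" if "k < n" for k
    proof -
      have "(M *\<^sub>v w) $ k = (\<Sum>j\<in>{0..<n}. b j k * w $ j)"
        using that adj by (simp add: M_def scalar_prod_def w_def)
      then have "(\<Sum>j<n. x j * b j k) = (M *\<^sub>v w) $ k"
        by (simp add: x_def atLeast0LessThan mult.commute)
      also have "\<dots> = d * y k" using that by (simp add: Mw z_def d_def abs_sgn mult.assoc)
      finally show ?thesis .
    qed
    then show ?thesis by (intro exI[of _ x]) (simp add: supported_def x_def)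
  qed
  then show ?thesis using \<open>det M \<noteq> 0\<close> that[of d] by (simp add: d_def)
qed

lemma independent_card_le:
  fixes b :: "nat \<Rightarrow> nat \<Rightarrow> int"
  assumes indep: "\<And>x. supported m x \<Longrightarrow> (\<And>k. k < n \<Longrightarrow> (\<Sum>j<m. x j * b j k) = 0) \<Longrightarrow> x = 0"
  shows "m \<le> n"
proof (rule ccontr)
  assume "\<not> m \<le> n"
  \<comment> \<open>Padding by zeros gives a square matrix. The padded vectors would combine to a
    nonzero multiple of \<open>ev n\<close>, although they all vanish at \<open>n\<close>.\<close>
  define c where "c j k = (if k < n then b j k else 0)" for j k
  have "x = 0" if "supported m x" "\<And>k. k < m \<Longrightarrow> (\<Sum>j<m. x j * c j k) = 0" for x
  proof (rule indep[OF that(1)])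
    fix k assume "k < n"
    then show "(\<Sum>j<m. x j * b j k) = 0" using that(2)[of k] \<open>\<not> m \<le> n\<close> by (simp add: c_def)
  qed
  then obtain d where d: "d > 0"
    "\<And>y. \<exists>x. supported m x \<and> (\<forall>k<m. (\<Sum>j<m. x j * c j k) = d * y k)"
    using square_independent[of m c] by blast
  have "n < m" using \<open>\<not> m \<le> n\<close> by simp
  then obtain x where "(\<Sum>j<m. x j * c j n) = d * ev n n"
    using d(2)[of "ev n"] by metis
  then show False using d(1) by (simp add: c_def)
qed

definition lc :: "nat \<Rightarrow> (nat \<Rightarrow> nat \<Rightarrow> int) \<Rightarrow> (nat \<Rightarrow> int) \<Rightarrow> nat \<Rightarrow> int" where
  "lc m b x = (\<lambda>k. \<Sum>j<m. x j * b j k)"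

lemma lc_diff: "lc m b (x - y) = lc m b x - lc m b y"
  by (auto simp: lc_def algebra_simps sum_subtractf)

lemma lc_uminus: "lc m b (- x) = - lc m b x"
  by (auto simp: lc_def sum_negf)

lemma lc_scale: "lc m b (\<lambda>k. c * x k) = (\<lambda>k. c * lc m b x k)"
  by (auto simp: lc_def sum_distrib_left algebra_simps)

lemma lc_ev [simp]: "i < m \<Longrightarrow> lc m b (ev i) = b i"
  by (auto simp: lc_def)

lemma lc_zero [simp]: "lc m b 0 = 0"
  by (auto simp: lc_def)

lemma lc_supported: "(\<And>j. j < m \<Longrightarrow> supported n (b j)) \<Longrightarrow> supported n (lc m b x)"
  by (simp add: lc_def supported_def)

lemma supported_lc_ev: "supported n x \<Longrightarrow> lc n ev x = x"
proof
  fix k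
  assume "supported n x"
  then show "lc n ev x k = x k"
    by (cases "k < n") (auto simp: lc_def ev_def supported_def if_distrib cong: if_cong)
qed

text \<open>An integral symmetrizer keeps the invariant form integer valued; \<open>D i\<close> is
  half the norm of \<alpha>_i.\<close>

locale sym_gcm = gcm_system +
  fixes D :: "nat \<Rightarrow> int"
  assumes D_pos: "i < n \<Longrightarrow> D i > 0"
    and D_sym: "i < n \<Longrightarrow> j < n \<Longrightarrow> D i * a i j = D j * a j i"
begin

definition form :: "(nat \<Rightarrow> int) \<Rightarrow> (nat \<Rightarrow> int) \<Rightarrow> int" where
  "form x y = (\<Sum>i<n. D i * x i * pr i y)"

lemma form_commute: "form x y = form y x"
proof -
  have "form x y = (\<Sum>i<n. \<Sum>j<n. (D i * a i j) * x i * y j)"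
    by (simp add: form_def pr_def sum_distrib_left algebra_simps)
  also have "\<dots> = (\<Sum>i<n. \<Sum>j<n. (D j * a j i) * x i * y j)"
    by (intro sum.cong HOL.refl) (simp add: D_sym)
  also have "\<dots> = (\<Sum>j<n. \<Sum>i<n. (D j * a j i) * x i * y j)" by (rule sum.swap)
  also have "\<dots> = form y x"
    by (simp add: form_def pr_def sum_distrib_left algebra_simps)
  finally show ?thesis .
qed

lemma form_add_left: "form (x + y) z = form x z + form y z"
  by (simp add: form_def algebra_simps sum.distrib)

lemma form_diff_left: "form (x - y) z = form x z - form y z"
  by (simp add: form_def algebra_simps sum_subtractf)

lemma form_uminus_left: "form (- x) z = - form x z"
  by (simp add: form_def sum_negf)

lemma form_scale_left: "form (\<lambda>k. c * x k) z = c * form x z"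
  by (simp add: form_def sum_distrib_left algebra_simps)

lemma form_add_right: "form z (x + y) = form z x + form z y"
  and form_diff_right: "form z (x - y) = form z x - form z y"
  and form_uminus_right: "form z (- x) = - form z x"
  and form_scale_right: "form z (\<lambda>k. c * x k) = c * form z x"
  using form_add_left form_diff_left form_uminus_left form_scale_left
  by (simp_all only: form_commute[of z])

lemmas form_simps = form_add_left form_diff_left form_uminus_left form_scale_left
  form_add_right form_diff_right form_uminus_right form_scale_right

lemma form_zero [simp]: "form 0 x = 0" "form x 0 = 0"
  by (simp_all add: form_def)

lemma form_lc_left: "form (lc m b x) z = (\<Sum>j<m. x j * form (b j) z)"
  unfolding form_def lc_def sum_distrib_left sum_distrib_right
  by (subst sum.swap) (simp add: algebra_simps)

lemma form_lc_right: "form z (lc m b x) = (\<Sum>j<m. x j * form z (b j))"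
  using form_lc_left[of m b x z] by (simp only: form_commute[of z])

lemma form_ev_left [simp]: "i < n \<Longrightarrow> form (ev i) x = D i * pr i x"
  using sum_ev_mult[of i n "\<lambda>k. D k * pr k x"] by (simp add: form_def algebra_simps)

lemma form_ev_right [simp]: "i < n \<Longrightarrow> form x (ev i) = D i * pr i x"
  by (simp add: form_commute[of x])

lemma form_refl:
  assumes "i < n"
  shows "form (refl i x) (refl i y) = form x y"
  using assms by (simp add: refl_eq form_simps diag pr_diff pr_scale)

lemma form_act: "set ws \<subseteq> {..<n} \<Longrightarrow> form (act ws x) (act ws y) = form x y"
  by (induction ws) (auto simp: form_refl)

lemma form_refl_left: "i < n \<Longrightarrow> form (refl i x) y = form x (refl i y)"
  using form_refl[of i x "refl i y"] by simp

lemma rts_norm: "x \<in> rts \<Longrightarrow> \<exists>i<n. form x x = 2 * D i"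
  by (induction rule: rts.induct) (auto simp: form_refl diag)

lemma rts_norm_pos: "x \<in> rts \<Longrightarrow> form x x > 0"
  using rts_norm D_pos by fastforce

text \<open>Coroots lie in the coroot lattice: the \<open>j\<close>-th coordinate of \<open>x\<^sup>\<or>\<close> is \<open>2 D\<^sub>j x\<^sub>j / (x, x)\<close>.\<close>

definition coroot_integral :: "(nat \<Rightarrow> int) \<Rightarrow> bool" where
  "coroot_integral x \<longleftrightarrow> (\<forall>j<n. form x x dvd 2 * D j * x j)"

lemma coroot_integral_dvd:
  assumes "coroot_integral x"
  shows "form x x dvd 2 * form x y"
proof -
  have "2 * form x y = (\<Sum>j<n. 2 * D j * x j * pr j y)"
    by (simp add: form_def sum_distrib_left algebra_simps)
  then show ?thesis using assms by (auto simp: coroot_integral_def intro!: dvd_sum)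
qed

lemma coroot_integral_refl:
  assumes "i < n" "coroot_integral x"
  shows "coroot_integral (refl i x)"
  unfolding coroot_integral_def form_refl[OF assms(1)]
proof (intro allI impI)
  fix j assume j: "j < n"
  have "form x x dvd 2 * form x (ev i)" using assms coroot_integral_dvd by blast
  then have "form x x dvd 2 * D i * pr i x" using assms by (simp add: mult.assoc)
  moreover have "form x x dvd 2 * D j * x j" using assms(2) j by (simp add: coroot_integral_def)
  ultimately show "form x x dvd 2 * D j * refl i x j"
    by (auto simp: refl_def right_diff_distrib intro: dvd_diff)
qed

lemma rts_coroot_integral: "x \<in> rts \<Longrightarrow> coroot_integral x"
proof (induction rule: rts.induct)
  case (rts_simple i)
  show ?case unfolding coroot_integral_def
  proof (intro allI impI)
    fix j assume "j < n"
    show "form (ev i) (ev i) dvd 2 * D j * ev i j"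
      using rts_simple by (cases "j = i") (simp_all add: diag)
  qed
qed (simp add: coroot_integral_refl)

text \<open>The value of \<open>y\<close> on the coroot of \<open>b\<close>. For real roots the
  division is exact, see \<open>cpr_eq\<close>.\<close>

definition cpr :: "(nat \<Rightarrow> int) \<Rightarrow> (nat \<Rightarrow> int) \<Rightarrow> int" where
  "cpr b y = 2 * form b y div form b b"

lemma cpr_eq: "b \<in> rts \<Longrightarrow> form b b * cpr b y = 2 * form b y"
  using coroot_integral_dvd[OF rts_coroot_integral] by (simp add: cpr_def)

lemma cpr_unique: "b \<in> rts \<Longrightarrow> form b b * c = 2 * form b y \<Longrightarrow> cpr b y = c"
  using cpr_eq[of b y] rts_norm_pos[of b] by (metis less_irrefl mult_cancel_left)

text \<open>The reflection in r_i b is the conjugate by r_i of the reflection in \<open>b\<close>,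
  so the claim propagates along the construction of \<open>b\<close>.\<close>

lemma rts_reflection:
  assumes "b \<in> rts" "x \<in> rts"
  shows "x - (\<lambda>k. cpr b x * b k) \<in> rts"
  using assms
proof (induction b arbitrary: x rule: rts.induct)
  case (rts_simple i)
  have "cpr (ev i) x = pr i x"
    by (rule cpr_unique) (use rts_simple in \<open>auto intro: rts.rts_simple simp: diag\<close>)
  then show ?case using rts.rts_refl[OF rts_simple(2,1)] by (simp only: refl_eq)
next
  case (rts_refl b i)
  have "form (refl i b) (refl i b) * cpr b (refl i x) = 2 * form (refl i b) x"
    using rts_refl cpr_eq[of b "refl i x"] by (simp add: form_refl form_refl_left)
  then have c: "cpr (refl i b) x = cpr b (refl i x)"
    using rts_refl by (intro cpr_unique) (auto intro: rts.rts_refl)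
  have "refl i (refl i x - (\<lambda>k. cpr b (refl i x) * b k)) \<in> rts"
    using rts_refl by (intro rts.rts_refl rts_refl.IH) auto
  then show ?case using rts_refl.hyps(2) unfolding c refl_diff refl_scale by (metis refl_refl)
qed

lemma rts_multiple_simple:
  assumes "(\<lambda>k. c * ev i k) \<in> rts" "i < n"
  shows "c = 1 \<or> c = - 1"
proof -
  have "form (\<lambda>k. c * ev i k) (\<lambda>k. c * ev i k) dvd 2 * D i * (c * ev i i)"
    using rts_coroot_integral[OF assms(1)] assms(2) unfolding coroot_integral_def by blast
  then have "(2 * D i * c) * c dvd (2 * D i * c) * 1"
    using assms(2) by (simp add: form_simps diag ac_simps)
  moreover have "c \<noteq> 0" using rts_nonzero[OF assms(1)] by (auto simp: fun_eq_iff)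
  ultimately have "c dvd 1" using D_pos[OF assms(2)] by (subst (asm) dvd_mult_cancel_left) auto
  then show ?thesis by auto
qed

text \<open>r_i changes only the coordinate at \<open>i\<close>. If the sign flips, all other
  coordinates of \<open>x\<close> vanish, and the only positive multiple of \<alpha>_i that is a
  root is \<alpha>_i.\<close>

lemma rts_refl_nonneg:
  assumes "x \<in> rts" "nonneg x" "i < n" "x \<noteq> ev i"
  shows "nonneg (refl i x)"
proof (rule ccontr)
  assume "\<not> nonneg (refl i x)"
  then have neg: "nonneg (- refl i x)" using rts_sign rts_refl assms by blast
  have "x k = x i * ev i k" for k
  proof (cases "k = i")
    case False
    then have "x k \<le> 0" using nonnegD[OF neg, of k] by (simp add: refl_def)
    then show ?thesis using nonnegD[OF assms(2), of k] False by simp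
  qed simp
  then have x: "x = (\<lambda>k. x i * ev i k)" by (rule ext)
  then have "x i = 1 \<or> x i = - 1" using rts_multiple_simple assms by metis
  then have "x i = 1" using nonnegD[OF assms(2), of i] by auto
  then show False using x assms(4) by simp
qed

end

section \<open>Families of real roots of a given type\<close>

lemma (in gcm_system) act_zero [simp]: "act ws 0 = 0"
proof (induction ws)
  case (Cons i ws)
  have "refl i 0 = 0" by (auto simp: refl_eq)
  then show ?case using Cons by (metis act_Cons)
qed (metis act_Nil)

text \<open>An independent family of real roots of \<open>a\<close> with type \<open>b\<close>, used
  as the linear map \<open>lc m \<beta>\<close> from the root lattice of \<open>b\<close> to that of
  \<open>a\<close>. \<open>beta_type\<close> expresses the type by the form, without
  division.\<close>

locale root_embedding = A: sym_gcm n a D + B: gcm_system m b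
  for n a D m b +
  fixes \<beta> :: "nat \<Rightarrow> nat \<Rightarrow> int"
  assumes beta_rts: "j < m \<Longrightarrow> \<beta> j \<in> A.rts"
    and beta_type: "i < m \<Longrightarrow> j < m \<Longrightarrow> 2 * A.form (\<beta> i) (\<beta> j) = A.form (\<beta> i) (\<beta> i) * b i j"
    and beta_indep: "supported m x \<Longrightarrow> lc m \<beta> x = 0 \<Longrightarrow> x = 0"
begin

text \<open>The half norms of the \<beta>_i symmetrize \<open>b\<close>; for this symmetrizer
  \<open>lc m \<beta>\<close> is an isometry, see \<open>form_lc\<close>.\<close>

definition N :: "nat \<Rightarrow> int" where
  "N i = A.form (\<beta> i) (\<beta> i) div 2"

lemma N_norm: "i < m \<Longrightarrow> A.form (\<beta> i) (\<beta> i) = 2 * N i"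
  using A.rts_norm[OF beta_rts[of i]] by (auto simp: N_def)

lemma form_beta: "i < m \<Longrightarrow> j < m \<Longrightarrow> A.form (\<beta> i) (\<beta> j) = N i * b i j"
  using beta_type[of i j] by (simp add: N_norm)

sublocale BF: sym_gcm m b N
proof
  show "N i > 0" if "i < m" for i
    using A.rts_norm_pos[OF beta_rts[OF that]] by (simp add: N_norm[OF that])
  show "N i * b i j = N j * b j i" if "i < m" "j < m" for i j
    using form_beta[OF that] form_beta[OF that(2,1)] A.form_commute[of "\<beta> i" "\<beta> j"] by simp
qed

lemma form_beta_lc: "i < m \<Longrightarrow> A.form (\<beta> i) (lc m \<beta> x) = N i * B.pr i x"
  by (simp add: A.form_lc_right form_beta B.pr_def sum_distrib_left algebra_simps)

lemma form_lc: "A.form (lc m \<beta> x) (lc m \<beta> y) = BF.form x y"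
  unfolding A.form_lc_left BF.form_def
  by (intro sum.cong HOL.refl) (simp add: form_beta_lc algebra_simps)

lemma lc_refl:
  assumes "i < m"
  shows "lc m \<beta> (B.refl i x) = lc m \<beta> x - (\<lambda>k. A.cpr (\<beta> i) (lc m \<beta> x) * \<beta> i k)"
proof -
  have "A.cpr (\<beta> i) (lc m \<beta> x) = B.pr i x"
    using assms by (intro A.cpr_unique beta_rts) (simp_all add: form_beta_lc N_norm)
  then show ?thesis using assms by (simp add: B.refl_eq lc_diff lc_scale)
qed

text \<open>A simple reflection of \<open>b\<close> is carried to the reflection in the real root
  \<beta>_i, which preserves the real roots of \<open>a\<close>.\<close>

lemma lc_rts: "x \<in> B.rts \<Longrightarrow> lc m \<beta> x \<in> A.rts"
  by (induction rule: B.rts.induct) (auto simp: beta_rts lc_refl intro: A.rts_reflection simp del: minus_apply)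

lemma beta_supported: "j < m \<Longrightarrow> supported n (\<beta> j)"
  using beta_rts A.rts_supported by blast

lemma card_le: "m \<le> n"
proof (rule independent_card_le[of m n \<beta>])
  fix x
  assume x: "supported m x" and 0: "\<And>k. k < n \<Longrightarrow> (\<Sum>j<m. x j * \<beta> j k) = 0"
  have "lc m \<beta> x k = 0" for k
    using 0[of k] beta_supported by (cases "k < n") (auto simp: lc_def supported_def)
  then show "x = 0" using x beta_indep by (auto simp: fun_eq_iff)
qed

lemma lc_nonneg: "(\<And>j. j < m \<Longrightarrow> nonneg (\<beta> j)) \<Longrightarrow> nonneg x \<Longrightarrow> nonneg (lc m \<beta> x)"
  by (auto simp: nonneg_def lc_def intro!: sum_nonneg)

lemma root_embedding_act:
  assumes "set ws \<subseteq> {..<n}"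
  shows "root_embedding n a D m b (\<lambda>j. A.act ws (\<beta> j))"
proof unfold_locales
  fix x assume x: "supported m x" "lc m (\<lambda>j. A.act ws (\<beta> j)) x = 0"
  have "A.act ws (lc m \<beta> x) = 0" using x(2) by (simp add: lc_def A.act_sum)
  then have "lc m \<beta> x = A.act (rev ws) 0" using A.act_rev[OF assms, of "lc m \<beta> x"] by simp
  also have "\<dots> = 0" by (rule A.act_zero)
  finally show "x = 0" using x(1) beta_indep by blast
qed (use assms beta_rts beta_type in \<open>auto simp: A.form_act intro: A.act_rts\<close>)

lemma root_embedding_uminus: "root_embedding n a D m b (\<lambda>j. - \<beta> j)"
proof unfold_locales
  fix x assume x: "supported m x" "lc m (\<lambda>j. - \<beta> j) x = 0"
  have "lc m (\<lambda>j. - \<beta> j) x = - lc m \<beta> x" by (auto simp: lc_def sum_negf)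
  then have "lc m \<beta> x = 0" using x(2) by (metis neg_equal_0_iff_equal)
  then show "x = 0" using x(1) beta_indep by blast
qed (use beta_rts beta_type in \<open>auto simp: A.form_simps A.rts_uminus\<close>)

text \<open>The conjugated \<beta>_j has product \<open>N j * pr j u > 0\<close> with the conjugated
  image of \<open>u\<close>, whereas a negative root has nonpositive product with a dominant
  vector.\<close>

lemma nonneg_if_dominant:
  assumes u: "\<And>i. i < m \<Longrightarrow> B.pr i u > 0"
    and ws: "set ws \<subseteq> {..<n}" "\<And>i. i < n \<Longrightarrow> A.pr i (A.act ws (lc m \<beta> u)) \<ge> 0"
    and j: "j < m"
  shows "nonneg (A.act ws (\<beta> j))"
proof (rule ccontr)
  let ?g = "A.act ws (\<beta> j)"
  assume "\<not> nonneg ?g"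
  then have neg: "nonneg (- ?g)" using A.rts_sign A.act_rts beta_rts ws(1) j by blast
  have "A.form ?g (A.act ws (lc m \<beta> u)) = N j * B.pr j u"
    using ws(1) j by (simp add: A.form_act form_beta_lc)
  also have "\<dots> > 0" using u j BF.D_pos by simp
  finally have "A.form (- ?g) (A.act ws (lc m \<beta> u)) < 0" by (simp add: A.form_simps)
  moreover have "A.form (- ?g) (A.act ws (lc m \<beta> u)) \<ge> 0"
    unfolding A.form_def using ws(2) A.D_pos nonnegD[OF neg]
    by (intro sum_nonneg mult_nonneg_nonneg) (auto simp: less_imp_le simp del: uminus_apply)
  ultimately show False by simp
qed

end

text \<open>Norms match because the second family is measured by the symmetrizer of \<open>b\<close>
  that the first one induces.\<close>

lemma root_embedding_comp:
  assumes "root_embedding n a D m b \<beta>"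
    and "root_embedding m b (root_embedding.N n a D \<beta>) l c \<gamma>"
  shows "root_embedding n a D l c (\<lambda>j. lc m \<beta> (\<gamma> j))"
proof -
  interpret P: root_embedding n a D m b \<beta> by fact
  interpret Q: root_embedding m b P.N l c \<gamma> by fact
  show ?thesis
  proof unfold_locales
    fix x assume x: "supported l x" "lc l (\<lambda>j. lc m \<beta> (\<gamma> j)) x = 0"
    have "lc l (\<lambda>j. lc m \<beta> (\<gamma> j)) x = lc m \<beta> (lc l \<gamma> x)"
      unfolding lc_def sum_distrib_left sum_distrib_right
      by (rule ext, subst sum.swap) (simp add: algebra_simps)
    moreover have "supported m (lc l \<gamma> x)"
      using Q.beta_supported by (intro lc_supported)
    ultimately have "lc l \<gamma> x = 0" using x(2) P.beta_indep by simp
    then show "x = 0" using x(1) Q.beta_indep by blast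
  qed (auto simp: P.lc_rts Q.beta_rts P.form_lc Q.beta_type)
qed

lemma (in root_embedding) beta_simple_permutes:
  assumes "m = n" and simple: "\<And>j. j < n \<Longrightarrow> \<exists>i<n. \<beta> j = ev i"
  obtains p where "p permutes {..<n}" "\<And>i j. i < n \<Longrightarrow> j < n \<Longrightarrow> b i j = a (p i) (p j)"
proof -
  define p where "p j = (if j < n then SOME i. i < n \<and> \<beta> j = ev i else j)" for j
  have p: "p j < n" "\<beta> j = ev (p j)" if "j < n" for j
    using someI_ex[OF simple[OF that, unfolded]] that by (auto simp: p_def)
  have "inj_on p {..<n}"
  proof (rule inj_onI)
    fix i j assume ij: "i \<in> {..<n}" "j \<in> {..<n}" "p i = p j"
    then have "\<beta> i = \<beta> j" using p(2) by (metis lessThan_iff)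
    moreover have "i < m" "j < m" using ij(1,2) assms(1) by auto
    ultimately have "lc m \<beta> (ev i - ev j) = 0" unfolding lc_diff by simp
    moreover have "supported m (ev i - ev j)"
      using \<open>i < m\<close> \<open>j < m\<close> by (intro supported_diff supported_ev)
    ultimately have "ev i - ev j = 0" by (rule beta_indep[rotated])
    then show "i = j" by simp
  qed
  moreover have "p ` {..<n} = {..<n}"
    using p(1) calculation by (intro card_subset_eq) (auto simp: card_image)
  ultimately have "bij_betw p {..<n} {..<n}" by (rule bij_betw_imageI)
  then have perm: "p permutes {..<n}" by (rule bij_imp_permutes) (simp add: p_def)
  have "b i j = a (p i) (p j)" if "i < n" "j < n" for i j
    using beta_type[of i j] that p[of i] p[of j] assms(1) A.D_pos[of "p i"] A.D_sym[of "p j" "p i"] by (simp add: A.diag)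
  then show ?thesis using perm that by blast
qed

section \<open>Conjugation into the dominant chamber\<close>

context sym_gcm
begin

text \<open>Reflecting in a simple root on which \<open>x\<close> is negative raises the integer
  \<open>form x z\<close>, since \<open>z\<close> is strictly dominant. The upper bound on
  \<open>X\<close> makes this stop, necessarily at a dominant vector.\<close>

lemma descent:
  assumes step: "\<And>x i. X x \<Longrightarrow> i < n \<Longrightarrow> pr i x < 0 \<Longrightarrow> X (refl i x)"
    and bound: "\<And>x. X x \<Longrightarrow> form x z \<le> M"
    and z: "\<And>i. i < n \<Longrightarrow> pr i z > 0"
    and "X x"
  shows "\<exists>ws. set ws \<subseteq> {..<n} \<and> (\<forall>i<n. pr i (act ws x) \<ge> 0)"
  using \<open>X x\<close>
proof (induction "nat (M - form x z)" arbitrary: x rule: less_induct)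
  case less
  show ?case
  proof (cases "\<forall>i<n. pr i x \<ge> 0")
    case True
    then show ?thesis by (intro exI[of _ "[]"]) simp
  next
    case False
    then obtain i where i: "i < n" "pr i x < 0" by (auto simp: not_le)
    have "form (refl i x) z = form x z - pr i x * (D i * pr i z)"
      using i by (simp add: refl_eq form_simps)
    moreover have "pr i x * (D i * pr i z) < 0"
      using i z D_pos by (simp add: mult_neg_pos)
    moreover have X: "X (refl i x)" using step less.prems i by blast
    ultimately obtain ws where ws: "set ws \<subseteq> {..<n}" "\<forall>k<n. pr k (act ws (refl i x)) \<ge> 0"
      using less.hyps[of "refl i x"] bound[OF X] by fastforce
    have "act (ws @ [i]) x = act ws (refl i x)" by (simp add: act_append)
    then show ?thesis using ws i by (intro exI[of _ "ws @ [i]"]) simp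
  qed
qed

text \<open>The norm is constant on the orbit and (y - z, y - z) \<ge> 0, which bounds the products
  with \<open>z\<close>.\<close>

lemma dominant_conjugate_semidefinite:
  assumes psd: "\<And>x. form x x \<ge> 0"
    and z: "\<And>i. i < n \<Longrightarrow> pr i z > 0"
  shows "\<exists>ws. set ws \<subseteq> {..<n} \<and> (\<forall>i<n. pr i (act ws x) \<ge> 0)"
proof (rule descent[where X = "\<lambda>y. form y y = form x x" and M = "form x x + form z z"])
  fix y assume y: "form y y = form x x"
  have "form (y - z) (y - z) = form y y - 2 * form y z + form z z"
    by (simp add: form_simps form_commute[of z y])
  then show "form y z \<le> form x x + form z z"
    using psd[of "y - z"] psd[of x] psd[of z] y by linarith
qed (simp_all add: form_refl z)

text \<open>A symmetric form of signature \<open>(1, k)\<close> up to sign has no pair of orthogonal negative vectors.\<close>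

definition lorentzian :: bool where
  "lorentzian \<longleftrightarrow> (\<forall>x y. form x x < 0 \<longrightarrow> form y y < 0 \<longrightarrow> form x y \<noteq> 0)"

text \<open>Two negative vectors lie in the same half of the cone iff their product is negative. A
  reflection preserves the halves: otherwise the segment from \<open>x\<close> to its image would contain a
  negative vector orthogonal to \<open>z\<close>.\<close>

lemma dominant_conjugate_lorentzian:
  assumes lor: lorentzian
    and z: "\<And>i. i < n \<Longrightarrow> pr i z > 0" "form z z < 0"
    and x: "form x x < 0" "form x z < 0"
  shows "\<exists>ws. set ws \<subseteq> {..<n} \<and> (\<forall>i<n. pr i (act ws x) \<ge> 0)"
proof (rule descent[where X = "\<lambda>y. form y y < 0 \<and> form y z < 0" and M = 0])
  fix y i assume y: "form y y < 0 \<and> form y z < 0" and i: "i < n" "pr i y < 0"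
  define q s r where "q = - pr i y" and "s = D i * pr i z" and "r = - form y z"
  have pos: "q > 0" "s > 0" "r > 0" using i y z(1) D_pos by (auto simp: q_def s_def r_def)
  have "form (refl i y) z < 0"
  proof (rule ccontr)
    assume "\<not> form (refl i y) z < 0"
    moreover have "form (refl i y) z = - r + q * s"
      using i by (simp add: refl_eq form_simps q_def s_def r_def)
    ultimately have rq: "r \<le> q * s" by simp
    \<comment> \<open>Up to the factor \<open>s\<close>, the point orthogonal to \<open>z\<close> on
      the segment from \<open>y\<close> to its image; it lies on the segment because r \<le> q
      s.\<close>
    define v where "v = (\<lambda>k. s * y k) + (\<lambda>k. r * ev i k)"
    have "form v z = s * form y z + r * s" using i by (simp add: v_def form_simps s_def)
    then have "form v z = 0" by (simp add: r_def)
    have "form v v = s * s * form y y + 2 * D i * r * (r - q * s)"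
      using i by (simp add: v_def form_simps q_def diag algebra_simps)
    moreover have "s * s * form y y < 0" using y pos by (simp add: mult_pos_neg)
    moreover have "2 * D i * r * (r - q * s) \<le> 0"
      using rq pos D_pos[OF i(1)] by (intro mult_nonneg_nonpos) auto
    ultimately have "form v v < 0" by linarith
    then show False using lor z(2) \<open>form v z = 0\<close> by (auto simp: lorentzian_def)
  qed
  then show "form (refl i y) (refl i y) < 0 \<and> form (refl i y) z < 0"
    using y i by (simp add: form_refl)
qed (use z x in auto)

end

text \<open>Moving the image of \<open>u\<close> into the dominant chamber makes all \<beta>_j
  positive, by \<open>nonneg_if_dominant\<close>. In the Lorentzian case this image may lie in the
  wrong half of the cone; then -\<beta>, which has the same type, is used.\<close>

lemma (in root_embedding) normalize:
  assumes z: "\<And>i. i < n \<Longrightarrow> A.pr i z > 0"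
    and u: "\<And>i. i < m \<Longrightarrow> B.pr i u > 0"
    and "(\<forall>x. A.form x x \<ge> 0) \<or> A.lorentzian \<and> A.form z z < 0 \<and> BF.form u u < 0"
  obtains \<gamma> where "root_embedding n a D m b \<gamma>" "\<And>j. j < m \<Longrightarrow> nonneg (\<gamma> j)"
proof -
  note finish = that
  have 1: thesis if e: "root_embedding n a D m b \<gamma>"
    and d: "\<exists>ws. set ws \<subseteq> {..<n} \<and> (\<forall>i<n. A.pr i (A.act ws (lc m \<gamma> u)) \<ge> 0)" for \<gamma>
  proof -
    interpret G: root_embedding n a D m b \<gamma> by (rule e)
    from d obtain ws where ws: "set ws \<subseteq> {..<n}" "\<And>i. i < n \<Longrightarrow> A.pr i (A.act ws (lc m \<gamma> u)) \<ge> 0"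
      by blast
    show thesis
      by (rule finish[OF G.root_embedding_act[OF ws(1)]]) (rule G.nonneg_if_dominant[OF u ws])
  qed
  from assms(3) show ?thesis
  proof
    assume "\<forall>x. A.form x x \<ge> 0"
    then show ?thesis
      by (intro 1[OF root_embedding_axioms] A.dominant_conjugate_semidefinite[of z] z) auto
  next
    assume L: "A.lorentzian \<and> A.form z z < 0 \<and> BF.form u u < 0"
    let ?x = "lc m \<beta> u"
    have x: "A.form ?x ?x < 0" using L by (simp add: form_lc)
    then have "A.form ?x z \<noteq> 0" using L by (auto simp: A.lorentzian_def)
    then consider "A.form ?x z < 0" | "A.form ?x z > 0" by linarith
    then show ?thesis
    proof cases
      case neg: 1
      show ?thesis
        by (intro 1[OF root_embedding_axioms] A.dominant_conjugate_lorentzian[of z] z)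
          (use L x neg in auto)
    next
      case 2
      have "lc m (\<lambda>j. - \<beta> j) u = - ?x" by (auto simp: lc_def sum_negf)
      moreover have "\<exists>ws. set ws \<subseteq> {..<n} \<and> (\<forall>i<n. A.pr i (A.act ws (- ?x)) \<ge> 0)"
        by (intro A.dominant_conjugate_lorentzian[of z] z) (use L x 2 in \<open>auto simp: A.form_simps\<close>)
      ultimately show ?thesis by (intro 1[OF root_embedding_uminus]) simp
    qed
  qed
qed

text \<open>The matrix \<open>R\<close> of coordinates of the roots \<open>\<rho>\<^sub>j\<close> and the matrix \<open>S\<close> of coordinates of their
  coroots satisfy \<open>S\<^sup>T A R = A\<close>, whence \<open>R M S\<^sup>T = M\<close> for the multiple \<open>M\<close> of \<open>A\<^sup>-\<^sup>1\<close>. As all entries are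
  nonnegative, comparing the sums of all entries shows that the columns of \<open>R\<close> have sum \<open>1\<close>.\<close>

lemma self_embedding_simple:
  assumes "root_embedding n a D n a \<rho>" and pos: "\<And>j. j < n \<Longrightarrow> nonneg (\<rho> j)"
    and M: "\<And>j. j < n \<Longrightarrow> nonneg (M j)" "\<And>j. j < n \<Longrightarrow> supported n (M j)"
      "\<And>i j. i < n \<Longrightarrow> j < n \<Longrightarrow> gcm_system.pr n a i (M j) = c * ev j i" "c \<noteq> 0"
      "\<And>i. i < n \<Longrightarrow> \<exists>j<n. M j i > 0"
    and j: "j < n"
  shows "height n (\<rho> j) = 1"
proof -
  interpret R: root_embedding n a D n a \<rho> by fact
  have ker: "x = 0" if x: "supported n x" "\<And>i. i < n \<Longrightarrow> R.A.pr i x = 0" for x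
  proof -
    have "c * D k * x k = 0" if k: "k < n" for k
    proof -
      have "R.A.form (M k) x = 0" using x(2) by (simp add: R.A.form_def)
      then have "R.A.form x (M k) = 0" by (subst R.A.form_commute)
      moreover have "R.A.form x (M k) = (\<Sum>i<n. (D i * x i * c) * ev k i)"
        unfolding R.A.form_def using M(3) k by (intro sum.cong) auto
      ultimately have "D k * x k * c = 0" using sum_mult_ev[OF k] by metis
      then show ?thesis by auto
    qed
    then have "x k = 0" for k
      using R.A.D_pos[of k] M(4) x(1) by (cases "k < n") (fastforce simp: supported_def)+
    then show ?thesis by auto
  qed
  obtain d where d: "d > 0" "\<And>y. \<exists>x. supported n x \<and> (\<forall>k<n. (\<Sum>j<n. x j * \<rho> j k) = d * y k)"
  proof (rule square_independent[of n \<rho>])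
    fix x assume x: "supported n x" "\<And>k. k < n \<Longrightarrow> (\<Sum>j<n. x j * \<rho> j k) = 0"
    have "lc n \<rho> x k = 0" for k
      using x(2) R.beta_supported by (cases "k < n") (auto simp: lc_def supported_def)
    then have "lc n \<rho> x = 0" by (intro ext) simp
    then show "x = 0" by (rule R.beta_indep[OF x(1)])
  qed blast
  have orth: "x = 0" if x: "supported n x" "\<And>i. i < n \<Longrightarrow> R.A.form (\<rho> i) x = 0" for x
  proof (rule ker[OF x(1)])
    fix k assume k: "k < n"
    obtain y where y: "supported n y" "\<forall>k'<n. lc n \<rho> y k' = d * ev k k'"
      using d(2)[of "ev k"] by (auto simp: lc_def)
    have "lc n \<rho> y = (\<lambda>i. d * ev k i)"
    proof
      fix i show "lc n \<rho> y i = d * ev k i"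
        using y(2) k R.beta_supported lc_supported[of n n \<rho> y] by (cases "i < n") (auto simp: supported_def)
    qed
    then have "d * (D k * R.A.pr k x) = R.A.form (lc n \<rho> y) x"
      using k by (simp add: R.A.form_simps)
    also have "\<dots> = 0" using x(2) by (simp add: R.A.form_lc_left)
    finally show "R.A.pr k x = 0" using d(1) R.A.D_pos[OF k] by simp
  qed
  define S where "S q i = D q * \<rho> i q div R.N i" for q i
  have S: "R.N i * S q i = D q * \<rho> i q" if "i < n" "q < n" for i q
    using R.A.rts_coroot_integral[OF R.beta_rts] that
    by (auto simp: S_def R.A.coroot_integral_def R.N_norm mult.assoc)
  have S_nonneg: "S q i \<ge> 0" if "i < n" "q < n" for i q
    using nonnegD[OF pos[OF that(1)], of q] R.A.D_pos[OF that(2)] R.BF.D_pos[OF that(1)]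
    by (simp add: S_def pos_imp_zdiv_nonneg_iff)
  define y where "y q = (\<lambda>l. \<Sum>k<n. S q k * M k l)" for q
  \<comment> \<open>Column \<open>q\<close> of R M S^T = M, where \<open>y q\<close> is that of M
    S^T. Both sides have the same products with all \<rho>_i, and the \<rho>_i span over the
    rationals.\<close>
  have key: "lc n \<rho> (y q) = M q" if q: "q < n" for q
  proof -
    have "lc n \<rho> (y q) - M q = 0"
    proof (rule orth)
      show "supported n (lc n \<rho> (y q) - M q)"
        by (intro supported_diff lc_supported M(2) q R.beta_supported)
      fix i assume i: "i < n"
      have "R.A.pr i (y q) = c * S q i"
      proof -
        have "R.A.pr i (y q) = (\<Sum>k<n. S q k * R.A.pr i (M k))"
          unfolding y_def by (rule R.A.pr_sum)
        also have "\<dots> = (\<Sum>k<n. (c * S q k) * ev i k)"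
          using M(3) i by (intro sum.cong) (auto simp: ev_def)
        also have "\<dots> = c * S q i" using i by (rule sum_mult_ev)
        finally show ?thesis .
      qed
      then have "R.A.form (\<rho> i) (lc n \<rho> (y q)) = c * (D q * \<rho> i q)"
        using i q S by (simp add: R.form_beta_lc)
      moreover have "R.A.form (\<rho> i) (M q) = (\<Sum>k<n. (D k * \<rho> i k * c) * ev q k)"
        unfolding R.A.form_def using M(3) q by (intro sum.cong) auto
      ultimately show "R.A.form (\<rho> i) (lc n \<rho> (y q) - M q) = 0"
        using q by (simp add: R.A.form_simps)
    qed
    then show ?thesis by (simp only: right_minus_eq)
  qed
  \<comment> \<open>The column sums of \<open>R\<close> and \<open>S\<close>. They are positive
    integers because the roots and their coroots are nonnegative and nonzero.\<close>
  define r s where "r l = height n (\<rho> l)" and "s k = (\<Sum>q<n. S q k)" for l k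
  have r: "r l \<ge> 1" if "l < n" for l
    using height_pos[OF pos[OF that] R.beta_supported[OF that]] R.A.rts_nonzero R.beta_rts that
    unfolding r_def by fastforce
  have s: "s k \<ge> 1" if k: "k < n" for k
  proof -
    have "s k \<noteq> 0"
    proof
      assume "s k = 0"
      then have "S q k = 0" if "q < n" for q
        using S_nonneg k that unfolding s_def by (subst (asm) sum_nonneg_eq_0_iff) auto
      then have "\<rho> k q = 0" for q
        using S[OF k, of q] R.A.D_pos[of q] R.beta_supported[OF k] by (cases "q < n") (auto simp: supported_def)
      then have "\<rho> k = 0" by auto
      then show False using R.A.rts_nonzero R.beta_rts k by blast
    qed
    moreover have "s k \<ge> 0" unfolding s_def using S_nonneg k by (intro sum_nonneg) auto
    ultimately show ?thesis by linarith
  qed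
  have "(\<Sum>q<n. height n (M q)) = (\<Sum>q<n. height n (lc n \<rho> (y q)))" using key by simp
  also have "\<dots> = (\<Sum>k<n. \<Sum>l<n. r l * s k * M k l)"
  proof -
    have "height n (lc n \<rho> (y q)) = (\<Sum>l<n. \<Sum>k<n. r l * S q k * M k l)" for q
    proof -
      have "height n (lc n \<rho> (y q)) = (\<Sum>l<n. y q l * r l)"
        unfolding height_def lc_def r_def by (subst sum.swap) (simp add: sum_distrib_left)
      then show ?thesis by (simp add: y_def sum_distrib_right sum_distrib_left algebra_simps)
    qed
    then have "(\<Sum>q<n. height n (lc n \<rho> (y q))) = (\<Sum>q<n. \<Sum>l<n. \<Sum>k<n. r l * S q k * M k l)" by simp
    also have "\<dots> = (\<Sum>l<n. \<Sum>k<n. \<Sum>q<n. r l * S q k * M k l)"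
      by (subst sum.swap, rule sum.cong[OF HOL.refl], rule sum.swap)
    also have "\<dots> = (\<Sum>l<n. \<Sum>k<n. r l * s k * M k l)"
      by (simp add: s_def sum_distrib_left sum_distrib_right algebra_simps)
    also have "\<dots> = (\<Sum>k<n. \<Sum>l<n. r l * s k * M k l)" by (rule sum.swap)
    finally show ?thesis .
  qed
  \<comment> \<open>Weighting the entries of \<open>M\<close> by r_l s_k \<ge> 1 does not change
    their sum, so every positive entry has weight 1.\<close>
  finally have "(\<Sum>k<n. \<Sum>l<n. (r l * s k - 1) * M k l) = 0"
    by (simp add: height_def algebra_simps sum_subtractf)
  moreover have nn: "(r l * s k - 1) * M k l \<ge> 0" if "k < n" "l < n" for k l
    using mult_mono[OF r[OF that(2)] s[OF that(1)]] r[OF that(2)] nonnegD[OF M(1)[OF that(1)], of l]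
    by (intro mult_nonneg_nonneg) auto
  moreover have "(\<Sum>l<n. (r l * s k - 1) * M k l) \<ge> 0" if "k < n" for k
    using nn that by (intro sum_nonneg) auto
  ultimately have "(\<Sum>l<n. (r l * s k - 1) * M k l) = 0" if "k < n" for k
    using that sum_nonneg_eq_0_iff[of "{..<n}" "\<lambda>k. \<Sum>l<n. (r l * s k - 1) * M k l"] by simp
  then have "(r l * s k - 1) * M k l = 0" if "k < n" "l < n" for k l
    using that nn sum_nonneg_eq_0_iff[of "{..<n}" "\<lambda>l. (r l * s k - 1) * M k l"] by simp
  note zero = this
  obtain k where k: "k < n" "M k j > 0" using M(5)[OF j] by blast
  have "r j * s k = 1" using zero[OF k(1) j] k(2) by simp
  moreover have "r j * 1 \<le> r j * s k" using r[OF j] s[OF k(1)] by (intro mult_left_mono) auto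
  ultimately have "r j = 1" using r[OF j] by linarith
  then show ?thesis by (simp add: r_def)
qed

text \<open>The heights of the \<beta>_k are at least 1, so a nonnegative combination of height 1 is
  a single \<beta>_k of height 1. Hence the \<gamma>_j are simple, and as they exhaust the simple
  roots of \<open>b\<close>, all \<beta>_k are simple.\<close>

lemma mutual_embedding_permutation:
  assumes "root_embedding n a D n b \<beta>" and "root_embedding n b (root_embedding.N n a D \<beta>) n a \<gamma>"
    and pos: "\<And>j. j < n \<Longrightarrow> nonneg (\<beta> j)" "\<And>j. j < n \<Longrightarrow> nonneg (\<gamma> j)"
    and one: "\<And>j. j < n \<Longrightarrow> height n (lc n \<beta> (\<gamma> j)) = 1"
  obtains p where "p permutes {..<n}" "\<And>i j. i < n \<Longrightarrow> j < n \<Longrightarrow> b i j = a (p i) (p j)"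
proof -
  interpret P: root_embedding n a D n b \<beta> by fact
  interpret Q: root_embedding n b P.N n a \<gamma> by fact
  have h: "height n (\<beta> k) \<ge> 1" if "k < n" for k
    using height_pos[OF pos(1)[OF that] P.beta_supported[OF that]] P.A.rts_nonzero P.beta_rts that by fastforce
  have "\<exists>k<n. \<gamma> j = ev k \<and> height n (\<beta> k) = 1" if j: "j < n" for j
  proof -
    have "1 = (\<Sum>k<n. \<gamma> j k * height n (\<beta> k))"
      using one[OF j] unfolding height_def lc_def by (subst (asm) sum.swap) (simp add: sum_distrib_left)
    also have "\<dots> \<ge> height n (\<gamma> j)"
      unfolding height_def[of n "\<gamma> j"] using h nonnegD[OF pos(2)[OF j]]
      by (intro sum_mono) (metis lessThan_iff mult.right_neutral mult_left_mono)
    finally have "height n (\<gamma> j) \<le> 1" .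
    moreover have "height n (\<gamma> j) > 0"
      using height_pos[OF pos(2)[OF j] Q.beta_supported[OF j]] P.B.rts_nonzero Q.beta_rts j by blast
    ultimately have "height n (\<gamma> j) = 1" by linarith
    then obtain k where k: "k < n" "\<gamma> j = ev k"
      using nonneg_height_one[OF pos(2)[OF j] Q.beta_supported[OF j]] by blast
    then show ?thesis using one[OF j] by auto
  qed
  then obtain f where f: "\<And>j. j < n \<Longrightarrow> f j < n \<and> \<gamma> j = ev (f j) \<and> height n (\<beta> (f j)) = 1"
    by metis
  have "inj_on f {..<n}"
  proof (rule inj_onI)
    fix i j assume ij: "i \<in> {..<n}" "j \<in> {..<n}" "f i = f j"
    then have "\<gamma> i = \<gamma> j" using f by (metis lessThan_iff)
    moreover have "i < n" "j < n" using ij(1,2) by auto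
    ultimately have "lc n \<gamma> (ev i - ev j) = 0" unfolding lc_diff by simp
    moreover have "supported n (ev i - ev j)"
      using \<open>i < n\<close> \<open>j < n\<close> by (intro supported_diff supported_ev)
    ultimately have "ev i - ev j = 0" by (rule Q.beta_indep[rotated])
    then show "i = j" by simp
  qed
  then have "f ` {..<n} = {..<n}" using f by (intro card_subset_eq) (auto simp: card_image)
  then have "height n (\<beta> k) = 1" if "k < n" for k
    using that f by (metis imageE lessThan_iff)
  then have "\<exists>i<n. \<beta> k = ev i" if "k < n" for k
    using that nonneg_height_one[OF pos(1)[OF that] P.beta_supported[OF that]] by metis
  then show ?thesis using P.beta_simple_permutes that by blast
qed

section \<open>Connectedness and quadratic forms\<close>

definition connected_matrix :: "nat \<Rightarrow> (nat \<Rightarrow> nat \<Rightarrow> int) \<Rightarrow> bool" where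
  "connected_matrix n a \<longleftrightarrow>
     (\<forall>S. S \<subset> {..<n} \<longrightarrow> S \<noteq> {} \<longrightarrow> (\<exists>i\<in>S. \<exists>j\<in>{..<n} - S. a i j \<noteq> 0))"

lemma connected_matrixE:
  assumes "connected_matrix n a" "i < n" "P i" "j < n" "\<not> P j"
  obtains k l where "k < n" "l < n" "P k" "\<not> P l" "a k l \<noteq> 0"
proof -
  let ?S = "{k. k < n \<and> P k}"
  have "?S \<subset> {..<n}" "?S \<noteq> {}" using assms(2-) by auto
  then have "\<exists>k\<in>?S. \<exists>l\<in>{..<n} - ?S. a k l \<noteq> 0"
    using assms(1) unfolding connected_matrix_def by blast
  then show ?thesis using that by auto
qed

text \<open>If \<open>a\<close> splits along \<open>S\<close>, each real root is supported inside or
  outside \<open>S\<close>. Both kinds occur among the \<beta>_j, since these span, and roots of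
  different kinds are orthogonal, so \<open>b\<close> would split as well.\<close>

lemma (in root_embedding) connected_target:
  assumes mn: "m = n" and b: "connected_matrix m b"
  shows "connected_matrix n a"
  unfolding connected_matrix_def
proof (intro allI impI, rule ccontr)
  fix S assume S: "S \<subset> {..<n}" "S \<noteq> {}" "\<not> (\<exists>i\<in>S. \<exists>j\<in>{..<n} - S. a i j \<noteq> 0)"
  have a0: "a i j = 0" "a j i = 0" if "i \<in> S" "j \<in> {..<n} - S" for i j
  proof -
    show "a i j = 0" using S(3) that by blast
    then show "a j i = 0" using A.zero_sym[of j i] that S(1) by auto
  qed
  have split: "(\<forall>k. k \<notin> S \<longrightarrow> x k = 0) \<or> (\<forall>k\<in>S. x k = 0)" if "x \<in> A.rts" for x
    using that
  proof induction
    case (rts_simple i)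
    then show ?case by (auto simp: ev_def)
  next
    case (rts_refl x i)
    have supp: "supported n x" using rts_refl A.rts_supported by blast
    from rts_refl.IH show ?case
    proof
      assume x: "\<forall>k. k \<notin> S \<longrightarrow> x k = 0"
      have "A.pr i x = 0" if "i \<notin> S"
        unfolding A.pr_def using x a0(2)[of _ i] that rts_refl(2) by (intro sum.neutral) auto
      then show ?thesis using x by (auto simp: A.refl_def)
    next
      assume x: "\<forall>k\<in>S. x k = 0"
      have "A.pr i x = 0" if "i \<in> S"
        unfolding A.pr_def using x a0(1)[of i] that by (intro sum.neutral) auto
      then show ?thesis using x by (auto simp: A.refl_def)
    qed
  qed
  obtain d where d: "d > 0" "\<And>y. \<exists>x. supported n x \<and> (\<forall>k<n. (\<Sum>j<n. x j * \<beta> j k) = d * y k)"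
  proof (rule square_independent[of n \<beta>])
    fix x assume x: "supported n x" "\<And>k. k < n \<Longrightarrow> (\<Sum>j<n. x j * \<beta> j k) = 0"
    have "lc m \<beta> x k = 0" for k
      using x(2) beta_supported mn by (cases "k < n") (auto simp: lc_def supported_def)
    then have "lc m \<beta> x = 0" by auto
    then show "x = 0" using beta_indep x(1) mn by blast
  qed blast
  have hit: "\<exists>j<m. \<beta> j s \<noteq> 0" if "s < n" for s
  proof (rule ccontr)
    assume "\<not> (\<exists>j<m. \<beta> j s \<noteq> 0)"
    moreover obtain x where "(\<Sum>j<n. x j * \<beta> j s) = d * ev s s" using d(2)[of "ev s"] \<open>s < n\<close> by blast
    ultimately show False using d(1) mn by simp
  qed
  define P where "P j \<longleftrightarrow> (\<forall>k. k \<notin> S \<longrightarrow> \<beta> j k = 0)" for j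
  have notP: "\<forall>k\<in>S. \<beta> j k = 0" if "j < m" "\<not> P j" for j
    using split[OF beta_rts[OF that(1)]] that(2) by (auto simp: P_def)
  obtain s t where st: "s \<in> S" "t < n" "t \<notin> S" using S by auto
  obtain i where i: "i < m" "\<beta> i s \<noteq> 0" using hit[of s] st S(1) by auto
  obtain j where j: "j < m" "\<beta> j t \<noteq> 0" using hit[of t] st by auto
  have "P i" using notP i st by blast
  moreover have "\<not> P j" using j st by (auto simp: P_def)
  ultimately obtain k l where kl: "k < m" "l < m" "P k" "\<not> P l" "b k l \<noteq> 0"
    using connected_matrixE[OF b i(1) _ j(1)] by metis
  have "A.form (\<beta> k) (\<beta> l) = 0"
    unfolding A.form_def
  proof (rule sum.neutral, rule ballI)
    fix q assume "q \<in> {..<n}"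
    show "D q * \<beta> k q * A.pr q (\<beta> l) = 0"
    proof (cases "q \<in> S")
      case True
      then have "A.pr q (\<beta> l) = 0"
        unfolding A.pr_def using notP[OF kl(2,4)] a0(1)[of q] by (intro sum.neutral) auto
      then show ?thesis by simp
    qed (use kl(3) in \<open>simp add: P_def\<close>)
  qed
  then show False using form_beta[OF kl(1,2)] kl(5) BF.D_pos[OF kl(1)] by simp
qed

text \<open>Put v_i = u_i t_i and use 2 t_i t_j = t_i^2 + t_j^2 - (t_i - t_j)^2. For nonpositive
  off-diagonal entries and G u \<ge> 0 this displays the form as a sum of nonnegative terms.\<close>

lemma quadratic_form_sum_of_squares:
  fixes G :: "'a \<Rightarrow> 'a \<Rightarrow> real"
  assumes "finite S" and sym: "\<And>i j. i \<in> S \<Longrightarrow> j \<in> S \<Longrightarrow> G i j = G j i"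
    and u: "\<And>i. i \<in> S \<Longrightarrow> u i > 0"
  shows "(\<Sum>i\<in>S. \<Sum>j\<in>S. G i j * v i * v j)
    = (\<Sum>i\<in>S. (v i)\<^sup>2 / u i * (\<Sum>j\<in>S. G i j * u j))
      - (\<Sum>i\<in>S. \<Sum>j\<in>S. G i j * u i * u j * (v i / u i - v j / u j)\<^sup>2) / 2"
proof -
  define T where "T = (\<Sum>i\<in>S. \<Sum>j\<in>S. G i j * (v i)\<^sup>2 * u j / u i)"
  have T1: "(\<Sum>i\<in>S. (v i)\<^sup>2 / u i * (\<Sum>j\<in>S. G i j * u j)) = T"
    unfolding T_def sum_distrib_left by (intro sum.cong HOL.refl) (simp add: field_simps)
  have T2: "(\<Sum>i\<in>S. \<Sum>j\<in>S. G i j * (v j)\<^sup>2 * u i / u j) = T"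
    unfolding T_def by (subst sum.swap) (intro sum.cong HOL.refl, simp add: sym)
  have "(\<Sum>i\<in>S. \<Sum>j\<in>S. G i j * u i * u j * (v i / u i - v j / u j)\<^sup>2)
    = (\<Sum>i\<in>S. \<Sum>j\<in>S. G i j * (v i)\<^sup>2 * u j / u i + G i j * (v j)\<^sup>2 * u i / u j - 2 * (G i j * v i * v j))"
  proof (intro sum.cong HOL.refl)
    fix i j assume ij: "i \<in> S" "j \<in> S"
    show "G i j * u i * u j * (v i / u i - v j / u j)\<^sup>2
      = G i j * (v i)\<^sup>2 * u j / u i + G i j * (v j)\<^sup>2 * u i / u j - 2 * (G i j * v i * v j)"
      using u[OF ij(1)] u[OF ij(2)] by (simp add: field_simps power2_eq_square)
  qed
  also have "\<dots> = T + T - 2 * (\<Sum>i\<in>S. \<Sum>j\<in>S. G i j * v i * v j)"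
    using T2 by (simp add: sum.distrib sum_subtractf sum_distrib_left T_def)
  finally show ?thesis unfolding T1 by (simp add: field_simps)
qed

text \<open>Gaussian elimination of one index at a time, which keeps the off-diagonal entries
  nonpositive. From a mere negative value of the form it produces a nonnegative vector that
  witnesses indefinite type.\<close>

lemma zmatrix_not_semidefinite:
  fixes G :: "'a \<Rightarrow> 'a \<Rightarrow> real"
  assumes "finite S"
    and "\<And>i j. i \<in> S \<Longrightarrow> j \<in> S \<Longrightarrow> G i j = G j i"
    and "\<And>i j. i \<in> S \<Longrightarrow> j \<in> S \<Longrightarrow> i \<noteq> j \<Longrightarrow> G i j \<le> 0"
    and "(\<Sum>i\<in>S. \<Sum>j\<in>S. G i j * v i * v j) < 0"
  shows "\<exists>u. (\<forall>i\<in>S. u i \<ge> 0) \<and> (\<forall>i\<in>S. (\<Sum>j\<in>S. G i j * u j) \<le> 0) \<and> (\<exists>i\<in>S. (\<Sum>j\<in>S. G i j * u j) < 0)"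
  using assms
proof (induction S arbitrary: G v rule: finite_induct)
  case (insert p S)
  note [simp] = insert.hyps
  have sym: "G i j = G j i" if "i \<in> insert p S" "j \<in> insert p S" for i j using insert.prems(1) that by blast
  have off: "G i j \<le> 0" if "i \<in> insert p S" "j \<in> insert p S" "i \<noteq> j" for i j using insert.prems(2) that by blast
  define c where "c = (\<Sum>j\<in>S. G p j * v j)"
  have "(\<Sum>i\<in>S. v i * (G i p * v p)) = (\<Sum>i\<in>S. v p * (G p i * v i))"
    by (intro sum.cong HOL.refl) (simp add: sym)
  then have expand: "(\<Sum>i\<in>insert p S. \<Sum>j\<in>insert p S. G i j * v i * v j)
    = G p p * (v p)\<^sup>2 + 2 * v p * c + (\<Sum>i\<in>S. \<Sum>j\<in>S. G i j * v i * v j)"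
    by (simp add: sum.distrib c_def sum_distrib_left power2_eq_square algebra_simps)
  consider (neg) "G p p < 0" | (pos) "G p p > 0" | (zero) "G p p = 0" "\<exists>j\<in>S. G p j \<noteq> 0"
    | (drop) "G p p = 0" "\<forall>j\<in>S. G p j = 0" by fastforce
  then show ?case
  proof cases
    case neg
    define u where "u = (\<lambda>i. if i = p then 1 else 0 :: real)"
    have "(\<Sum>j\<in>insert p S. G i j * u j) = G i p" for i
      by (simp add: u_def if_distrib cong: if_cong)
    moreover have "G i p \<le> 0" if "i \<in> insert p S" for i
      using that neg off[of i p] by (cases "i = p") auto
    ultimately show ?thesis using neg by (intro exI[of _ u]) (auto simp: u_def)
  next
    case zero
    then obtain j where j: "j \<in> S" "G p j < 0" using off[of p] by fastforce
    \<comment> \<open>Chosen such that K G_jp = -|G_jj|, which compensates the diagonal entry in row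
      \<open>j\<close>.\<close>
    define K where "K = \<bar>G j j\<bar> / (- G p j)"
    have K: "K \<ge> 0" "G j j + K * G j p \<le> 0"
    proof -
      have "G j p = G p j" using sym j by simp
      then have "K * G j p = - \<bar>G j j\<bar>" using j(2) by (simp add: K_def)
      then show "G j j + K * G j p \<le> 0" by linarith
      show "K \<ge> 0" unfolding K_def using j(2) by (intro divide_nonneg_nonneg) auto
    qed
    define u where "u = (\<lambda>i. if i = p then K else if i = j then 1 else 0)"
    have "(\<Sum>l\<in>S. G i l * u l) = (\<Sum>l\<in>S. if l = j then G i j else 0)" for i
      by (intro sum.cong HOL.refl) (auto simp: u_def)
    then have eq: "(\<Sum>l\<in>insert p S. G i l * u l) = K * G i p + G i j" for i
      using j by (simp add: u_def)
    have "K * G i p + G i j \<le> 0" if "i \<in> insert p S" for i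
    proof (cases "i = j")
      case False
      have "G i p \<le> 0" using that zero(1) off[of i p] by (cases "i = p") auto
      then have "K * G i p \<le> 0" using K(1) by (simp add: mult_nonneg_nonpos)
      then show ?thesis using off[of i j] that j False by auto
    qed (use K(2) in auto)
    moreover have "K * G p p + G p j < 0" using zero j by simp
    moreover have "u i \<ge> 0" for i using K(1) by (simp add: u_def)
    ultimately show ?thesis by (intro exI[of _ u]) (unfold eq, auto)
  next
    case drop
    then have "c = 0" by (simp add: c_def)
    then have "(\<Sum>i\<in>S. \<Sum>j\<in>S. G i j * v i * v j) < 0" using insert.prems(3)[unfolded expand] drop by simp
    then obtain u where u: "\<forall>i\<in>S. u i \<ge> 0" "\<forall>i\<in>S. (\<Sum>j\<in>S. G i j * u j) \<le> 0"
      "\<exists>i\<in>S. (\<Sum>j\<in>S. G i j * u j) < 0"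
      using insert.IH[of G v] sym off by auto
    define w where "w = (\<lambda>i. if i = p then 0 else u i)"
    have eq: "(\<Sum>j\<in>insert p S. G i j * w j) = (\<Sum>j\<in>S. G i j * u j)" for i
    proof -
      have "(\<Sum>j\<in>S. G i j * w j) = (\<Sum>j\<in>S. G i j * u j)"
        by (intro sum.cong HOL.refl) (auto simp: w_def)
      then show ?thesis by (simp add: w_def)
    qed
    have "\<forall>i\<in>insert p S. w i \<ge> 0" using u(1) by (simp add: w_def)
    then show ?thesis using u drop by (intro exI[of _ w]) (unfold eq, auto)
  next
    case pos
    \<comment> \<open>The Schur complement of the entry at \<open>p\<close>. Completing the square
      shows that its form at \<open>v\<close> is no larger than that of \<open>G\<close>.\<close>
    define H where "H i j = G i j - G i p * G p j / G p p" for i j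
    have "(\<Sum>i\<in>S. \<Sum>j\<in>S. H i j * v i * v j)
        = (\<Sum>i\<in>S. \<Sum>j\<in>S. G i j * v i * v j) - (\<Sum>i\<in>S. \<Sum>j\<in>S. (G i p * v i) * (G p j * v j)) / G p p"
      by (simp add: H_def algebra_simps sum_subtractf sum_divide_distrib)
    also have "(\<Sum>i\<in>S. \<Sum>j\<in>S. (G i p * v i) * (G p j * v j)) = (\<Sum>i\<in>S. G i p * v i) * c"
      by (simp add: sum_product c_def)
    also have "(\<Sum>i\<in>S. G i p * v i) = c"
      unfolding c_def by (intro sum.cong HOL.refl) (simp add: sym)
    finally have H: "(\<Sum>i\<in>S. \<Sum>j\<in>S. H i j * v i * v j) = (\<Sum>i\<in>S. \<Sum>j\<in>S. G i j * v i * v j) - c * c / G p p" .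
    have "G p p * (v p)\<^sup>2 + 2 * v p * c + c * c / G p p = (G p p * v p + c)\<^sup>2 / G p p"
      using pos by (simp add: power2_eq_square field_simps)
    moreover have "\<dots> \<ge> 0" using pos by simp
    ultimately have "(\<Sum>i\<in>S. \<Sum>j\<in>S. H i j * v i * v j) < 0"
      using insert.prems(3) unfolding expand H by linarith
    moreover have "H i j = H j i" if "i \<in> S" "j \<in> S" for i j
      using that sym[of i j] sym[of i p] sym[of p j] by (simp add: H_def)
    moreover have "H i j \<le> 0" if "i \<in> S" "j \<in> S" "i \<noteq> j" for i j
    proof -
      have "i \<noteq> p" "j \<noteq> p" using that insert.hyps by auto
      then have "G i p * G p j \<ge> 0" using off[of i p] off[of p j] that by (simp add: mult_nonpos_nonpos)
      then have "G i p * G p j / G p p \<ge> 0" using pos by simp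
      then show ?thesis using off[of i j] that by (simp add: H_def)
    qed
    ultimately obtain u where u: "\<forall>i\<in>S. u i \<ge> 0" "\<forall>i\<in>S. (\<Sum>j\<in>S. H i j * u j) \<le> 0"
      "\<exists>i\<in>S. (\<Sum>j\<in>S. H i j * u j) < 0"
      using insert.IH[of H v] by auto
    \<comment> \<open>The value at \<open>p\<close> for which row \<open>p\<close> vanishes; the
      other rows then reduce to those of \<open>H\<close>.\<close>
    define t where "t = - (\<Sum>j\<in>S. G p j * u j) / G p p"
    define w where "w = (\<lambda>i. if i = p then t else u i)"
    have sw: "(\<Sum>j\<in>S. G i j * w j) = (\<Sum>j\<in>S. G i j * u j)" for i
      by (intro sum.cong HOL.refl) (auto simp: w_def)
    have "(\<Sum>j\<in>insert p S. G p j * w j) = 0" using pos by (simp add: sw, simp add: w_def t_def)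
    moreover have eq: "(\<Sum>j\<in>insert p S. G i j * w j) = (\<Sum>j\<in>S. H i j * u j)" for i
      by (simp add: sw, simp add: w_def t_def H_def algebra_simps sum_subtractf sum_divide_distrib sum_distrib_left)
    moreover have "\<forall>i\<in>insert p S. w i \<ge> 0"
    proof -
      have "(\<Sum>j\<in>S. G p j * u j) \<le> 0"
      proof (rule sum_nonpos)
        fix j assume "j \<in> S"
        moreover from this have "p \<noteq> j" using insert.hyps by blast
        ultimately show "G p j * u j \<le> 0" using off[of p j] u(1) by (auto intro: mult_nonpos_nonneg)
      qed
      then have "t \<ge> 0" using pos by (simp add: t_def divide_nonpos_pos)
      then show ?thesis using u(1) by (simp add: w_def)
    qed
    ultimately show ?thesis using u by (intro exI[of _ w]) (unfold eq, auto)
  qed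
qed simp

context gcm_system
begin

text \<open>A large multiple of \<open>u\<close> is rounded down. Rounding costs at most the sum of
  the |a_ij| in row \<open>i\<close>, which a large factor outweighs.\<close>

lemma integral_negative_vector:
  fixes u :: "nat \<Rightarrow> real"
  assumes u: "\<And>i. i < n \<Longrightarrow> u i \<ge> 0" and neg: "\<And>i. i < n \<Longrightarrow> (\<Sum>j<n. real_of_int (a i j) * u j) < 0"
  shows "\<exists>w. nonneg w \<and> (\<forall>i<n. pr i w < 0)"
proof -
  have ev: "eventually (\<lambda>K. \<forall>i\<in>{..<n}. K * (\<Sum>j<n. real_of_int (a i j) * u j) + (\<Sum>j<n. \<bar>real_of_int (a i j)\<bar>) < 0) at_top"
  proof (rule eventually_ball_finite)
    show "\<forall>i\<in>{..<n}. eventually (\<lambda>K. K * (\<Sum>j<n. real_of_int (a i j) * u j) + (\<Sum>j<n. \<bar>real_of_int (a i j)\<bar>) < 0) at_top"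
    proof
      fix i assume "i \<in> {..<n}"
      define c C where "c = (\<Sum>j<n. real_of_int (a i j) * u j)" and "C = (\<Sum>j<n. \<bar>real_of_int (a i j)\<bar>)"
      have "c < 0" using neg \<open>i \<in> {..<n}\<close> by (simp add: c_def)
      have "K * c + C < 0" if "K > C / (- c)" for K
        using that \<open>c < 0\<close> by (simp add: field_simps)
      then show "eventually (\<lambda>K. K * c + C < 0) at_top"
        using eventually_gt_at_top[of "C / (- c)"] by (rule eventually_mono[rotated])
    qed
  qed simp
  then obtain K where K: "K \<ge> 0" "\<And>i. i < n \<Longrightarrow> K * (\<Sum>j<n. real_of_int (a i j) * u j) + (\<Sum>j<n. \<bar>real_of_int (a i j)\<bar>) < 0"
    using eventually_conj[OF ev eventually_ge_at_top[of 0]] by (auto simp: eventually_at_top_linorder)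
  define w where "w k = (if k < n then \<lfloor>K * u k\<rfloor> else 0)" for k
  have "nonneg w" using u K(1) by (simp add: nonneg_def w_def)
  moreover have "pr i w < 0" if "i < n" for i
  proof -
    have "real_of_int (a i j) * \<lfloor>K * u j\<rfloor> \<le> K * (real_of_int (a i j) * u j) + \<bar>real_of_int (a i j)\<bar>" for j
    proof -
      define e where "e = K * u j - \<lfloor>K * u j\<rfloor>"
      have "0 \<le> e" "e \<le> 1" unfolding e_def by linarith+
      then have "\<bar>real_of_int (a i j) * e\<bar> \<le> \<bar>real_of_int (a i j)\<bar> * 1"
        unfolding abs_mult by (intro mult_left_mono) auto
      moreover have "real_of_int (a i j) * \<lfloor>K * u j\<rfloor> = K * (real_of_int (a i j) * u j) - real_of_int (a i j) * e"
        by (simp add: e_def algebra_simps)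
      ultimately show ?thesis by linarith
    qed
    then have "(\<Sum>j<n. real_of_int (a i j) * \<lfloor>K * u j\<rfloor>)
        \<le> (\<Sum>j<n. K * (real_of_int (a i j) * u j) + \<bar>real_of_int (a i j)\<bar>)"
      by (intro sum_mono)
    also have "\<dots> < 0" using K(2)[OF that] by (simp add: sum.distrib sum_distrib_left)
    finally have "real_of_int (pr i w) < 0" by (simp add: pr_def w_def)
    then show ?thesis by simp
  qed
  ultimately show ?thesis by blast
qed

text \<open>Some negative row \<open>k\<close> is adjacent to a zero row \<open>l\<close>.
  Increasing u_k a little makes row \<open>l\<close> negative and keeps all rows nonpositive, so the
  number of zero rows drops.\<close>

lemma spread_negativity:
  fixes u :: "nat \<Rightarrow> real"
  assumes conn: "connected_matrix n a"
    and u: "\<And>i. i < n \<Longrightarrow> u i \<ge> 0" "\<And>i. i < n \<Longrightarrow> (\<Sum>j<n. real_of_int (a i j) * u j) \<le> 0"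
      "\<exists>i<n. (\<Sum>j<n. real_of_int (a i j) * u j) < 0"
  shows "\<exists>w. nonneg w \<and> (\<forall>i<n. pr i w < 0)"
  using u
proof (induction "card {i. i < n \<and> (\<Sum>j<n. real_of_int (a i j) * u j) = 0}" arbitrary: u rule: less_induct)
  case less
  define val where "val w i = (\<Sum>j<n. real_of_int (a i j) * w j)" for w :: "nat \<Rightarrow> real" and i
  have prems: "\<And>i. i < n \<Longrightarrow> u i \<ge> 0" "\<And>i. i < n \<Longrightarrow> val u i \<le> 0" "\<exists>i<n. val u i < 0"
    using less.prems by (auto simp: val_def)
  show ?case
  proof (cases "\<forall>i<n. val u i < 0")
    case True
    then show ?thesis using integral_negative_vector[of u] prems(1) by (simp add: val_def)
  next
    case False
    then obtain i j where ij: "i < n" "val u i < 0" "j < n" "\<not> val u j < 0" using prems(3) by blast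
    obtain k l where kl: "k < n" "l < n" "val u k < 0" "\<not> val u l < 0" "a k l \<noteq> 0"
      by (rule connected_matrixE[OF conn ij])
    have l0: "val u l = 0" using prems(2)[OF kl(2)] kl(4) by linarith
    have "k \<noteq> l" using kl by auto
    have alk: "a l k < 0"
      using offdiag[of l k] zero_sym[of k l] kl \<open>k \<noteq> l\<close> by (auto simp: order.order_iff_strict)
    \<comment> \<open>The diagonal entry is 2, so the value in row \<open>k\<close> is halved and
      stays negative.\<close>
    define e where "e = - val u k / 4"
    have "e > 0" using kl(3) by (simp add: e_def)
    define w where "w = (\<lambda>i. u i + (if i = k then e else 0))"
    have w: "val w i = val u i + real_of_int (a i k) * e" for i
    proof -
      have "val w i = (\<Sum>j<n. real_of_int (a i j) * u j + (if j = k then real_of_int (a i j) * e else 0))"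
        unfolding val_def w_def by (intro sum.cong) (auto simp: algebra_simps)
      then show ?thesis using kl(1) by (simp add: sum.distrib val_def)
    qed
    have wle: "val w i \<le> val u i" if "i < n" "i \<noteq> k" for i
      using offdiag[of i k] that kl(1) \<open>e > 0\<close> by (simp add: w mult_nonpos_nonneg)
    have wk: "val w k < 0" using kl(1,3) by (simp add: w diag e_def)
    have wl: "val w l < 0" using l0 alk \<open>e > 0\<close> by (simp add: w mult_neg_pos)
    have "{i. i < n \<and> val w i = 0} \<subset> {i. i < n \<and> val u i = 0}"
    proof -
      have "val u i = 0" if "i < n" "val w i = 0" for i
        using wle[of i] prems(2)[of i] wk that by (cases "i = k") auto
      then have "{i. i < n \<and> val w i = 0} \<subseteq> {i. i < n \<and> val u i = 0}" by blast
      moreover have "l \<in> {i. i < n \<and> val u i = 0}" "l \<notin> {i. i < n \<and> val w i = 0}"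
        using l0 wl kl(2) by auto
      ultimately show ?thesis by blast
    qed
    then have "card {i. i < n \<and> val w i = 0} < card {i. i < n \<and> val u i = 0}"
      by (intro psubset_card_mono) auto
    moreover have "w i \<ge> 0" if "i < n" for i using prems(1)[OF that] \<open>e > 0\<close> by (simp add: w_def)
    moreover have "val w i \<le> 0" if "i < n" for i
      using wle[of i] prems(2)[OF that] wk that by (cases "i = k") auto
    ultimately show ?thesis
      using less.hyps[of w] wl kl(2) by (auto simp: val_def)
  qed
qed

end

context sym_gcm
begin

lemma form_eq_double_sum: "form x x = (\<Sum>i<n. \<Sum>j<n. (D i * a i j) * x i * x j)"
  by (simp add: form_def pr_def sum_distrib_left algebra_simps)

lemma form_nonneg_on:
  fixes u :: "nat \<Rightarrow> real"
  assumes S: "S \<subseteq> {..<n}" and u: "\<And>i. i \<in> S \<Longrightarrow> u i > 0"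
      "\<And>i. i \<in> S \<Longrightarrow> (\<Sum>j\<in>S. real_of_int (a i j) * u j) \<ge> 0"
    and x: "\<And>k. k < n \<Longrightarrow> k \<notin> S \<Longrightarrow> x k = 0"
  shows "form x x \<ge> 0"
proof -
  define G where "G i j = real_of_int (D i * a i j)" for i j
  have fin: "finite S" using S finite_subset by blast
  have "form x x = (\<Sum>i\<in>S. \<Sum>j\<in>S. (D i * a i j) * x i * x j)"
    unfolding form_eq_double_sum using S x
    by (intro sum.mono_neutral_cong_right) (auto intro!: sum.mono_neutral_right)
  then have "real_of_int (form x x) = (\<Sum>i\<in>S. \<Sum>j\<in>S. G i j * x i * x j)" by (simp add: G_def)
  also have "\<dots> = (\<Sum>i\<in>S. (real_of_int (x i))\<^sup>2 / u i * (\<Sum>j\<in>S. G i j * u j))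
      - (\<Sum>i\<in>S. \<Sum>j\<in>S. G i j * u i * u j * (x i / u i - x j / u j)\<^sup>2) / 2"
  proof (rule quadratic_form_sum_of_squares[OF fin _ u(1)])
    show "G i j = G j i" if "i \<in> S" "j \<in> S" for i j
    proof -
      have "i < n" "j < n" using S that by auto
      then show ?thesis unfolding G_def by (metis D_sym)
    qed
  qed
  also have "\<dots> \<ge> 0"
  proof -
    have "(\<Sum>i\<in>S. (real_of_int (x i))\<^sup>2 / u i * (\<Sum>j\<in>S. G i j * u j)) \<ge> 0"
    proof (rule sum_nonneg, rule mult_nonneg_nonneg)
      fix i assume i: "i \<in> S"
      have "(\<Sum>j\<in>S. G i j * u j) = D i * (\<Sum>j\<in>S. real_of_int (a i j) * u j)"
        by (simp add: G_def sum_distrib_left algebra_simps)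
      then show "(\<Sum>j\<in>S. G i j * u j) \<ge> 0" using u(2)[OF i] D_pos[of i] S i by auto
      show "(real_of_int (x i))\<^sup>2 / u i \<ge> 0" using u(1)[OF i] by simp
    qed
    moreover have "(\<Sum>i\<in>S. \<Sum>j\<in>S. G i j * u i * u j * (x i / u i - x j / u j)\<^sup>2) \<le> 0"
    proof (intro sum_nonpos)
      fix i j assume ij: "i \<in> S" "j \<in> S"
      show "G i j * u i * u j * (x i / u i - x j / u j)\<^sup>2 \<le> 0"
      proof (cases "i = j")
        case False
        then have "D i * a i j \<le> 0"
          using offdiag[of i j] D_pos[of i] S ij by (intro mult_nonneg_nonpos) (auto simp: less_imp_le)
        then have "G i j \<le> 0" by (simp add: G_def flip: of_int_mult)
        then show ?thesis using u(1)[OF ij(1)] u(1)[OF ij(2)]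
          by (intro mult_nonpos_nonneg) auto
      qed simp
    qed
    ultimately show ?thesis by linarith
  qed
  finally show ?thesis by simp
qed

text \<open>The norm of N x + \<alpha>_i is affine in \<open>N\<close> with slope a multiple of
  \<open>pr i x\<close>, so it can be nonnegative for all \<open>N\<close> only if the slope is 0.
  Nonnegativity is asked of these vectors alone, so that the lemma applies to a form that is
  semidefinite on a hyperplane.\<close>

lemma isotropic_pr_eq_0:
  assumes psd: "\<And>N. form (\<lambda>k. N * x k + ev i k) (\<lambda>k. N * x k + ev i k) \<ge> 0"
    and x: "form x x = 0" and i: "i < n"
  shows "pr i x = 0"
proof (rule ccontr)
  assume ne: "pr i x \<noteq> 0"
  define N where "N = - 2 * pr i x"
  have "(\<lambda>k. N * x k + ev i k) = (\<lambda>k. N * x k) + ev i" by auto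
  then have "form (\<lambda>k. N * x k + ev i k) (\<lambda>k. N * x k + ev i k) = 2 * D i * (N * pr i x + 1)"
    using i x by (simp add: form_simps diag algebra_simps)
  then have "2 * D i * (N * pr i x + 1) \<ge> 0" using psd[of N] by simp
  then have "N * pr i x + 1 \<ge> 0" using D_pos[OF i] by (simp add: zero_le_mult_iff)
  moreover have "pr i x * pr i x > 0" using ne by (auto simp: zero_less_mult_iff)
  ultimately show False by (simp add: N_def algebra_simps)
qed

lemma dual_basis:
  assumes "\<And>x. supported n x \<Longrightarrow> (\<And>i. i < n \<Longrightarrow> pr i x = 0) \<Longrightarrow> x = 0"
  obtains d where "d > 0" "\<And>y. \<exists>x. supported n x \<and> (\<forall>i<n. pr i x = d * y i)"
proof -
  have eq: "(\<Sum>j<n. x j * a i j) = pr i x" for x i by (simp add: pr_def mult.commute)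
  show ?thesis
    by (rule square_independent[of n "\<lambda>j i. a i j"]) (use assms that in \<open>simp_all add: eq\<close>)
qed

end

section \<open>Finite and hyperbolic matrices\<close>

lemma ev_nonzero: "ev i \<noteq> 0"
  by (metis ev_apply(1) zero_fun_apply zero_neq_one)

definition pos_part :: "(nat \<Rightarrow> int) \<Rightarrow> nat \<Rightarrow> int" where
  "pos_part x = (\<lambda>k. max (x k) 0)"

lemma pos_part_decomp: "x = pos_part x - pos_part (- x)"
  by (auto simp: pos_part_def)

lemma nonneg_pos_part [simp]: "nonneg (pos_part x)"
  by (simp add: nonneg_def pos_part_def)

lemma supported_pos_part: "supported n x \<Longrightarrow> supported n (pos_part x)"
  by (simp add: supported_def pos_part_def)

lemma pos_part_uminus_eq_0_iff: "pos_part (- x) = 0 \<longleftrightarrow> nonneg x"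
  by (auto simp: pos_part_def nonneg_def fun_eq_iff max_def)

lemma pos_part_disjoint: "pos_part x k = 0 \<or> pos_part (- x) k = 0"
  by (auto simp: pos_part_def)

context sym_gcm
begin

lemma form_disjoint_nonpos:
  assumes "nonneg p" "nonneg q" "\<And>k. p k = 0 \<or> q k = 0"
  shows "form p q \<le> 0"
  unfolding form_def
proof (rule sum_nonpos)
  fix i assume i: "i \<in> {..<n}"
  show "D i * p i * pr i q \<le> 0"
  proof (cases "p i = 0")
    case False
    have "a i j * q j \<le> 0" if "j \<in> {..<n}" for j
    proof (cases "j = i")
      case True
      then show ?thesis using False assms(3)[of i] by auto
    next
      case False
      then show ?thesis using offdiag[of i j] i that nonnegD[OF assms(2), of j]
        by (auto intro: mult_nonpos_nonneg)
    qed
    then have "pr i q \<le> 0" unfolding pr_def by (rule sum_nonpos)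
    moreover have "D i * p i \<ge> 0" using D_pos[of i] i nonnegD[OF assms(1), of i] by simp
    ultimately show ?thesis by (rule mult_nonneg_nonpos[rotated])
  qed simp
qed

lemma form_pos_part: "form (pos_part x) (pos_part x) = form (pos_part x) x + form (pos_part x) (pos_part (- x))"
  using pos_part_decomp[of x] form_diff_right[of "pos_part x" "pos_part x" "pos_part (- x)"] by simp

end

text \<open>\<open>Q\<close> ranges over all symmetrizers of \<open>b\<close>, because the
  composition needs the one induced by the first family, and that family is replaced during
  normalization.\<close>

theorem finite_mutual_embedding:
  assumes P: "root_embedding n a D n b \<beta>"
    and Q: "\<And>N. sym_gcm n b N \<Longrightarrow> root_embedding n b N n a \<gamma>"
    and u: "\<And>i. i < n \<Longrightarrow> u i > (0::real)"
      "\<And>i. i < n \<Longrightarrow> (\<Sum>j<n. real_of_int (a i j) * u j) \<ge> 0"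
    and fin: "\<And>v. supported n v \<Longrightarrow> (\<And>i. i < n \<Longrightarrow> gcm_system.pr n a i v \<ge> 0) \<Longrightarrow>
      (\<forall>i<n. v i > 0) \<or> v = 0"
  obtains p where "p permutes {..<n}" "\<And>i j. i < n \<Longrightarrow> j < n \<Longrightarrow> b i j = a (p i) (p j)"
proof -
  interpret P: root_embedding n a D n b \<beta> by fact
  have psd: "P.A.form x x \<ge> 0" for x
    by (rule P.A.form_nonneg_on[of "{..<n}" u]) (use u in auto)
  have ker: "x = 0" if x: "supported n x" "\<And>i. i < n \<Longrightarrow> P.A.pr i x = 0" for x
  proof -
    have "(\<forall>i<n. x i > 0) \<or> x = 0" using fin[of x] x by simp
    moreover have "(\<forall>i<n. (- x) i > 0) \<or> - x = 0" using fin[of "- x"] x by (simp add: P.A.pr_uminus)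
    ultimately have "x k = 0" for k
      using x(1) by (cases "k < n") (force simp: supported_def fun_eq_iff)+
    then show ?thesis by auto
  qed
  have definite: "x = 0" if x: "supported n x" "P.A.form x x = 0" for x
    by (rule ker[OF x(1)], rule P.A.isotropic_pr_eq_0[OF psd x(2)])
  obtain d where d: "d > 0" "\<And>y. \<exists>x. supported n x \<and> (\<forall>i<n. P.A.pr i x = d * y i)"
    by (rule P.A.dual_basis[OF ker]) auto
  obtain z where z: "\<And>i. i < n \<Longrightarrow> P.A.pr i z > 0"
    using d(2)[of "\<lambda>_. 1"] d(1) by auto
  \<comment> \<open>The form is definite on the lattice of \<open>a\<close> and is pulled back along
    the injective isometry \<open>lc n \<beta>\<close>, so \<open>b\<close> is nonsingular
    too.\<close>
  have kerB: "x = 0" if x: "supported n x" "\<And>i. i < n \<Longrightarrow> P.B.pr i x = 0" for x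
  proof -
    have "P.A.form (lc n \<beta> x) (lc n \<beta> x) = 0" using x(2) by (simp add: P.form_lc P.BF.form_def)
    then have "lc n \<beta> x = 0" using P.beta_supported by (intro definite lc_supported) auto
    then show ?thesis using P.beta_indep x(1) by blast
  qed
  obtain e where e: "e > 0" "\<And>y. \<exists>x. supported n x \<and> (\<forall>i<n. P.B.pr i x = e * y i)"
    by (rule P.BF.dual_basis[OF kerB]) auto
  obtain w where w: "\<And>i. i < n \<Longrightarrow> P.B.pr i w > 0"
    using e(2)[of "\<lambda>_. 1"] e(1) by auto
  obtain \<beta>' where P': "root_embedding n a D n b \<beta>'" and \<beta>': "\<And>j. j < n \<Longrightarrow> nonneg (\<beta>' j)"
    using P.normalize[of z w] z w psd by blast
  interpret P': root_embedding n a D n b \<beta>' by fact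
  have Q1: "root_embedding n b P'.N n a \<gamma>" by (rule Q) (rule P'.BF.sym_gcm_axioms)
  interpret Q: root_embedding n b P'.N n a \<gamma> by (rule Q1)
  have psdB: "P'.BF.form x x \<ge> 0" for x using psd[of "lc n \<beta>' x"] by (simp add: P'.form_lc)
  obtain \<gamma>' where Q': "root_embedding n b P'.N n a \<gamma>'" and \<gamma>': "\<And>j. j < n \<Longrightarrow> nonneg (\<gamma>' j)"
    using Q.normalize[of w z] z w psdB by blast
  interpret Q': root_embedding n b P'.N n a \<gamma>' by fact
  have R: "root_embedding n a D n a (\<lambda>j. lc n \<beta>' (\<gamma>' j))" by (rule root_embedding_comp[OF P' Q'])
  have pos: "nonneg (lc n \<beta>' (\<gamma>' j))" if "j < n" for j
    by (intro P'.lc_nonneg \<beta>' \<gamma>' that)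
  have "\<forall>k. \<exists>x. supported n x \<and> (\<forall>i<n. P.A.pr i x = d * ev k i)" using d(2) by blast
  then obtain M where M: "\<And>k. supported n (M k)" "\<And>k i. i < n \<Longrightarrow> P.A.pr i (M k) = d * ev k i"
    by metis
  \<comment> \<open>A column of a positive multiple of the inverse is nonzero with nonnegative
    image, so class (Fin) makes all its entries positive.\<close>
  have Mpos: "M k i > 0" if "k < n" "i < n" for k i
  proof -
    have "P.A.pr i (M k) \<ge> 0" if "i < n" for i using M(2)[OF that] d(1) nonneg_ev nonnegD by simp
    moreover have "M k \<noteq> 0" using M(2)[of k k] \<open>k < n\<close> d(1) by auto
    ultimately show ?thesis using fin[of "M k"] M(1) that by blast
  qed
  have "nonneg (M k)" if "k < n" for k
    unfolding nonneg_def using Mpos[OF that] M(1)[of k]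
    by (metis less_imp_le not_le order_refl supportedD)
  then have "height n (lc n \<beta>' (\<gamma>' j)) = 1" if "j < n" for j
    by (intro self_embedding_simple[OF R pos, of M d]) (use M d Mpos that in auto)
  then show ?thesis
    using mutual_embedding_permutation[OF P' Q' \<beta>' \<gamma>'] that by blast
qed

text \<open>Removing a vertex leaves components of finite or affine type, so the form is
  semidefinite on every coordinate hyperplane. The last condition is the second half of class (Ind),
  for integral vectors.\<close>

locale hyperbolic_gcm = sym_gcm +
  assumes two_le: "2 \<le> n"
    and conn: "connected_matrix n a"
    and semidefinite: "k < n \<Longrightarrow> x k = 0 \<Longrightarrow> form x x \<ge> 0"
    and indefinite: "nonneg x \<Longrightarrow> supported n x \<Longrightarrow> (\<And>i. i < n \<Longrightarrow> pr i x \<ge> 0) \<Longrightarrow> x = 0"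
begin

text \<open>The combination of \<open>x\<close> and \<open>y\<close> that vanishes at vertex 0 has
  nonnegative norm. For orthogonal negative vectors this forces y 0 = 0, and then \<open>y\<close>
  itself contradicts semidefiniteness.\<close>

lemma lorentzian: lorentzian
  unfolding lorentzian_def
proof (intro allI impI notI)
  fix x y
  assume x: "form x x < 0" and y: "form y y < 0" and xy: "form x y = 0"
  define v where "v = (\<lambda>k. y 0 * x k) - (\<lambda>k. x 0 * y k)"
  have "form y x = 0" using xy form_commute[of x y] by simp
  then have v: "form v v = (y 0)\<^sup>2 * form x x + (x 0)\<^sup>2 * form y y"
    using xy by (simp add: v_def form_simps power2_eq_square)
  have "form v v \<ge> 0" using two_le by (intro semidefinite[of 0]) (auto simp: v_def)
  moreover have "(y 0)\<^sup>2 * form x x \<le> 0" "(x 0)\<^sup>2 * form y y \<le> 0"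
    using x y by (simp_all add: mult_nonneg_nonpos)
  ultimately have "(y 0)\<^sup>2 * form x x = 0" using v by linarith
  then have "y 0 = 0" using x by simp
  then have "form y y \<ge> 0" using two_le by (intro semidefinite[of 0]) auto
  then show False using y by simp
qed

lemma isotropic_pr_off:
  assumes "k < n" "x k = 0" "form x x = 0" "i < n" "i \<noteq> k"
  shows "pr i x = 0"
  using assms by (intro isotropic_pr_eq_0 semidefinite[of k]) auto

text \<open>Such an \<open>x\<close> is isotropic. If it vanished at a second vertex,
  semidefiniteness on the two hyperplanes would give A x = 0, which (Ind) excludes.\<close>

lemma isotropic_support:
  assumes x: "nonneg x" "supported n x" "x \<noteq> 0" "k < n" "x k = 0" "form x x \<le> 0"
    and i: "i < n" "i \<noteq> k"
  shows "x i > 0"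
proof (rule ccontr)
  assume "\<not> x i > 0"
  then have xi: "x i = 0" using nonnegD[OF x(1), of i] by linarith
  have "form x x = 0" using semidefinite[of k x] x by linarith
  then have "pr j x = 0" if "j < n" for j
    using isotropic_pr_off[of k x j] isotropic_pr_off[of i x j] x xi i that by (cases "j = k") auto
  then show False using indefinite x by auto
qed

text \<open>Write v = p - q with disjoint supports. As (p, v) = 0, the norm of \<open>p\<close> is
  (p, q) \<le> 0, so \<open>p\<close> is positive off one vertex \<open>k\<close>. Hence
  \<open>q\<close> is a multiple of \<alpha>_k and has positive norm, but (q, q) = (p, q) as
  well.\<close>

lemma kernel_trivial:
  assumes v: "supported n v" "\<And>i. i < n \<Longrightarrow> pr i v = 0"
  shows "v = 0"
proof (rule ccontr)
  assume "v \<noteq> 0"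
  have form0: "form y v = 0" for y using v(2) by (simp add: form_def)
  define p q where "p = pos_part v" and "q = pos_part (- v)"
  have pq: "nonneg p" "supported n p" "nonneg q" "supported n q" "\<And>k. p k = 0 \<or> q k = 0"
    using v(1) pos_part_disjoint by (auto simp: p_def q_def supported_pos_part)
  have "p \<noteq> 0"
  proof
    assume "p = 0"
    then have "nonneg (- v)" using pos_part_uminus_eq_0_iff[of "- v"] by (simp add: p_def)
    then show False using indefinite[of "- v"] v \<open>v \<noteq> 0\<close> by (simp add: pr_uminus)
  qed
  have "q \<noteq> 0"
  proof
    assume "q = 0"
    then have "nonneg v" using pos_part_uminus_eq_0_iff[of v] by (simp add: q_def)
    then show False using indefinite[of v] v \<open>v \<noteq> 0\<close> by simp
  qed
  then obtain k where k: "q k \<noteq> 0" by (metis ext zero_fun_apply)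
  then have kn: "k < n" using pq(4) by (meson not_le supportedD)
  have pk: "p k = 0" using pq(5) k by blast
  have "form p p \<le> 0" using form_pos_part[of v] form0 form_disjoint_nonpos[OF pq(1,3,5)] by (simp add: p_def q_def)
  then have p_pos: "p i > 0" if "i < n" "i \<noteq> k" for i
    using isotropic_support[OF pq(1,2) \<open>p \<noteq> 0\<close> kn pk] that by blast
  have "q i = 0" if "i \<noteq> k" for i
    using p_pos[of i] pq(5)[of i] supportedD[OF pq(4), of i] that by (metis less_irrefl not_le)
  then have q: "q = (\<lambda>i. q k * ev k i)" by (auto simp: ev_def)
  have "form q q = 2 * D k * (q k)\<^sup>2"
    by (subst (1 2) q) (use kn in \<open>simp add: form_simps diag power2_eq_square\<close>)
  also have "\<dots> > 0" using D_pos[OF kn] k by simp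
  finally have "form q q > 0" .
  moreover have "form q q \<le> 0"
    using form_pos_part[of "- v"] form0 form_disjoint_nonpos[OF pq(3,1)] pq(5)
    by (simp add: p_def q_def form_simps disj_commute)
  ultimately show False by simp
qed

text \<open>\<open>v\<close> is a column of a negative multiple of the inverse. If v_j < 0, its
  positive part \<open>p\<close> vanishes at \<open>j\<close> and has norm \<le> 0, so it is
  positive elsewhere and the negative part is a multiple of \<alpha>_j. Then \<open>p\<close> is
  isotropic and orthogonal to all simple roots, against (Ind).\<close>

lemma negative_dual_nonneg:
  assumes v: "supported n v" "\<And>i. i < n \<Longrightarrow> pr i v = - d * ev k i" and d: "d > 0" and k: "k < n"
  shows "nonneg v"
proof (rule ccontr)
  assume nn: "\<not> nonneg v"
  have formv: "form y v = - d * D k * y k" for y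
  proof -
    have "form y v = (\<Sum>i<n. (- d * D i * y i) * ev k i)"
      unfolding form_def using v(2) by (intro sum.cong) auto
    also have "\<dots> = - d * D k * y k" using k by (rule sum_mult_ev)
    finally show ?thesis .
  qed
  define p q where "p = pos_part v" and "q = pos_part (- v)"
  have pq: "nonneg p" "supported n p" "nonneg q" "supported n q" "\<And>k. p k = 0 \<or> q k = 0"
    using v(1) pos_part_disjoint by (auto simp: p_def q_def supported_pos_part)
  have "p \<noteq> 0"
  proof
    assume "p = 0"
    then have neg: "nonneg (- v)" using pos_part_uminus_eq_0_iff[of "- v"] by (simp add: p_def)
    have "pr i (- v) \<ge> 0" if "i < n" for i
      using v(2)[OF that] d nonnegD[OF nonneg_ev, of k i] by (simp add: pr_uminus)
    then have "- v = 0" using indefinite[OF neg] v(1) by simp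
    then have "pr k v = 0" by simp
    then show False using v(2)[OF k] d by simp
  qed
  obtain j where j: "v j < 0" using nn by (auto simp: nonneg_def not_le)
  then have jn: "j < n" using v(1) by (metis less_irrefl not_le supportedD)
  have pj: "p j = 0" "q j > 0" using j by (simp_all add: p_def q_def pos_part_def)
  have pp: "form p p = - d * D k * p k + form p q" using form_pos_part[of v] formv by (simp add: p_def q_def)
  have pq0: "form p q \<le> 0" using form_disjoint_nonpos[OF pq(1,3,5)] .
  have pk: "- d * D k * p k \<le> 0" using d D_pos[OF k] nonnegD[OF pq(1), of k] by simp
  have p_pos: "p i > 0" if "i < n" "i \<noteq> j" for i
    using isotropic_support[OF pq(1,2) \<open>p \<noteq> 0\<close> jn pj(1)] pp pq0 pk that by simp
  have "q i = 0" if "i \<noteq> j" for i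
    using p_pos[of i] pq(5)[of i] supportedD[OF pq(4), of i] that by (metis less_irrefl not_le)
  then have q: "q = (\<lambda>i. q j * ev j i)" by (auto simp: ev_def)
  have "form p p \<ge> 0" using semidefinite[of j p] jn pj(1) by blast
  then have "form p q = 0" "form p p = 0" using pp pq0 pk by linarith+
  have "form p q = q j * (D j * pr j p)"
    by (subst q) (use jn in \<open>simp add: form_simps\<close>)
  then have "pr j p = 0" using \<open>form p q = 0\<close> pj(2) D_pos[OF jn] by simp
  moreover have "pr i p = 0" if "i < n" "i \<noteq> j" for i
    using isotropic_pr_off[of j p i] jn pj(1) \<open>form p p = 0\<close> that by blast
  ultimately have "pr i p \<ge> 0" if "i < n" for i using that by (cases "i = j") auto
  then show False using indefinite[OF pq(1,2)] \<open>p \<noteq> 0\<close> by blast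
qed

text \<open>If v_i = 0, then \<open>v\<close> is positive at all other vertices, and row
  \<open>i\<close>, a sum of nonpositive terms equal to 0, cuts \<open>i\<close> off from the
  diagram. Diagonal entries are left out, as they may vanish.\<close>

lemma negative_dual_pos:
  assumes v: "supported n v" "\<And>i. i < n \<Longrightarrow> pr i v = - d * ev k i" and d: "d > 0" and k: "k < n"
    and i: "i < n" "i \<noteq> k"
  shows "v i > 0"
proof (rule ccontr)
  assume "\<not> v i > 0"
  have nn: "nonneg v" by (rule negative_dual_nonneg[OF v d k])
  have vi: "v i = 0" using \<open>\<not> v i > 0\<close> nonnegD[OF nn, of i] by linarith
  have "v \<noteq> 0" using v(2)[OF k] d by auto
  have "form v v = (\<Sum>l<n. (- d * D l * v l) * ev k l)"
    unfolding form_def using v(2) by (intro sum.cong) auto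
  also have "\<dots> = - d * D k * v k" using k by (rule sum_mult_ev)
  also have "\<dots> \<le> 0" using d D_pos[OF k] nonnegD[OF nn, of k] by simp
  finally have pos: "v j > 0" if "j < n" "j \<noteq> i" for j
    using isotropic_support[OF nn v(1) \<open>v \<noteq> 0\<close> i(1) vi _ that] by blast
  have "(\<Sum>j<n. - (a i j * v j)) = 0" using v(2)[OF i(1)] i by (simp add: pr_def sum_negf)
  moreover have "- (a i j * v j) \<ge> 0" if "j < n" for j
    using offdiag[OF i(1) that] vi nonnegD[OF nn, of j] by (cases "j = i") (auto intro: mult_nonpos_nonneg)
  ultimately have zero: "a i j * v j = 0" if "j < n" for j
    using that sum_nonneg_eq_0_iff[of "{..<n}" "\<lambda>j. - (a i j * v j)"] by simp
  obtain s t where st: "s < n" "t < n" "s = i" "t \<noteq> i" "a s t \<noteq> 0"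
    using connected_matrixE[OF conn i(1), of "\<lambda>j. j = i" k] k i by metis
  then show False using zero[of t] pos[of t] by simp
qed

end

theorem hyperbolic_mutual_embedding:
  assumes A: "hyperbolic_gcm n a D"
    and P: "root_embedding n a D n b \<beta>"
    and Q: "\<And>N. sym_gcm n b N \<Longrightarrow> root_embedding n b N n a \<gamma>"
    and u: "\<And>i. i < n \<Longrightarrow> u i \<ge> (0::real)"
      "\<And>i. i < n \<Longrightarrow> (\<Sum>j<n. real_of_int (a i j) * u j) < 0"
  obtains p where "p permutes {..<n}" "\<And>i j. i < n \<Longrightarrow> j < n \<Longrightarrow> b i j = a (p i) (p j)"
proof -
  interpret A: hyperbolic_gcm n a D by fact
  interpret P: root_embedding n a D n b \<beta> by fact
  have Q0: "root_embedding n b P.N n a \<gamma>" by (rule Q) (rule P.BF.sym_gcm_axioms)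
  interpret Q0: root_embedding n b P.N n a \<gamma> by (rule Q0)
  have n0: "0 < n" using A.two_le by simp
  \<comment> \<open>With w \<ge> 0 and strictly negative pairings, all terms of (w, w) are
    nonpositive and one is negative.\<close>
  have timelike: "sym_gcm.form n c E z z < 0"
    if c: "sym_gcm n c E" and w: "nonneg w" "z = - w" "\<And>i. i < n \<Longrightarrow> gcm_system.pr n c i w < 0" for c E z w
  proof -
    interpret C: sym_gcm n c E by (rule c)
    have "\<exists>k<n. w k \<noteq> 0"
    proof (rule ccontr)
      assume "\<not> (\<exists>k<n. w k \<noteq> 0)"
      then have "C.pr 0 w = 0" by (simp add: C.pr_def)
      then show False using w(3)[OF n0] by simp
    qed
    then obtain k where k: "k < n" "w k > 0" using w(1) by (metis nonneg_def order.order_iff_strict)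
    have "(\<Sum>i<n. - (E i * w i * C.pr i w)) > 0"
    proof (rule sum_pos2[of _ k])
      show "- (E k * w k * C.pr k w) > 0" using k w(3)[OF k(1)] C.D_pos[OF k(1)] by (simp add: mult_pos_neg)
      fix i assume "i \<in> {..<n}"
      then show "- (E i * w i * C.pr i w) \<ge> 0"
        using w(3)[of i] C.D_pos[of i] nonnegD[OF w(1), of i] by (auto intro: mult_nonneg_nonpos)
    qed (use k in auto)
    then show ?thesis by (simp add: w(2) C.form_simps) (simp add: C.form_def sum_negf)
  qed
  obtain zw where zw: "nonneg zw" "\<And>i. i < n \<Longrightarrow> A.pr i zw < 0"
    using A.integral_negative_vector[of u] u by auto
  define z where "z = - zw"
  have z: "A.pr i z > 0" if "i < n" for i using zw(2)[OF that] by (simp add: z_def A.pr_uminus)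
  have zform: "sym_gcm.form n a E z z < 0" if "sym_gcm n a E" for E
    by (rule timelike[OF that zw(1) z_def zw(2)])
  have connB: "connected_matrix n b" using Q0.connected_target A.conn by simp
  obtain ww where ww: "nonneg ww" "\<And>i. i < n \<Longrightarrow> P.B.pr i ww < 0"
  proof -
    \<comment> \<open>\<open>b\<close> is not known to be hyperbolic. Its form is negative at the
      image of \<open>z\<close>; \<open>zmatrix_not_semidefinite\<close> and
      \<open>spread_negativity\<close> turn this into a nonnegative vector with strictly negative
      pairings.\<close>
    define v where "v = lc n \<gamma> z"
    have "P.BF.form v v < 0" using zform[OF Q0.BF.sym_gcm_axioms] by (simp add: v_def Q0.form_lc)
    then have "real_of_int (P.BF.form v v) < 0" by simp
    then have "(\<Sum>i<n. \<Sum>j<n. real_of_int (P.N i * b i j) * v i * v j) < 0"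
      by (simp add: P.BF.form_eq_double_sum)
    moreover have "real_of_int (P.N i * b i j) = real_of_int (P.N j * b j i)" if "i < n" "j < n" for i j
      using P.BF.D_sym[OF that] by (metis of_int_eq_iff)
    moreover have "real_of_int (P.N i * b i j) \<le> 0" if "i < n" "j < n" "i \<noteq> j" for i j
    proof -
      have "P.N i * b i j \<le> 0"
        using P.B.offdiag[OF that] P.BF.D_pos[OF that(1)] by (simp add: mult_nonneg_nonpos)
      then show ?thesis by (simp only: of_int_le_0_iff)
    qed
    ultimately obtain r where r: "\<forall>i\<in>{..<n}. r i \<ge> 0"
      "\<forall>i\<in>{..<n}. (\<Sum>j\<in>{..<n}. real_of_int (P.N i * b i j) * r j) \<le> 0"
      "\<exists>i\<in>{..<n}. (\<Sum>j\<in>{..<n}. real_of_int (P.N i * b i j) * r j) < 0"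
      using zmatrix_not_semidefinite[of "{..<n}" "\<lambda>i j. real_of_int (P.N i * b i j)" "\<lambda>i. real_of_int (v i)"]
      by auto
    have eq: "(\<Sum>j<n. real_of_int (P.N i * b i j) * r j) = P.N i * (\<Sum>j<n. real_of_int (b i j) * r j)" for i
      by (simp add: sum_distrib_left algebra_simps)
    have "\<exists>w. nonneg w \<and> (\<forall>i<n. P.B.pr i w < 0)"
    proof (rule P.B.spread_negativity[OF connB])
      show "r i \<ge> 0" if "i < n" for i using r(1) that by blast
      show "(\<Sum>j<n. real_of_int (b i j) * r j) \<le> 0" if "i < n" for i
        using r(2) P.BF.D_pos[OF that] that unfolding eq by (auto simp: mult_le_0_iff)
      show "\<exists>i<n. (\<Sum>j<n. real_of_int (b i j) * r j) < 0"
        using r(3) P.BF.D_pos unfolding eq by (force simp: mult_less_0_iff)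
    qed
    then show ?thesis using that by blast
  qed
  define w where "w = - ww"
  have w: "P.B.pr i w > 0" if "i < n" for i using ww(2)[OF that] by (simp add: w_def P.B.pr_uminus)
  have wform: "sym_gcm.form n b E w w < 0" if "sym_gcm n b E" for E
    by (rule timelike[OF that ww(1) w_def ww(2)])
  obtain \<beta>' where P': "root_embedding n a D n b \<beta>'" and \<beta>': "\<And>j. j < n \<Longrightarrow> nonneg (\<beta>' j)"
  proof (rule P.normalize[of z w])
    show "(\<forall>x. 0 \<le> A.form x x) \<or> A.lorentzian \<and> A.form z z < 0 \<and> P.BF.form w w < 0"
      using A.lorentzian zform[OF A.sym_gcm_axioms] wform[OF P.BF.sym_gcm_axioms] by blast
  qed (use z w in auto)
  interpret P': root_embedding n a D n b \<beta>' by fact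
  have Q1: "root_embedding n b P'.N n a \<gamma>" by (rule Q) (rule P'.BF.sym_gcm_axioms)
  interpret Q: root_embedding n b P'.N n a \<gamma> by (rule Q1)
  have lorB: "P'.BF.lorentzian"
    using A.lorentzian unfolding A.lorentzian_def P'.BF.lorentzian_def P'.form_lc[symmetric] by blast
  obtain \<gamma>' where Q': "root_embedding n b P'.N n a \<gamma>'" and \<gamma>': "\<And>j. j < n \<Longrightarrow> nonneg (\<gamma>' j)"
  proof (rule Q.normalize[of w z])
    show "(\<forall>x. 0 \<le> P'.BF.form x x) \<or> P'.BF.lorentzian \<and> P'.BF.form w w < 0 \<and> Q.BF.form z z < 0"
      using lorB zform[OF Q.BF.sym_gcm_axioms] wform[OF P'.BF.sym_gcm_axioms] by blast
  qed (use z w in auto)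
  interpret Q': root_embedding n b P'.N n a \<gamma>' by fact
  have R: "root_embedding n a D n a (\<lambda>j. lc n \<beta>' (\<gamma>' j))" by (rule root_embedding_comp[OF P' Q'])
  have pos: "nonneg (lc n \<beta>' (\<gamma>' j))" if "j < n" for j
    by (intro P'.lc_nonneg \<beta>' \<gamma>' that)
  obtain d where d: "d > 0" "\<And>y. \<exists>x. supported n x \<and> (\<forall>i<n. A.pr i x = d * y i)"
    by (rule A.dual_basis[OF A.kernel_trivial]) auto
  have "\<exists>x. supported n x \<and> (\<forall>i<n. A.pr i x = - d * ev k i)" for k
    using d(2)[of "\<lambda>i. - ev k i"] by simp
  then obtain M where M: "\<And>k. supported n (M k)" "\<And>k i. i < n \<Longrightarrow> A.pr i (M k) = - d * ev k i"
    by metis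
  have Mnn: "nonneg (M k)" if "k < n" for k
    by (rule A.negative_dual_nonneg[OF M d(1) that])
  have "\<exists>j<n. M j i > 0" if "i < n" for i
  proof -
    obtain j where "j < n" "i \<noteq> j" using A.two_le by (metis Suc_1 Suc_le_lessD n0 not_less_eq zero_neq_one less_one)
    then show ?thesis using A.negative_dual_pos[OF M d(1) _ that] by blast
  qed
  then have "height n (lc n \<beta>' (\<gamma>' j)) = 1" if "j < n" for j
    by (intro self_embedding_simple[OF R pos, of M "- d"]) (use M d Mnn that in auto)
  then show ?thesis
    using mutual_embedding_permutation[OF P' Q' \<beta>' \<gamma>'] that by blast
qed

section \<open>Affine matrices\<close>

lemma lc_lc: "lc m b (lc l c x) = lc l (\<lambda>j. lc m b (c j)) x"
  unfolding lc_def sum_distrib_left sum_distrib_right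
  by (rule ext, subst sum.swap) (simp add: algebra_simps)

lemma dvd_symmetric_double_sum:
  fixes h :: "nat \<Rightarrow> nat \<Rightarrow> int"
  assumes "\<And>i j. i < n \<Longrightarrow> j < n \<Longrightarrow> h i j = h j i"
    and "\<And>i. i < n \<Longrightarrow> q dvd h i i" "\<And>i j. i < n \<Longrightarrow> j < n \<Longrightarrow> q dvd 2 * h i j"
  shows "q dvd (\<Sum>i<n. \<Sum>j<n. h i j)"
  using assms
proof (induction n)
  case (Suc n)
  have "(\<Sum>i<n. h i n) = (\<Sum>i<n. h n i)" by (intro sum.cong) (auto simp: Suc.prems(1))
  then have "(\<Sum>i<Suc n. \<Sum>j<Suc n. h i j) = (\<Sum>i<n. \<Sum>j<n. h i j) + (\<Sum>i<n. 2 * h n i) + h n n"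
    by (simp add: sum.distrib flip: sum_distrib_left)
  moreover have "q dvd (\<Sum>i<n. 2 * h n i)" by (intro dvd_sum) (simp add: Suc.prems(3))
  moreover have "q dvd (\<Sum>i<n. \<Sum>j<n. h i j)" using Suc by simp
  moreover have "q dvd h n n" using Suc.prems(2) by simp
  ultimately show ?case by (metis dvd_add)
qed simp

lemma bezout_sum:
  fixes r :: "nat \<Rightarrow> int"
  shows "\<exists>c. (\<Sum>i<n. c i * r i) = Gcd (r ` {..<n})"
proof (induction n)
  case (Suc n)
  then obtain c where c: "(\<Sum>i<n. c i * r i) = Gcd (r ` {..<n})" by blast
  obtain u v where uv: "u * r n + v * Gcd (r ` {..<n}) = gcd (r n) (Gcd (r ` {..<n}))"
    using bezout_int by blast
  define c' where "c' i = (if i = n then u else v * c i)" for i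
  have "(\<Sum>i<Suc n. c' i * r i) = (\<Sum>i<n. v * (c i * r i)) + u * r n"
    by (simp add: c'_def mult.assoc)
  also have "\<dots> = v * Gcd (r ` {..<n}) + u * r n" by (simp add: c flip: sum_distrib_left)
  also have "\<dots> = Gcd (r ` {..<Suc n})" using uv by (simp add: lessThan_Suc add.commute)
  finally show ?case by blast
qed simp

text \<open>At a vertex where \<open>p\<close> vanishes, adjacent to one where it does not, the row
  of A p = 0 would have only nonpositive terms and a negative one.\<close>

lemma (in gcm_system) nonneg_kernel_full:
  assumes "connected_matrix n a" and p: "nonneg p" "supported n p" "\<And>i. i < n \<Longrightarrow> pr i p = 0"
    and k: "k < n" "p k = 0"
  shows "p = 0"
proof (rule ccontr)
  assume "p \<noteq> 0"
  then obtain l where l: "p l \<noteq> 0" by (metis ext zero_fun_apply)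
  then have "l < n" using p(2) by (meson not_le supportedD)
  then obtain i j where ij: "i < n" "j < n" "p i = 0" "p j \<noteq> 0" "a i j \<noteq> 0"
    using connected_matrixE[OF assms(1) k(1), of "\<lambda>i. p i = 0" l] k l by blast
  have term_le: "a i t * p t \<le> 0" if "t < n" for t
    using offdiag[OF ij(1) that] ij(3) nonnegD[OF p(1), of t] by (cases "t = i") (auto intro: mult_nonpos_nonneg)
  have "(\<Sum>t<n. - (a i t * p t)) = 0" using p(3)[OF ij(1)] by (simp add: pr_def sum_negf)
  then have "a i j * p j = 0"
    using term_le ij(2) sum_nonneg_eq_0_iff[of "{..<n}" "\<lambda>t. - (a i t * p t)"] by simp
  then show False using ij by simp
qed

text \<open>As \<open>o'\<close> has mark 1, the coordinate there reads off the multiple of \<delta>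
  and serves to choose representatives modulo \<delta>.\<close>

locale affine_gcm = sym_gcm +
  fixes \<delta> :: "nat \<Rightarrow> int" and o' :: nat
  assumes conn: "connected_matrix n a"
    and delta_pos: "i < n \<Longrightarrow> \<delta> i > 0"
    and delta_supported: "supported n \<delta>"
    and pr_delta: "i < n \<Longrightarrow> pr i \<delta> = 0"
    and base: "o' < n" "\<delta> o' = 1"
begin

lemma semidefinite: "form x x \<ge> 0"
proof (rule form_nonneg_on[of "{..<n}" "\<lambda>i. real_of_int (\<delta> i)"])
  fix i assume "i \<in> {..<n}"
  then have "real_of_int (pr i \<delta>) = 0" using pr_delta by simp
  then show "(\<Sum>j<n. real_of_int (a i j) * real_of_int (\<delta> j)) \<ge> 0" by (simp add: pr_def)
qed (auto simp: delta_pos)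

lemma form_delta [simp]: "form x \<delta> = 0" "form \<delta> x = 0"
proof -
  show "form x \<delta> = 0" by (simp add: form_def pr_delta)
  then show "form \<delta> x = 0" by (subst form_commute)
qed

definition imag :: "int \<Rightarrow> nat \<Rightarrow> int" where
  "imag c = (\<lambda>k. c * \<delta> k)"

lemma form_imag [simp]: "form x (imag c) = 0" "form (imag c) x = 0"
  by (simp_all add: imag_def form_simps)

lemma imag_supported: "supported n (imag c)"
  by (simp add: imag_def supported_scale delta_supported)

lemma imag_base [simp]: "imag c o' = c"
  by (simp add: imag_def base)

lemma imag_0 [simp]: "imag 0 = 0"
  by (auto simp: imag_def)

lemma imag_uminus: "imag (- c) = - imag c"
  by (auto simp: imag_def)

text \<open>Subtracting a multiple of \<delta> makes the coordinate at \<open>o'\<close> vanish. The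
  positive and the negative part of the rest are nonnegative kernel vectors that vanish at
  \<open>o'\<close>, hence 0.\<close>

lemma isotropic_imag:
  assumes x: "supported n x" "form x x = 0"
  shows "x = imag (x o')"
proof -
  define y where "y = x - imag (x o')"
  have y: "supported n y" "y o' = 0"
    using x imag_supported by (auto simp: y_def supported_diff)
  have pr_x: "pr i x = 0" if "i < n" for i
    by (rule isotropic_pr_eq_0[OF semidefinite x(2) that])
  then have pr_y: "pr i y = 0" if "i < n" for i
    using that pr_delta by (simp add: y_def imag_def pr_diff pr_scale)
  have key: "pos_part v = 0" if v: "supported n v" "v o' = 0" "\<And>i. i < n \<Longrightarrow> pr i v = 0" for v
  proof (rule nonneg_kernel_full[OF conn])
    have "form (pos_part v) v = 0" using v(3) by (simp add: form_def)
    then have "form (pos_part v) (pos_part v) \<le> 0"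
      using form_disjoint_nonpos[of "pos_part v" "pos_part (- v)"] pos_part_disjoint[of v]
      by (simp add: form_pos_part)
    then have "form (pos_part v) (pos_part v) = 0" using semidefinite[of "pos_part v"] by linarith
    then show "pr i (pos_part v) = 0" if "i < n" for i
      using isotropic_pr_eq_0[OF semidefinite _ that] by blast
    show "pos_part v o' = 0" using v(2) by (simp add: pos_part_def)
  qed (use v(1) base in \<open>simp_all add: supported_pos_part\<close>)
  have "pos_part y = 0" "pos_part (- y) = 0"
    using key[of y] key[of "- y"] y pr_y by (simp_all add: pr_uminus)
  then have "y = 0" using pos_part_decomp[of y] by simp
  then show ?thesis by (simp add: y_def)
qed

lemma proper_definite:
  assumes "supported n x" "x \<noteq> 0" "k < n" "x k = 0"
  shows "form x x > 0"
proof (rule ccontr)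
  assume "\<not> form x x > 0"
  then have x: "x = imag (x o')" using isotropic_imag assms(1) semidefinite[of x] by simp
  then have "x o' * \<delta> k = 0" using assms(4) by (metis imag_def)
  then have "x o' = 0" using delta_pos[OF assms(3)] by simp
  then show False using x assms(2) by simp
qed

text \<open>If one of the two Cartan integers is 1, then x - y is up to sign a reflected root. If
  both are at least 2, the norm of x - y is \<le> 0, so x - y is a multiple of \<delta>.\<close>

lemma rts_diff:
  assumes x: "x \<in> rts" and y: "y \<in> rts" and pos: "form x y > 0"
  shows "x - y \<in> rts \<or> (\<exists>c. x - y = imag c)"
proof -
  define p q where "p = cpr y x" and "q = cpr x y"
  have p: "form y y * p = 2 * form x y" and q: "form x x * q = 2 * form x y"
    using cpr_eq[OF y, of x] cpr_eq[OF x, of y] by (simp_all add: p_def q_def form_commute[of y x])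
  have "form y y * p > 0" "form x x * q > 0" using p q pos by simp_all
  then have pq: "p > 0" "q > 0"
    using rts_norm_pos[OF x] rts_norm_pos[OF y] zero_less_mult_pos by blast+
  consider "p = 1" | "q = 1" | "p \<ge> 2" "q \<ge> 2" using pq by linarith
  then show ?thesis
  proof cases
    case 1
    then have "x - y \<in> rts" using rts_reflection[OF y x] by (simp add: p_def)
    then show ?thesis ..
  next
    case 2
    then have "- (y - x) \<in> rts" using rts_uminus[OF rts_reflection[OF x y]] by (simp add: q_def)
    then show ?thesis by simp
  next
    case 3
    have "form y y * 2 \<le> form y y * p" "form x x * 2 \<le> form x x * q"
      using 3 rts_norm_pos[OF x] rts_norm_pos[OF y] by (auto intro: mult_left_mono)
    then have "form (x - y) (x - y) \<le> 0"
      using p q by (simp add: form_simps form_commute[of y x])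
    then have "form (x - y) (x - y) = 0" using semidefinite[of "x - y"] by linarith
    then show ?thesis using isotropic_imag[of "x - y"] rts_supported x y supported_diff by blast
  qed
qed

text \<open>If both parts of x = p - r are nonzero, each misses a vertex and has positive norm.
  Integrality makes (x, x) a divisor of both norms, but (x, x) \<ge> (p, p) + (r, r).\<close>

lemma coroot_integral_sign:
  assumes x: "supported n x" "coroot_integral x" "form x x > 0"
  shows "nonneg x \<or> nonneg (- x)"
proof (rule ccontr)
  assume mixed: "\<not> (nonneg x \<or> nonneg (- x))"
  define p r where "p = pos_part x" and "r = pos_part (- x)"
  have pr: "nonneg p" "supported n p" "nonneg r" "supported n r" "\<And>k. p k = 0 \<or> r k = 0"
    using x(1) pos_part_disjoint by (auto simp: p_def r_def supported_pos_part)
  have "r \<noteq> 0" using mixed pos_part_uminus_eq_0_iff[of x] by (simp add: r_def)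
  have "p \<noteq> 0" using mixed pos_part_uminus_eq_0_iff[of "- x"] by (simp add: p_def)
  obtain i where i: "p i \<noteq> 0" using \<open>p \<noteq> 0\<close> by (metis ext zero_fun_apply)
  obtain j where j: "r j \<noteq> 0" using \<open>r \<noteq> 0\<close> by (metis ext zero_fun_apply)
  have "i < n" "j < n" using i j pr(2,4) by (meson not_le supportedD)+
  then have pos: "form p p > 0" "form r r > 0"
    using proper_definite[of p j] proper_definite[of r i] pr i j \<open>p \<noteq> 0\<close> \<open>r \<noteq> 0\<close> by auto
  have dvd: "form x x dvd form v v" if v: "\<And>j. v j = 0 \<or> v j = x j \<or> v j = - x j" for v
    unfolding form_eq_double_sum[of v]
  proof (rule dvd_symmetric_double_sum)
    have D: "form x x dvd 2 * (D i * v i)" if "i < n" for i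
      using x(2) v[of i] that by (auto simp: coroot_integral_def mult.assoc)
    fix i j assume ij: "i < n" "j < n"
    show "D i * a i j * v i * v j = D j * a j i * v j * v i" using D_sym[OF ij] by simp
    have "D i * a i i * v i * v i = 2 * (D i * v i) * v i" using ij by (simp add: diag)
    then show "form x x dvd D i * a i i * v i * v i" using D[OF ij(1)] by (metis dvd_mult2)
    have "2 * (D i * a i j * v i * v j) = 2 * (D i * v i) * (a i j * v j)" by simp
    then show "form x x dvd 2 * (D i * a i j * v i * v j)" using D[OF ij(1)] by (metis dvd_mult2)
  qed
  have "form x x dvd form p p" "form x x dvd form r r"
    by (rule dvd, auto simp: p_def r_def pos_part_def)+
  then have "form x x \<le> form p p" "form x x \<le> form r r" using pos by (auto intro: zdvd_imp_le)
  moreover have "form x x = form p p - 2 * form p r + form r r"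
  proof -
    have "x = p - r" using pos_part_decomp[of x] by (simp add: p_def r_def)
    then show ?thesis by (simp add: form_simps form_commute[of r p])
  qed
  moreover have "form p r \<le> 0" using form_disjoint_nonpos[OF pr(1,3,5)] .
  ultimately show False using x(3) by linarith
qed

text \<open>Proposition 5.10 b) of Kac's book for affine matrices.\<close>

lemma coroot_integral_imp_rts:
  assumes "supported n x" "coroot_integral x" "form x x > 0"
  shows "x \<in> rts"
proof -
  have pos: "x \<in> rts" if "nonneg x" "supported n x" "coroot_integral x" "form x x > 0" for x
    using that
  proof (induction "nat (height n x)" arbitrary: x rule: less_induct)
    case less
    \<comment> \<open>A positive norm has a positive term, and reflecting in this \<open>j\<close>
      lowers the height. The result has a sign by \<open>coroot_integral_sign\<close>; if it is
      negative, \<open>x\<close> was a multiple of \<alpha>_j.\<close>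
    have "\<exists>j<n. D j * x j * pr j x > 0"
    proof (rule ccontr)
      assume "\<not> ?thesis"
      then have "form x x \<le> 0" unfolding form_def by (intro sum_nonpos) (metis lessThan_iff not_less)
      then show False using less.prems(4) by simp
    qed
    then obtain j where j: "j < n" "D j * x j * pr j x > 0" by blast
    have "D j * x j \<ge> 0" using D_pos[OF j(1)] nonnegD[OF less.prems(1), of j] by simp
    then have "D j * x j > 0" "pr j x > 0" using j(2) by (auto simp: zero_less_mult_iff)
    define y where "y = refl j x"
    have y: "supported n y" "coroot_integral y" "form y y > 0"
      using less.prems j(1) by (simp_all add: y_def supported_refl coroot_integral_refl form_refl)
    have xy: "x = refl j y" using j(1) by (simp add: y_def)
    from coroot_integral_sign[OF y] show ?case
    proof
      assume nn: "nonneg y"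
      have "y \<noteq> 0" using y(3) by auto
      then have "height n y > 0" using height_pos nn y(1) by blast
      moreover have "height n y < height n x"
        using j(1) \<open>pr j x > 0\<close> by (simp add: y_def height_refl)
      ultimately have "y \<in> rts" using less.hyps[of y] nn y by simp
      then show ?thesis using xy j(1) rts_refl by metis
    next
      assume neg: "nonneg (- y)"
      have "x k = 0" if "k \<noteq> j" for k
        using nonnegD[OF neg, of k] nonnegD[OF less.prems(1), of k] that by (simp add: y_def refl_def)
      then have x: "x = (\<lambda>k. x j * ev j k)" by (auto simp: ev_def)
      have "form x x = 2 * D j * (x j * x j)"
        by (subst (1 2) x) (use j(1) in \<open>simp add: form_simps diag\<close>)
      moreover have "form x x dvd 2 * D j * x j"
        using less.prems(3) j(1) by (simp add: coroot_integral_def)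
      ultimately have "(2 * D j * x j) * x j dvd (2 * D j * x j) * 1" by (simp add: mult.assoc)
      moreover have "2 * D j * x j \<noteq> 0" using \<open>D j * x j > 0\<close> by auto
      ultimately have "x j dvd 1" by (subst (asm) dvd_mult_cancel_left) auto
      then have "x j = 1" using nonnegD[OF less.prems(1), of j] by auto
      then show ?thesis using x rts_simple[OF j(1)] by simp
    qed
  qed
  show ?thesis
  proof (cases "nonneg x")
    case False
    then have "nonneg (- x)" using coroot_integral_sign assms by blast
    then have "- x \<in> rts"
      using pos[of "- x"] assms by (simp add: form_simps coroot_integral_def)
    then show ?thesis using rts_uminus[of "- x"] by simp
  qed (use pos assms in blast)
qed

text \<open>Norms of real roots are bounded, and the sum of squares turns this into a bound on x_i /
  \<delta>_i - x_j / \<delta>_j along edges. Connectedness carries boundedness over from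
  \<open>o'\<close>, where \<open>x\<close> is 0.\<close>

lemma finite_base_roots: "finite {x \<in> rts. x o' = 0}"
proof -
  \<comment> \<open>Bounds 4 D_k, twice the norm of a real root; the summand 1 ensures C \<le>
    C^2.\<close>
  define C where "C = 1 + 4 * (\<Sum>i<n. real_of_int (D i))"
  have "(\<Sum>i<n. real_of_int (D i)) \<ge> 0" using D_pos by (intro sum_nonneg) (auto simp: less_imp_le)
  then have C: "C \<ge> 1" by (simp add: C_def)
  have edge: "\<bar>x i / \<delta> i - x j / \<delta> j\<bar> \<le> C" if x: "x \<in> rts" and ij: "i < n" "j < n" "a i j \<noteq> 0" for x i j
  proof (cases "i = j")
    case False
    define G where "G k l = real_of_int (D k * a k l)" for k l
    define T where "T k l = - (G k l * \<delta> k * \<delta> l * (x k / \<delta> k - x l / \<delta> l)\<^sup>2)" for k l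
    have Gd: "(\<Sum>l<n. G k l * \<delta> l) = 0" if "k < n" for k
    proof -
      have "(\<Sum>l<n. G k l * \<delta> l) = D k * real_of_int (pr k \<delta>)"
        by (simp add: G_def pr_def sum_distrib_left mult.assoc)
      then show ?thesis by (simp add: pr_delta[OF that])
    qed
    have "real_of_int (form x x) = (\<Sum>k<n. \<Sum>l<n. G k l * x k * x l)"
      by (simp add: form_eq_double_sum G_def)
    also have "\<dots> = (\<Sum>k<n. (real_of_int (x k))\<^sup>2 / \<delta> k * (\<Sum>l<n. G k l * \<delta> l))
      - (\<Sum>k<n. \<Sum>l<n. G k l * \<delta> k * \<delta> l * (x k / \<delta> k - x l / \<delta> l)\<^sup>2) / 2"
    proof (rule quadratic_form_sum_of_squares)
      show "G k l = G l k" if "k \<in> {..<n}" "l \<in> {..<n}" for k l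
        using that unfolding G_def by (metis D_sym lessThan_iff)
    qed (auto simp: delta_pos)
    also have "(\<Sum>k<n. (real_of_int (x k))\<^sup>2 / \<delta> k * (\<Sum>l<n. G k l * \<delta> l)) = 0"
      by (intro sum.neutral ballI) (simp add: Gd)
    finally have sos: "2 * real_of_int (form x x) = (\<Sum>k<n. \<Sum>l<n. T k l)"
      by (simp add: T_def sum_negf)
    have T0: "T k l \<ge> 0" if "k < n" "l < n" for k l
    proof (cases "k = l")
      case False
      have "D k * a k l \<le> 0" using offdiag[OF that False] D_pos[OF that(1)] by (simp add: mult_nonneg_nonpos)
      then have "G k l \<le> 0" unfolding G_def by (simp only: of_int_le_0_iff)
      then have "G k l * \<delta> k * \<delta> l * (x k / \<delta> k - x l / \<delta> l)\<^sup>2 \<le> 0"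
        using delta_pos[OF that(1)] delta_pos[OF that(2)]
        by (intro mult_nonpos_nonneg) auto
      then show ?thesis by (simp add: T_def)
    qed (simp add: T_def)
    have "T i j \<le> (\<Sum>l<n. T i l)" using T0 ij by (intro member_le_sum) auto
    also have "\<dots> \<le> (\<Sum>k<n. \<Sum>l<n. T k l)"
      using T0 ij by (intro member_le_sum[of i _ "\<lambda>k. \<Sum>l<n. T k l"] sum_nonneg) auto
    also have "\<dots> \<le> C"
    proof -
      obtain k where k: "k < n" "form x x = 2 * D k" using rts_norm[OF x] by blast
      have "real_of_int (D k) \<le> (\<Sum>i<n. real_of_int (D i))"
        using k(1) D_pos by (intro member_le_sum) (auto simp: less_imp_le)
      then show ?thesis using k(2) by (simp add: C_def flip: sos)
    qed
    finally have "T i j \<le> C" .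
    moreover have "(x i / \<delta> i - x j / \<delta> j)\<^sup>2 \<le> T i j"
    proof -
      have "D i * a i j < 0"
        using offdiag[OF ij(1,2) False] ij(3) D_pos[OF ij(1)] by (simp add: mult_pos_neg)
      then have "1 \<le> - (D i * a i j)" by linarith
      moreover have "1 \<le> \<delta> i * \<delta> j" using delta_pos[OF ij(1)] delta_pos[OF ij(2)]
        by (metis int_one_le_iff_zero_less mult_pos_pos)
      ultimately have "1 \<le> - (D i * a i j) * (\<delta> i * \<delta> j)"
        using mult_mono[of 1 "- (D i * a i j)" 1 "\<delta> i * \<delta> j"] by simp
      then have "real_of_int 1 \<le> real_of_int (- (D i * a i j) * (\<delta> i * \<delta> j))" by (simp only: of_int_le_iff)
      then have "1 * (x i / \<delta> i - x j / \<delta> j)\<^sup>2 \<le> - (G i j * \<delta> i * \<delta> j) * (x i / \<delta> i - x j / \<delta> j)\<^sup>2"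
        by (intro mult_right_mono) (simp_all add: G_def)
      then show ?thesis by (simp add: T_def)
    qed
    moreover have "C * 1 \<le> C * C" using C by (intro mult_left_mono) auto
    ultimately have "(x i / \<delta> i - x j / \<delta> j)\<^sup>2 \<le> C\<^sup>2" unfolding power2_eq_square by linarith
    then show ?thesis using C by (simp add: abs_le_square_iff[symmetric])
  qed (use C in simp)
  define bd where "bd i \<longleftrightarrow> (\<exists>K. \<forall>x\<in>rts. x o' = 0 \<longrightarrow> \<bar>x i\<bar> \<le> K)" for i
  have "bd i" if "i < n" for i
  proof (rule ccontr)
    assume "\<not> bd i"
    moreover have "bd o'" by (auto simp: bd_def)
    ultimately obtain k l where kl: "k < n" "l < n" "bd k" "\<not> bd l" "a k l \<noteq> 0"
      using connected_matrixE[OF conn base(1) _ \<open>i < n\<close>] by metis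
    obtain K where K: "\<And>x. x \<in> rts \<Longrightarrow> x o' = 0 \<Longrightarrow> \<bar>x k\<bar> \<le> K" using kl(3) by (auto simp: bd_def)
    have "\<bar>x l\<bar> \<le> \<lceil>\<delta> l * (real_of_int K + C)\<rceil>" if x: "x \<in> rts" "x o' = 0" for x
    proof -
      have dk: "real_of_int (\<delta> k) \<ge> 1" using delta_pos[OF kl(1)] by linarith
      have dl: "real_of_int (\<delta> l) > 0" using delta_pos[OF kl(2)] by simp
      have "\<bar>real_of_int (x k) / \<delta> k\<bar> \<le> \<bar>real_of_int (x k)\<bar>"
        using dk by (simp add: abs_divide divide_le_eq mult_le_cancel_left1)
      also have "\<dots> \<le> K" using K[OF x] by linarith
      finally have "\<bar>real_of_int (x l) / \<delta> l\<bar> \<le> K + C" using edge[OF x(1) kl(1,2,5)] by linarith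
      then have "\<bar>real_of_int (x l)\<bar> \<le> \<delta> l * (K + C)" using dl by (simp add: abs_divide field_simps)
      then show ?thesis by linarith
    qed
    then show False using kl(4) unfolding bd_def by blast
  qed
  then have "\<forall>i. \<exists>K. i < n \<longrightarrow> (\<forall>x\<in>rts. x o' = 0 \<longrightarrow> \<bar>x i\<bar> \<le> K)" by (auto simp: bd_def)
  then obtain K where K: "\<And>i x. i < n \<Longrightarrow> x \<in> rts \<Longrightarrow> x o' = 0 \<Longrightarrow> \<bar>x i\<bar> \<le> K i" by metis
  define L where "L = (\<Sum>i<n. \<bar>K i\<bar>)"
  have "\<bar>x i\<bar> \<le> L" if "i < n" "x \<in> rts" "x o' = 0" for i x
  proof -
    have "\<bar>x i\<bar> \<le> \<bar>K i\<bar>" using K[OF that] by linarith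
    also have "\<dots> \<le> L" unfolding L_def using that(1) by (intro member_le_sum) auto
    finally show ?thesis .
  qed
  then have "{x \<in> rts. x o' = 0} \<subseteq> {f. \<forall>x. (x \<in> {..<n} \<longrightarrow> f x \<in> {- L..L}) \<and> (x \<notin> {..<n} \<longrightarrow> f x = 0)}"
    using rts_supported by (force simp: supported_def abs_le_iff)
  then show ?thesis using finite_set_of_finite_funs[of "{..<n}" "{- L..L}" 0] finite_subset by auto
qed

end

section \<open>Linear functionals and their dominant conjugates\<close>

context sym_gcm
begin

definition val :: "(nat \<Rightarrow> int) \<Rightarrow> (nat \<Rightarrow> int) \<Rightarrow> int" where
  "val y x = (\<Sum>k<n. y k * x k)"

lemma val_add: "val y (u + v) = val y u + val y v"
  by (simp add: val_def algebra_simps sum.distrib)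

lemma val_uminus: "val y (- u) = - val y u"
  by (simp add: val_def sum_negf)

lemma val_scale: "val y (\<lambda>k. c * u k) = c * val y u"
  by (simp add: val_def sum_distrib_left algebra_simps)

lemma val_lc: "val y (lc m b x) = (\<Sum>j<m. x j * val y (b j))"
  unfolding val_def lc_def sum_distrib_left sum_distrib_right
  by (subst sum.swap) (simp add: algebra_simps)

lemma val_refl:
  assumes "i < n"
  shows "val y (refl i x) = val (\<lambda>k. y k - y i * a i k) x"
proof -
  have "val y (refl i x) = val y x - y i * pr i x"
  proof -
    have "val y (\<lambda>k. pr i x * ev i k) = pr i x * y i"
      using assms by (simp add: val_scale) (simp add: val_def)
    then show ?thesis using val_add[of y "refl i x" "\<lambda>k. pr i x * ev i k"] by (simp add: refl_eq)
  qed
  then show ?thesis by (simp add: val_def pr_def algebra_simps sum_subtractf sum_distrib_left)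
qed

text \<open>A functional that is negative on finitely many positive roots is conjugate to a dominant one:
  reflecting in a simple root on which it is negative removes exactly that root from this set.\<close>

lemma dominant_functional:
  assumes "finite {x \<in> rts. nonneg x \<and> val y x < 0}"
  shows "\<exists>ws. set ws \<subseteq> {..<n} \<and> (\<forall>i<n. val y (act ws (ev i)) \<ge> 0)"
  using assms
proof (induction "card {x \<in> rts. nonneg x \<and> val y x < 0}" arbitrary: y rule: less_induct)
  case less
  define Neg where "Neg y = {x \<in> rts. nonneg x \<and> val y x < 0}" for y
  have val_ev: "val y (ev i) = y i" if "i < n" for y i using that by (simp add: val_def)
  show ?case
  proof (cases "\<forall>i<n. y i \<ge> 0")
    case True
    then show ?thesis by (intro exI[of _ "[]"]) (simp add: val_ev)
  next
    case False
    then obtain i where i: "i < n" "y i < 0" by (auto simp: not_le)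
    define y' where "y' = (\<lambda>k. y k - y i * a i k)"
    have val': "val y' x = val y (refl i x)" for x using i(1) by (simp add: val_refl y'_def)
    have "refl i ` Neg y' \<subseteq> Neg y - {ev i}"
    proof (rule image_subsetI)
      fix x assume x: "x \<in> Neg y'"
      have "x \<noteq> ev i"
      proof
        assume "x = ev i"
        then have "val y' x = - y i" using i(1) by (simp add: val' refl_ev val_uminus val_ev)
        then show False using x i(2) by (simp add: Neg_def)
      qed
      moreover have "refl i x \<noteq> ev i"
      proof
        assume "refl i x = ev i"
        then have "x = - ev i" using refl_refl[OF i(1), of x] refl_ev[OF i(1)] by simp
        then show False using x nonnegD[of x i] by (simp add: Neg_def)
      qed
      ultimately show "refl i x \<in> Neg y - {ev i}"
        using x i(1) rts_refl_nonneg[of x i] by (auto simp: Neg_def val' intro: rts_refl)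
    qed
    moreover have inj: "inj_on (refl i) (Neg y')" using i(1) by (metis inj_onI refl_refl)
    moreover have fin: "finite (Neg y)" using less.prems by (simp add: Neg_def)
    moreover have "ev i \<in> Neg y" using i by (auto simp: Neg_def val_ev intro: rts_simple)
    ultimately have "card (Neg y') \<le> card (Neg y - {ev i})" "finite (Neg y')"
      by (metis card_inj_on_le finite_Diff, metis finite_Diff finite_imageD finite_subset)
    moreover have "card (Neg y - {ev i}) < card (Neg y)"
      using \<open>ev i \<in> Neg y\<close> fin by (metis card_Diff1_less)
    ultimately obtain ws where ws: "set ws \<subseteq> {..<n}" "\<forall>k<n. val y' (act ws (ev k)) \<ge> 0"
      using less.hyps[of y'] by (auto simp: Neg_def)
    then show ?thesis using i(1) by (intro exI[of _ "i # ws"]) (simp add: val')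
  qed
qed

end

text \<open>As the norm of a real root \<open>x\<close> is some 2 D_i, this divisibility carries
  coroot integrality from \<open>x\<close> to x + c \<delta>. The real roots are then invariant
  under shifts by \<delta>.\<close>

locale untwisted_gcm = affine_gcm +
  assumes marks_dvd: "i < n \<Longrightarrow> j < n \<Longrightarrow> D i dvd D j * \<delta> j"
begin

lemma rts_shift:
  assumes "x \<in> rts"
  shows "x + imag c \<in> rts"
proof (rule coroot_integral_imp_rts)
  have form: "form (x + imag c) (x + imag c) = form x x" by (simp add: form_simps)
  then show "form (x + imag c) (x + imag c) > 0" using rts_norm_pos[OF assms] by simp
  show "supported n (x + imag c)" using rts_supported[OF assms] imag_supported by (rule supported_add)
  obtain i where i: "i < n" "form x x = 2 * D i" using rts_norm[OF assms] by blast
  show "coroot_integral (x + imag c)" unfolding coroot_integral_def form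
  proof (intro allI impI)
    fix j assume j: "j < n"
    have "form x x dvd 2 * D j * x j"
      using rts_coroot_integral[OF assms] j by (simp add: coroot_integral_def)
    moreover have "2 * D i dvd 2 * (D j * \<delta> j)" using marks_dvd[OF i(1) j] by (rule mult_dvd_mono[OF dvd_refl])
    then have "form x x dvd c * (2 * (D j * \<delta> j))" unfolding i(2) by (rule dvd_mult)
    ultimately have "form x x dvd 2 * D j * x j + c * (2 * (D j * \<delta> j))" by (rule dvd_add)
    then show "form x x dvd 2 * D j * (x + imag c) j" by (simp add: imag_def algebra_simps)
  qed
qed

text \<open>A positive root is g + k \<delta> with \<open>g\<close> from a finite set and k \<ge> 0,
  and the value of the functional grows with \<open>k\<close>.\<close>

lemma finite_negative_roots:
  assumes "val y \<delta> > 0"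
  shows "finite {x \<in> rts. nonneg x \<and> val y x < 0}"
proof (rule finite_subset)
  let ?B = "{x \<in> rts. x o' = 0}"
  show "finite (\<Union>g\<in>?B. (\<lambda>k. g + imag k) ` {0..\<bar>val y g\<bar>})"
    using finite_base_roots by blast
  show "{x \<in> rts. nonneg x \<and> val y x < 0} \<subseteq> (\<Union>g\<in>?B. (\<lambda>k. g + imag k) ` {0..\<bar>val y g\<bar>})"
  proof
    fix x assume "x \<in> {x \<in> rts. nonneg x \<and> val y x < 0}"
    then have x: "x \<in> rts" "nonneg x" "val y x < 0" by auto
    define k g where "k = x o'" and "g = x + imag (- k)"
    have g: "g \<in> ?B" using rts_shift[OF x(1)] by (simp add: g_def k_def)
    have xg: "x = g + imag k" by (simp add: g_def imag_uminus)
    have "k \<ge> 0" using nonnegD[OF x(2)] by (simp add: k_def)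
    have "val y x = val y g + k * val y \<delta>" by (subst xg) (simp add: val_add imag_def val_scale)
    moreover have "k * 1 \<le> k * val y \<delta>" using \<open>k \<ge> 0\<close> assms by (intro mult_left_mono) auto
    ultimately have "k \<le> \<bar>val y g\<bar>" using x(3) by linarith
    then show "x \<in> (\<Union>g\<in>?B. (\<lambda>k. g + imag k) ` {0..\<bar>val y g\<bar>})"
      using g xg \<open>k \<ge> 0\<close> by (intro UN_I[OF g] image_eqI[of _ _ k]) auto
  qed
qed

end

text \<open>The situation reached after shifting by multiples of \<delta>: the \<beta>_j form a
  basis of the root lattice, in which \<delta> has the positive coordinates
  \<open>m\<close>.\<close>

locale unimodular_pi_system = untwisted_gcm n a D \<delta> o' + root_embedding n a D n b \<beta>
  for n a D \<delta> o' b \<beta> +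
  fixes m :: "nat \<Rightarrow> int"
  assumes nonroot: "i < n \<Longrightarrow> j < n \<Longrightarrow> i \<noteq> j \<Longrightarrow> \<beta> i - \<beta> j \<notin> rts"
    and surj: "supported n x \<Longrightarrow> \<exists>\<xi>. supported n \<xi> \<and> x = lc n \<beta> \<xi>"
    and m_pos: "i < n \<Longrightarrow> m i > 0" and m_supported: "supported n m"
    and lc_m: "lc n \<beta> m = \<delta>"
begin

lemma lc_inject: "supported n x \<Longrightarrow> supported n y \<Longrightarrow> lc n \<beta> x = lc n \<beta> y \<Longrightarrow> x = y"
  using beta_indep[of "x - y"] by (simp add: supported_diff lc_diff)

lemma lc_eq_imag:
  assumes "supported n x" "lc n \<beta> x = imag c"
  shows "x = (\<lambda>k. c * m k)"
proof (rule lc_inject)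
  show "lc n \<beta> x = lc n \<beta> (\<lambda>k. c * m k)" using assms(2) by (simp add: lc_scale lc_m imag_def)
qed (use assms m_supported in \<open>auto intro: supported_scale\<close>)

lemma positive_pairing:
  assumes "form (lc n \<beta> x) (lc n \<beta> x) > 0"
  obtains j where "j < n" "x j * form (lc n \<beta> x) (\<beta> j) > 0"
proof -
  have "\<exists>j<n. x j * form (lc n \<beta> x) (\<beta> j) > 0"
  proof (rule ccontr)
    assume "\<not> ?thesis"
    then have "(\<Sum>j<n. x j * form (\<beta> j) (lc n \<beta> x)) \<le> 0"
      by (intro sum_nonpos) (metis form_commute lessThan_iff not_less)
    then show False using assms form_lc_left[of n \<beta> x "lc n \<beta> x"] by simp
  qed
  then show ?thesis using that by blast
qed

abbreviation mixed :: "(nat \<Rightarrow> int) \<Rightarrow> bool" where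
  "mixed x \<equiv> \<not> nonneg x \<and> \<not> nonneg (- x)"

lemma mixed_not_imag:
  assumes "supported n x" "i < n" "x i > 0" "j < n" "x j \<le> 0"
  shows "lc n \<beta> x \<noteq> imag c"
proof
  assume "lc n \<beta> x = imag c"
  then have x: "x = (\<lambda>k. c * m k)" by (rule lc_eq_imag[OF assms(1)])
  then have "c * m i > 0" "c * m j \<le> 0" using assms by metis+
  then show False using m_pos[OF assms(2)] m_pos[OF assms(4)]
    by (simp add: zero_less_mult_iff mult_le_0_iff)
qed

text \<open>A positive product would make u - v a root or a multiple of \<delta>, by
  \<open>rts_diff\<close>; the coordinates of \<open>x\<close> rule out the latter.\<close>

lemma orthogonality:
  assumes "supported n x" "i < n" "x i > 0" "j < n" "x j \<le> 0"
    and "x = u - v" "lc n \<beta> u \<in> rts" "lc n \<beta> v \<in> rts" "lc n \<beta> x \<notin> rts"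
  shows "form (lc n \<beta> u) (lc n \<beta> v) \<le> 0"
proof (rule ccontr)
  assume "\<not> ?thesis"
  then have "form (lc n \<beta> u) (lc n \<beta> v) > 0" by simp
  then have "lc n \<beta> x \<in> rts \<or> (\<exists>c. lc n \<beta> x = imag c)"
    using rts_diff[OF assms(7,8)] by (simp add: assms(6) lc_diff)
  then show False using mixed_not_imag[OF assms(1-5)] assms(9) by blast
qed

text \<open>Induction on the sum of the absolute values of the coefficients. A minimal root with
  coefficients of both signs has the form \<open>\<beta>\<^sub>j - \<nu>\<close> with a root \<open>\<nu> = \<beta>\<^sub>k + \<nu>'\<close>, and then neither
  \<open>\<beta>\<^sub>j - \<beta>\<^sub>k\<close> nor \<open>\<beta>\<^sub>j - \<nu>'\<close> is a root. This contradicts the fact that if three roots have a root as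
  their sum, then two of their pairwise sums are roots or imaginary.\<close>

lemma roots_not_mixed:
  assumes "supported n \<xi>" "lc n \<beta> \<xi> \<in> rts"
  shows "nonneg \<xi> \<or> nonneg (- \<xi>)"
  using assms
proof (induction "nat (\<Sum>j<n. \<bar>\<xi> j\<bar>)" arbitrary: \<xi> rule: less_induct)
  case less
  define size where "size x = (\<Sum>j<n. \<bar>x j\<bar>)" for x :: "nat \<Rightarrow> int"
  have size_step: "size (x - ev j) = size x - 1" if "j < n" "x j > 0" for x j
  proof -
    have "\<bar>(x - ev j) i\<bar> = \<bar>x i\<bar> - ev j i" for i using that(2) by (cases "i = j") auto
    then show ?thesis using that(1) sum_mult_ev[of j n "\<lambda>_. 1"] by (simp add: size_def sum_subtractf)
  qed
  have size_uminus: "size (- x) = size x" for x by (simp add: size_def)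
  have size_nonneg: "size x \<ge> 0" for x by (auto simp: size_def intro: sum_nonneg)
  have IH: "nonneg x \<or> nonneg (- x)" if "size x < size \<xi>" "supported n x" "lc n \<beta> x \<in> rts" for x
  proof -
    have "nat (size x) < nat (size \<xi>)" using that(1) size_nonneg[of x] by linarith
    then show ?thesis using less.hyps[of x] that(2,3) by (simp add: size_def)
  qed
  have core: False
    if z: "supported n z" "lc n \<beta> z \<in> rts" "mixed z" "size z = size \<xi>"
      and j: "j < n" "z j > 0" "form (lc n \<beta> z) (\<beta> j) > 0" for z j
  proof -
    obtain k' where k': "z k' < 0" using z(3) by (auto simp: nonneg_def not_le)
    have k'n: "k' < n" using k' z(1) by (metis less_irrefl not_le supportedD)
    define \<nu> where "\<nu> = ev j - z"
    have \<nu>: "supported n \<nu>" using z(1) j(1) by (simp add: \<nu>_def supported_diff)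
    have size_\<nu>: "size \<nu> = size \<xi> - 1"
    proof -
      have "\<nu> = - (z - ev j)" by (simp add: \<nu>_def)
      then show ?thesis using size_step[of j z] j(1,2) z(4) by (metis size_uminus)
    qed
    have lc_neg: "lc n \<beta> (z - ev j) = - lc n \<beta> \<nu>" by (simp add: \<nu>_def lc_diff)
    from rts_diff[OF z(2) beta_rts[OF j(1)] j(3)] have \<nu>_rts: "lc n \<beta> \<nu> \<in> rts"
    proof
      assume "lc n \<beta> z - \<beta> j \<in> rts"
      then have "- lc n \<beta> \<nu> \<in> rts" using j(1) lc_neg by (simp add: lc_diff)
      then show ?thesis using rts_uminus by force
    next
      assume "\<exists>c. lc n \<beta> z - \<beta> j = imag c"
      then obtain c where "lc n \<beta> (z - ev j) = imag c" using j(1) by (auto simp: lc_diff)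
      \<comment> \<open>If z - \<beta>_j were c \<delta>, the negative coordinate at k' would give c
        \<le> -1 and hence z_j = 1 + c m_j \<le> 0.\<close>
      then have "z - ev j = (\<lambda>k. c * m k)" using z(1) j(1) by (intro lc_eq_imag supported_diff) auto
      then have zc: "z k = ev j k + c * m k" for k by (metis add_diff_cancel_left' diff_add_cancel minus_apply add.commute)
      have "k' \<noteq> j" using k' j(2) by auto
      then have "c * m k' < 0" using zc[of k'] k' by simp
      then have "c \<le> - 1" using m_pos[OF k'n] by (simp add: mult_less_0_iff)
      then have "c * m j \<le> - 1 * m j" using m_pos[OF j(1)] by (intro mult_right_mono) auto
      then have "z j \<le> 0" using zc[of j] m_pos[OF j(1)] by simp
      then show ?thesis using j(2) by simp
    qed
    have "\<nu> k' > 0" using k' j(2) by (cases "k' = j") (auto simp: \<nu>_def)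
    then have "\<not> nonneg (- \<nu>)" using nonnegD[of "- \<nu>" k'] by auto
    then have nn: "nonneg \<nu>" using IH[OF _ \<nu> \<nu>_rts] size_\<nu> by auto
    have \<nu>j: "\<nu> j = 0" using nonnegD[OF nn, of j] j(2) by (simp add: \<nu>_def)
    obtain k where k: "k < n" "\<nu> k * form (lc n \<beta> \<nu>) (\<beta> k) > 0"
      using positive_pairing rts_norm_pos[OF \<nu>_rts] by blast
    then have \<nu>k: "\<nu> k > 0" and fk: "form (lc n \<beta> \<nu>) (\<beta> k) > 0"
      using nonnegD[OF nn, of k] by (auto simp: zero_less_mult_iff)
    have "k \<noteq> j" using \<nu>k \<nu>j by auto
    define \<nu>' where "\<nu>' = \<nu> - ev k"
    have \<nu>': "supported n \<nu>'" "nonneg \<nu>'" "\<nu>' j = 0" "size \<nu>' = size \<xi> - 2"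
    proof -
      show "supported n \<nu>'" unfolding \<nu>'_def using \<nu> k(1) by (intro supported_diff) auto
      show "nonneg \<nu>'"
        unfolding nonneg_def
      proof
        fix i show "0 \<le> \<nu>' i" using nonnegD[OF nn, of i] \<nu>k by (cases "i = k") (auto simp: \<nu>'_def)
      qed
      show "\<nu>' j = 0" using \<nu>j \<open>k \<noteq> j\<close> by (simp add: \<nu>'_def)
      show "size \<nu>' = size \<xi> - 2" using size_step[of k \<nu>] k(1) \<nu>k size_\<nu> by (simp add: \<nu>'_def)
    qed
    have zk: "z = ev j - ev k - \<nu>'" by (simp add: \<nu>'_def \<nu>_def)
    have "\<nu>' \<noteq> 0"
    proof
      assume "\<nu>' = 0"
      then have "lc n \<beta> z = \<beta> j - \<beta> k" using zk j(1) k(1) by (simp add: lc_diff)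
      then show False using nonroot[OF j(1) k(1)] \<open>k \<noteq> j\<close> z(2) by auto
    qed
    then obtain l where l: "\<nu>' l \<noteq> 0" by (metis ext zero_fun_apply)
    then have ln: "l < n" and lpos: "\<nu>' l > 0"
      using \<nu>'(1) supportedD nonnegD[OF \<nu>'(2), of l] by (meson not_le, simp)
    have "l \<noteq> j" using l \<nu>'(3) by auto
    have \<nu>'_rts: "lc n \<beta> \<nu>' \<in> rts"
    proof -
      have eq: "lc n \<beta> \<nu>' = lc n \<beta> \<nu> - \<beta> k" using k(1) by (simp add: \<nu>'_def lc_diff)
      have "lc n \<beta> \<nu>' \<noteq> imag c" for c
        using mixed_not_imag[OF \<nu>'(1) ln lpos j(1)] \<nu>'(3) by simp
      then show ?thesis using rts_diff[OF \<nu>_rts beta_rts[OF k(1)] fk] eq by auto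
    qed
    let ?c = "lc n \<beta> \<nu>'"
    have d1: "supported n (ev j - ev k)" "(ev j - ev k) j > 0" "(ev j - ev k) k \<le> 0"
      using j(1) k(1) \<open>k \<noteq> j\<close> by (auto simp: supported_diff)
    have not1: "lc n \<beta> (ev j - ev k) \<notin> rts"
      using nonroot[OF j(1) k(1)] \<open>k \<noteq> j\<close> j(1) k(1) by (simp add: lc_diff)
    have d2: "supported n (ev j - \<nu>')" "(ev j - \<nu>') j > 0" "(ev j - \<nu>') l \<le> 0"
      using j(1) \<nu>'(1,3) lpos \<open>l \<noteq> j\<close> by (auto simp: supported_diff)
    \<comment> \<open>The vector would be mixed and of size one less than that of \<xi>, against the
      induction hypothesis.\<close>
    have not2: "lc n \<beta> (ev j - \<nu>') \<notin> rts"
    proof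
      assume r: "lc n \<beta> (ev j - \<nu>') \<in> rts"
      have "\<bar>(ev j - \<nu>') i\<bar> = ev j i + \<bar>\<nu>' i\<bar>" for i
        using \<nu>'(3) nonnegD[OF \<nu>'(2), of i] by (cases "i = j") auto
      then have "size (ev j - \<nu>') = 1 + size \<nu>'"
        using j(1) sum_mult_ev[of j n "\<lambda>_. 1"] by (simp add: size_def sum.distrib)
      then have "nonneg (ev j - \<nu>') \<or> nonneg (- (ev j - \<nu>'))"
        using \<nu>'(4) r d2(1) by (intro IH) auto
      then show False
        using nonnegD[of "ev j - \<nu>'" l] nonnegD[of "- (ev j - \<nu>')" j] lpos \<open>l \<noteq> j\<close> \<nu>'(3) by auto
    qed
    have lc_uminus_ev: "lc n \<beta> (- ev k) = - \<beta> k" using k(1) by (simp add: lc_uminus)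
    note orth1 = orthogonality[of "ev j - ev k" j k, OF d1(1) j(1) d1(2) k(1) d1(3) _ _ _ not1]
      and orth2 = orthogonality[of "ev j - \<nu>'" j l, OF d2(1) j(1) d2(2) ln d2(3) _ _ _ not2]
    have b: "lc n \<beta> (ev j) \<in> rts" "lc n \<beta> (ev k) \<in> rts" using j(1) k(1) beta_rts by simp_all
    have "form (lc n \<beta> (ev j)) (lc n \<beta> (ev k)) \<le> 0" by (rule orth1[OF HOL.refl b])
    then have 1: "form (\<beta> j) (\<beta> k) \<le> 0" using j(1) k(1) by simp
    have "form (lc n \<beta> (ev j)) ?c \<le> 0" by (rule orth2[OF HOL.refl b(1) \<nu>'_rts])
    then have 2: "form (\<beta> j) ?c \<le> 0" using j(1) by simp
    have "ev j - \<nu>' = z - (- ev k)" by (subst zk) simp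
    moreover have "lc n \<beta> (- ev k) \<in> rts" using rts_uminus[OF b(2)] by (simp only: lc_uminus)
    ultimately have "form (lc n \<beta> z) (lc n \<beta> (- ev k)) \<le> 0" using orth2 z(2) by blast
    then have A: "form (lc n \<beta> z) (- \<beta> k) \<le> 0" by (simp only: lc_uminus_ev)
    have "ev j - ev k = z - (- \<nu>')" by (subst zk) simp
    moreover have "lc n \<beta> (- \<nu>') \<in> rts" using rts_uminus[OF \<nu>'_rts] by (simp only: lc_uminus)
    ultimately have "form (lc n \<beta> z) (lc n \<beta> (- \<nu>')) \<le> 0" using orth1 z(2) by blast
    then have B: "form (lc n \<beta> z) (- ?c) \<le> 0" by (simp only: lc_uminus)
    have zl: "lc n \<beta> z = \<beta> j - \<beta> k - ?c" using zk j(1) k(1) by (simp add: lc_diff)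
    \<comment> \<open>With z = \<beta>_j - \<nu>, the four inequalities add up to (\<nu>, \<nu>)
      \<le> (\<beta>_j, \<nu>) \<le> 0.\<close>
    have "form (\<beta> k + ?c) (\<beta> k + ?c) \<le> 0"
      using A B 1 2 unfolding zl
      by (simp add: form_simps form_commute[of "\<beta> k" "\<beta> j"] form_commute[of ?c "\<beta> j"] form_commute[of ?c "\<beta> k"])
    moreover have "\<beta> k + ?c = lc n \<beta> \<nu>" using k(1) by (simp add: \<nu>'_def lc_diff)
    ultimately show False using rts_norm_pos[OF \<nu>_rts] by simp
  qed
  show ?case
  proof (rule ccontr)
    assume "\<not> ?thesis"
    then have mix: "mixed \<xi>" by simp
    obtain j where j: "j < n" "\<xi> j * form (lc n \<beta> \<xi>) (\<beta> j) > 0"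
      using positive_pairing rts_norm_pos[OF less.prems(2)] by blast
    then consider "\<xi> j > 0" "form (lc n \<beta> \<xi>) (\<beta> j) > 0" | "\<xi> j < 0" "form (lc n \<beta> \<xi>) (\<beta> j) < 0"
      by (auto simp: zero_less_mult_iff)
    then show False
    proof cases
      case 1
      then show ?thesis using core[of \<xi> j] less.prems mix j(1) by simp
    next
      case 2
      then show ?thesis
        using core[of "- \<xi>" j] less.prems mix j(1) rts_uminus
        by (simp add: lc_uminus form_simps size_uminus)
    qed
  qed
qed

text \<open>The functional that is 1 on all \<beta>_j is positive on \<delta>, so it has a dominant
  conjugate, and the correspondingly conjugated \<gamma>_j are positive. By
  \<open>roots_not_mixed\<close> the simple roots are nonnegative combinations of the \<gamma>_j,
  and comparing heights makes each simple root one of them.\<close>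

theorem permutation:
  obtains p where "p permutes {..<n}" "\<And>i j. i < n \<Longrightarrow> j < n \<Longrightarrow> b i j = a (p i) (p j)"
proof -
  have "\<exists>\<xi>. k < n \<longrightarrow> supported n \<xi> \<and> ev k = lc n \<beta> \<xi>" for k using surj[of "ev k"] by auto
  then obtain X where X: "\<And>k. k < n \<Longrightarrow> supported n (X k)" "\<And>k. k < n \<Longrightarrow> lc n \<beta> (X k) = ev k"
    by metis
  \<comment> \<open>The sum of the coordinates of \<alpha>_k in the basis \<beta>.\<close>
  define y where "y k = (\<Sum>j<n. X k j)" for k
  have yb: "val y (\<beta> j) = 1" if j: "j < n" for j
  proof -
    have "lc n \<beta> (lc n X (\<beta> j)) = lc n (\<lambda>k. lc n \<beta> (X k)) (\<beta> j)" by (rule lc_lc)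
    also have "\<dots> = lc n ev (\<beta> j)" unfolding lc_def[of n "\<lambda>k. lc n \<beta> (X k)"] lc_def[of n ev] using X(2) by simp
    also have "\<dots> = \<beta> j" by (rule supported_lc_ev[OF beta_supported[OF j]])
    also have "\<dots> = lc n \<beta> (ev j)" using j by simp
    finally have eq: "lc n \<beta> (lc n X (\<beta> j)) = lc n \<beta> (ev j)" .
    have "lc n X (\<beta> j) = ev j"
    proof (rule lc_inject[OF _ _ eq])
      show "supported n (lc n X (\<beta> j))" using X(1) by (rule lc_supported)
    qed (use j in simp)
    then have "(\<Sum>i<n. lc n X (\<beta> j) i) = 1" using j sum_mult_ev[of j n "\<lambda>_. 1"] by simp
    moreover have "(\<Sum>i<n. lc n X (\<beta> j) i) = val y (\<beta> j)"
      unfolding lc_def val_def y_def by (subst sum.swap) (simp add: sum_distrib_left mult.commute)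
    ultimately show ?thesis by simp
  qed
  have "val y \<delta> = (\<Sum>j<n. m j)" using yb by (simp add: lc_m[symmetric] val_lc)
  also have "\<dots> > 0" using m_pos base(1) by (intro sum_pos) auto
  finally obtain ws where ws: "set ws \<subseteq> {..<n}" "\<forall>i<n. val y (act ws (ev i)) \<ge> 0"
    using dominant_functional[OF finite_negative_roots] by blast
  define \<gamma> where "\<gamma> j = act (rev ws) (\<beta> j)" for j
  have emb: "root_embedding n a D n b \<gamma>" unfolding \<gamma>_def by (rule root_embedding_act) (use ws in auto)
  interpret G: root_embedding n a D n b \<gamma> by (rule emb)
  have \<gamma>: "nonneg (\<gamma> j)" if j: "j < n" for j
  proof (rule ccontr)
    assume "\<not> nonneg (\<gamma> j)"
    then have neg: "nonneg (- \<gamma> j)" using rts_sign G.beta_rts[OF j] by blast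
    have "\<beta> j = act ws (\<gamma> j)" using act_rev[of "rev ws" "\<beta> j"] ws(1) by (simp add: \<gamma>_def)
    also have "\<dots> = act ws (lc n ev (\<gamma> j))" using G.beta_supported[OF j] by (simp add: supported_lc_ev)
    also have "\<dots> = lc n (\<lambda>k. act ws (ev k)) (\<gamma> j)" unfolding lc_def by (rule act_sum)
    finally have "val y (\<beta> j) = (\<Sum>k<n. \<gamma> j k * val y (act ws (ev k)))" by (simp add: val_lc)
    also have "\<dots> \<le> 0"
    proof (rule sum_nonpos)
      fix k assume "k \<in> {..<n}"
      then show "\<gamma> j k * val y (act ws (ev k)) \<le> 0"
        using ws(2) nonnegD[OF neg, of k] by (simp add: mult_nonpos_nonneg)
    qed
    finally show False using yb[OF j] by simp
  qed
  have h: "height n (\<gamma> j) \<ge> 1" if "j < n" for j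
    using height_pos[OF \<gamma>[OF that] G.beta_supported[OF that]] rts_nonzero G.beta_rts[OF that] by fastforce
  have hit: "\<exists>j<n. \<gamma> j = ev i" if i: "i < n" for i
  proof -
    obtain \<xi> where \<xi>: "supported n \<xi>" "act ws (ev i) = lc n \<beta> \<xi>"
      using surj[of "act ws (ev i)"] act_supported ws(1) i by auto
    have "lc n \<beta> \<xi> \<in> rts" using act_rts[OF ws(1) rts_simple[OF i]] \<xi>(2) by simp
    then have sign: "nonneg \<xi> \<or> nonneg (- \<xi>)" using roots_not_mixed \<xi>(1) by blast
    have "ev i = act (rev ws) (lc n \<beta> \<xi>)" using \<xi>(2) act_rev[OF ws(1), of "ev i"] by simp
    also have "\<dots> = lc n \<gamma> \<xi>" unfolding lc_def \<gamma>_def by (rule act_sum)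
    finally have ei: "ev i = lc n \<gamma> \<xi>" .
    have "height n (ev i) = 1" using i sum_mult_ev[of i n "\<lambda>_. 1"] by (simp add: height_def)
    moreover have "height n (lc n \<gamma> \<xi>) = (\<Sum>j<n. \<xi> j * height n (\<gamma> j))"
      unfolding height_def lc_def by (subst sum.swap) (simp add: sum_distrib_left)
    ultimately have one: "(\<Sum>j<n. \<xi> j * height n (\<gamma> j)) = 1" using ei by simp
    have nn: "nonneg \<xi>"
    proof (rule ccontr)
      assume "\<not> nonneg \<xi>"
      then have neg: "nonneg (- \<xi>)" using sign by simp
      have "(\<Sum>j<n. \<xi> j * height n (\<gamma> j)) \<le> 0"
      proof (rule sum_nonpos)
        fix j assume "j \<in> {..<n}"
        then show "\<xi> j * height n (\<gamma> j) \<le> 0"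
          using nonnegD[OF neg, of j] h[of j] by (simp add: mult_nonpos_nonneg)
      qed
      then show False using one by simp
    qed
    have "height n \<xi> \<le> (\<Sum>j<n. \<xi> j * height n (\<gamma> j))"
      unfolding height_def[of n \<xi>]
    proof (rule sum_mono)
      fix j assume "j \<in> {..<n}"
      then show "\<xi> j \<le> \<xi> j * height n (\<gamma> j)"
        using mult_left_mono[OF h[of j] nonnegD[OF nn, of j]] by simp
    qed
    moreover have "\<xi> \<noteq> 0" using ei ev_nonzero[of i] by auto
    ultimately have "height n \<xi> = 1" using one height_pos[OF nn \<xi>(1)] by linarith
    then obtain j where "j < n" "\<xi> = ev j" using nonneg_height_one[OF nn \<xi>(1)] by blast
    then show ?thesis using ei by auto
  qed
  then obtain f where f: "\<And>i. i < n \<Longrightarrow> f i < n \<and> \<gamma> (f i) = ev i" by metis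
  have "inj_on f {..<n}" by (rule inj_onI) (metis ev_inject f lessThan_iff)
  then have "f ` {..<n} = {..<n}" using f by (intro card_subset_eq) (auto simp: card_image)
  then have "\<exists>i<n. \<gamma> j = ev i" if "j < n" for j using that f by (metis imageE lessThan_iff)
  then show ?thesis using G.beta_simple_permutes that by blast
qed

end

theorem untwisted_mutual_embedding:
  assumes A: "untwisted_gcm n a D \<delta> o'"
    and P: "root_embedding n a D n b \<beta>"
    and Q: "\<And>N. sym_gcm n b N \<Longrightarrow> root_embedding n b N n a \<gamma>"
    and nonroot: "\<And>i j. i < n \<Longrightarrow> j < n \<Longrightarrow> i \<noteq> j \<Longrightarrow> \<beta> i - \<beta> j \<notin> gcm_system.rts n a"
  obtains p where "p permutes {..<n}" "\<And>i j. i < n \<Longrightarrow> j < n \<Longrightarrow> b i j = a (p i) (p j)"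
proof -
  interpret A: untwisted_gcm n a D \<delta> o' by fact
  interpret P: root_embedding n a D n b \<beta> by fact
  have Q0: "root_embedding n b P.N n a \<gamma>" by (rule Q) (rule P.BF.sym_gcm_axioms)
  interpret Q: root_embedding n b P.N n a \<gamma> by (rule Q0)
  have connB: "connected_matrix n b" using Q.connected_target A.conn by simp
  \<comment> \<open>The composite induces a second symmetrizer of \<open>a\<close>, for which the
    affine facts are needed as well.\<close>
  interpret A': affine_gcm n a Q.N \<delta> o'
    by unfold_locales (use A.conn A.delta_pos A.delta_supported A.pr_delta A.base in auto)
  have psdB: "P.BF.form x x \<ge> 0" for x using A.semidefinite[of "lc n \<beta> x"] by (simp add: P.form_lc)
  \<comment> \<open>Some positive multiple of \<delta> lies in the span of the \<beta>_j. Its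
    coordinate vector is isotropic for the semidefinite form of the connected \<open>b\<close>, so
    its positive and negative part are kernel vectors, and only one of them can be nonzero.\<close>
  obtain r c where r: "supported n r" "nonneg r" "\<And>i. i < n \<Longrightarrow> r i > 0" "lc n \<beta> r = A.imag c" "c \<noteq> 0"
  proof -
    obtain d where d: "d > 0" "\<And>y. \<exists>x. supported n x \<and> (\<forall>k<n. (\<Sum>j<n. x j * \<beta> j k) = d * y k)"
    proof (rule square_independent[of n \<beta>])
      fix x assume x: "supported n x" "\<And>k. k < n \<Longrightarrow> (\<Sum>j<n. x j * \<beta> j k) = 0"
      have "lc n \<beta> x k = 0" for k
        using x(2) P.beta_supported by (cases "k < n") (auto simp: lc_def supported_def)
      then have "lc n \<beta> x = 0" by auto
      then show "x = 0" using P.beta_indep x(1) by blast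
    qed blast
    obtain \<xi> where \<xi>: "supported n \<xi>" "\<And>k. k < n \<Longrightarrow> lc n \<beta> \<xi> k = d * \<delta> k"
      using d(2)[of \<delta>] by (auto simp: lc_def)
    have "lc n \<beta> \<xi> k = A.imag d k" for k
      using \<xi>(2)[of k] lc_supported[of n n \<beta> \<xi>] P.beta_supported A.delta_supported
      by (cases "k < n") (auto simp: A.imag_def supported_def)
    then have L\<xi>: "lc n \<beta> \<xi> = A.imag d" by (rule ext)
    have form0: "P.BF.form x \<xi> = 0" for x by (simp add: L\<xi> flip: P.form_lc)
    have kernel: "P.B.pr i (pos_part v) = 0" if v: "v = \<xi> \<or> v = - \<xi>" and i: "i < n" for v i
    proof (rule P.BF.isotropic_pr_eq_0[OF psdB _ i])
      have "P.BF.form (pos_part v) v = 0" using v form0 by (auto simp: P.BF.form_simps)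
      then have "P.BF.form (pos_part v) (pos_part v) \<le> 0"
        using P.BF.form_disjoint_nonpos[of "pos_part v" "pos_part (- v)"] pos_part_disjoint[of v]
        by (simp add: P.BF.form_pos_part)
      then show "P.BF.form (pos_part v) (pos_part v) = 0" using psdB[of "pos_part v"] by linarith
    qed
    have full: "pos_part v i > 0" if v: "v = \<xi> \<or> v = - \<xi>" and "pos_part v \<noteq> 0" "i < n" for v i
    proof (rule ccontr)
      assume "\<not> pos_part v i > 0"
      then have "pos_part v i = 0" using nonnegD[OF nonneg_pos_part, of v i] by linarith
      moreover have "supported n (pos_part v)" using v \<xi>(1) by (auto simp: supported_pos_part)
      ultimately have "pos_part v = 0"
        using P.B.nonneg_kernel_full[OF connB nonneg_pos_part _ kernel[OF v]] \<open>i < n\<close> by blast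
      then show False using that(2) by simp
    qed
    have "\<xi> \<noteq> 0"
    proof
      assume "\<xi> = 0"
      then have "A.imag d o' = 0" using L\<xi> by simp
      then show False using d(1) by simp
    qed
    show ?thesis
    proof (cases "pos_part \<xi> = 0")
      case True
      then have eq: "pos_part (- \<xi>) = - \<xi>"
        using pos_part_decomp[of \<xi>] by (metis diff_0 minus_minus)
      then have ne: "pos_part (- \<xi>) \<noteq> 0" using \<open>\<xi> \<noteq> 0\<close> by simp
      show ?thesis
      proof (rule that[of "- \<xi>" "- d"])
        show "(- \<xi>) i > 0" if "i < n" for i using full[OF _ ne that] eq by simp
        show "nonneg (- \<xi>)" using nonneg_pos_part[of "- \<xi>"] eq by simp
      qed (use \<xi>(1) d(1) L\<xi> in \<open>simp_all add: lc_uminus A.imag_uminus\<close>)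
    next
      case False
      have "pos_part (- \<xi>) = 0"
      proof (rule ccontr)
        assume "pos_part (- \<xi>) \<noteq> 0"
        then have "pos_part (- \<xi>) o' > 0" "pos_part \<xi> o' > 0" using full False A.base(1) by blast+
        then show False using pos_part_disjoint[of \<xi> o'] by simp
      qed
      then have eq: "pos_part \<xi> = \<xi>" using pos_part_decomp[of \<xi>] by simp
      show ?thesis
      proof (rule that[of \<xi> d])
        show "\<xi> i > 0" if "i < n" for i using full[OF _ False that] eq by simp
        show "nonneg \<xi>" using nonneg_pos_part[of \<xi>] eq by simp
      qed (use \<xi>(1) d(1) L\<xi> in simp_all)
    qed
  qed
  \<comment> \<open>Dividing by the gcd makes \<open>m\<close> primitive, which gives Bezout
    coefficients \<kappa>' for it.\<close>
  define g where "g = Gcd (r ` {..<n})"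
  have g_dvd: "g dvd r i" if "i < n" for i using that by (auto simp: g_def)
  have g0: "g > 0"
  proof -
    have "g \<noteq> 0" using g_dvd[OF A.base(1)] r(3)[OF A.base(1)] by auto
    moreover have "g \<ge> 0" by (simp add: g_def)
    ultimately show ?thesis by linarith
  qed
  define m where "m i = r i div g" for i
  have gm: "g * m i = r i" for i
    using g_dvd[of i] supportedD[OF r(1), of i] by (cases "i < n") (auto simp: m_def)
  have m_pos: "m i > 0" if "i < n" for i
    using r(3)[OF that] g0 by (simp add: gm[symmetric] zero_less_mult_iff)
  have m_supp: "supported n m" using r(1) by (auto simp: supported_def m_def)
  obtain \<kappa>' where "(\<Sum>i<n. \<kappa>' i * r i) = g" using bezout_sum[where n = n and r = r] by (auto simp: g_def)
  then have "g * (\<Sum>i<n. \<kappa>' i * m i) = g * 1" by (simp add: sum_distrib_left gm[symmetric] algebra_simps)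
  then have bez: "(\<Sum>i<n. \<kappa>' i * m i) = 1" using g0 by simp
  define s where "s = lc n \<beta> m o'"
  have gL: "(\<lambda>k. g * lc n \<beta> m k) = A.imag c"
  proof -
    have "(\<lambda>k. g * lc n \<beta> m k) = lc n \<beta> (\<lambda>k. g * m k)" by (simp only: lc_scale)
    then show ?thesis using r(4) by (simp add: gm)
  qed
  then have c: "c = g * s" using fun_cong[OF gL, of o'] by (simp add: s_def)
  have Lm: "lc n \<beta> m = A.imag s"
  proof
    fix k
    have "g * lc n \<beta> m k = g * A.imag s k" using fun_cong[OF gL, of k] by (simp add: c A.imag_def)
    then show "lc n \<beta> m k = A.imag s k" using g0 by simp
  qed
  have s0: "s \<noteq> 0" using c r(5) by auto
  \<comment> \<open>The combination of the \<beta>_j with coefficients \<open>m\<close> is s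
    \<delta>; the factor 1 - s supplies what is missing to \<delta>.\<close>
  define \<kappa> where "\<kappa> i = (1 - s) * \<kappa>' i" for i
  define k where "k x = (\<Sum>i<n. x i * \<kappa> i)" for x
  \<comment> \<open>The type of a family of real roots only depends on their classes modulo \<open>\<delta>\<close>. This choice of
    representatives achieves \<open>\<Sum>\<^sub>j m\<^sub>j \<beta>'\<^sub>j = \<delta>\<close>.\<close>
  define \<beta>' where "\<beta>' j = \<beta> j + A.imag (\<kappa> j)" for j
  have L': "lc n \<beta>' x = lc n \<beta> x + A.imag (k x)" for x
    by (auto simp: lc_def \<beta>'_def k_def A.imag_def algebra_simps sum.distrib sum_distrib_left sum_distrib_right)
  have km: "k m = 1 - s"
  proof -
    have "k m = (1 - s) * (\<Sum>i<n. \<kappa>' i * m i)" by (simp add: k_def \<kappa>_def sum_distrib_left algebra_simps)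
    then show ?thesis using bez by simp
  qed
  have k_scale: "k (\<lambda>i. t * x i) = t * k x" for t x by (simp add: k_def sum_distrib_left algebra_simps)
  have k_diff: "k (x - y) = k x - k y" for x y by (simp add: k_def algebra_simps sum_subtractf)
  have L'm: "lc n \<beta>' m = \<delta>" by (auto simp: L' Lm km A.imag_def algebra_simps)
  have emb: "root_embedding n a D n b \<beta>'"
  proof unfold_locales
    show "\<beta>' j \<in> A.rts" if "j < n" for j using P.beta_rts[OF that] A.rts_shift by (simp add: \<beta>'_def)
    show "2 * A.form (\<beta>' i) (\<beta>' j) = A.form (\<beta>' i) (\<beta>' i) * b i j" if "i < n" "j < n" for i j
      using P.beta_type[OF that] by (simp add: \<beta>'_def A.form_simps)
    show "x = 0" if x: "supported n x" "lc n \<beta>' x = 0" for x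
    proof -
      \<comment> \<open>A relation between the shifted vectors says that
        \<open>lc n \<beta> x\<close> is t \<delta>. Comparison with the relation for
        \<open>m\<close> gives s x = t m, and applying \<open>k\<close> yields t = 0.\<close>
      define t where "t = - k x"
      have Lx: "lc n \<beta> x = A.imag t"
        using x(2) by (simp add: L' t_def A.imag_uminus eq_neg_iff_add_eq_0)
      have "lc n \<beta> ((\<lambda>i. s * x i) - (\<lambda>i. t * m i)) = 0"
        by (auto simp: lc_diff lc_scale Lx Lm A.imag_def)
      then have "(\<lambda>i. s * x i) - (\<lambda>i. t * m i) = 0"
        by (rule P.beta_indep[rotated]) (intro supported_diff supported_scale x(1) m_supp)
      then have "k (\<lambda>i. s * x i) = k (\<lambda>i. t * m i)" using k_diff by simp
      then have "s * k x = t * (1 - s)" by (simp add: k_scale km)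
      then have "t = 0" by (simp add: t_def algebra_simps)
      then show ?thesis using Lx P.beta_indep[OF x(1)] by simp
    qed
  qed
  have unimod: "unimodular_pi_system n a D \<delta> o' b \<beta>' m"
  proof -
    interpret P': root_embedding n a D n b \<beta>' by (rule emb)
    show ?thesis
    proof unfold_locales
      show "\<beta>' i - \<beta>' j \<notin> A.rts" if "i < n" "j < n" "i \<noteq> j" for i j
      proof
        assume "\<beta>' i - \<beta>' j \<in> A.rts"
        then have "\<beta>' i - \<beta>' j + A.imag (\<kappa> j - \<kappa> i) \<in> A.rts" by (rule A.rts_shift)
        moreover have "\<beta>' i - \<beta>' j + A.imag (\<kappa> j - \<kappa> i) = \<beta> i - \<beta> j"
          by (auto simp: \<beta>'_def A.imag_def algebra_simps)
        ultimately show False using nonroot[OF that] by simp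
      qed
      define B where "B = {x \<in> A.rts. x o' = 0}"
      define R where "R x = lc n \<beta> (lc n \<gamma> x)" for x
      \<comment> \<open>The composite modulo \<delta>, with representatives normalized at
        \<open>o'\<close>. Being injective on the finite set \<open>B\<close>, it is onto, so the
        \<beta>_j generate every simple root up to a multiple of \<delta>.\<close>
      define \<rho> where "\<rho> x = R x + A.imag (- R x o')" for x
      have R_diff: "R (x - y) = R x - R y" for x y by (simp add: R_def lc_diff)
      have "\<rho> ` B \<subseteq> B"
      proof (rule image_subsetI)
        fix x assume "x \<in> B"
        then have "lc n \<gamma> x \<in> P.B.rts" by (intro Q.lc_rts) (simp add: B_def)
        then have "R x \<in> A.rts" unfolding R_def by (rule P.lc_rts)
        then show "\<rho> x \<in> B" using A.rts_shift by (simp add: B_def \<rho>_def)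
      qed
      moreover have "inj_on \<rho> B"
      proof (rule inj_onI)
        fix x y assume xy: "x \<in> B" "y \<in> B" "\<rho> x = \<rho> y"
        \<comment> \<open>Equal images modulo \<delta> make x - y isotropic for the pulled back
          form, hence a multiple of \<delta>, and it vanishes at \<open>o'\<close>.\<close>
        have "R (x - y) = A.imag (R x o' - R y o')"
          using fun_cong[OF xy(3)] by (auto simp: R_diff \<rho>_def A.imag_def algebra_simps)
        then have "A.form (R (x - y)) (R (x - y)) = 0" by simp
        then have "Q.BF.form (x - y) (x - y) = 0" by (simp add: R_def P.form_lc Q.form_lc)
        moreover have "supported n (x - y)" using xy A.rts_supported by (simp add: B_def supported_diff)
        ultimately have "x - y = A'.imag ((x - y) o')" using A'.isotropic_imag by blast
        also have "\<dots> = 0" using xy by (simp add: B_def)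
        finally show "x = y" by simp
      qed
      ultimately have \<rho>B: "\<rho> ` B = B" using A.finite_base_roots by (simp add: B_def endo_inj_surj)
      have basis: "\<exists>\<xi>. supported n \<xi> \<and> ev i = lc n \<beta>' \<xi>" if i: "i < n" for i
      proof -
        have "ev i + A.imag (- ev i o') \<in> B"
          using A.rts_shift[OF A.rts_simple[OF i]] by (simp add: B_def)
        then obtain x where x: "x \<in> B" "ev i + A.imag (- ev i o') = \<rho> x" using \<rho>B by (metis imageE)
        define \<eta> t where "\<eta> = lc n \<gamma> x" and "t = ev i o' - R x o'"
        have \<eta>: "supported n \<eta>" unfolding \<eta>_def by (intro lc_supported Q.beta_supported)
        have ei: "ev i = lc n \<beta> \<eta> + A.imag t"
          using fun_cong[OF x(2)] by (auto simp: \<rho>_def R_def \<eta>_def t_def A.imag_def algebra_simps fun_eq_iff)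
        \<comment> \<open>As \<delta> is now the combination with coefficients \<open>m\<close>, the
          remaining multiple of \<delta> is absorbed by subtracting u m.\<close>
        define u where "u = k \<eta> - t"
        have "lc n \<beta>' (\<eta> - (\<lambda>j. u * m j)) = lc n \<beta> \<eta> + A.imag (k \<eta>) - A.imag u"
          by (simp only: lc_diff lc_scale L'm) (simp only: L' A.imag_def)
        also have "\<dots> = ev i" by (subst ei) (auto simp: A.imag_def u_def algebra_simps)
        finally have "ev i = lc n \<beta>' (\<eta> - (\<lambda>j. u * m j))" ..
        moreover have "supported n (\<eta> - (\<lambda>j. u * m j))"
          using \<eta> m_supp by (intro supported_diff supported_scale)
        ultimately show ?thesis by blast
      qed
      then have "\<exists>\<xi>. i < n \<longrightarrow> supported n \<xi> \<and> ev i = lc n \<beta>' \<xi>" for i by blast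
      then obtain X where X: "\<And>i. i < n \<Longrightarrow> supported n (X i)" "\<And>i. i < n \<Longrightarrow> lc n \<beta>' (X i) = ev i"
        by metis
      show "\<exists>\<xi>. supported n \<xi> \<and> x = lc n \<beta>' \<xi>" if x: "supported n x" for x
      proof (intro exI conjI)
        show "supported n (lc n X x)" using X(1) by (rule lc_supported)
        have "lc n \<beta>' (lc n X x) = lc n (\<lambda>i. lc n \<beta>' (X i)) x" by (rule lc_lc)
        also have "\<dots> = lc n ev x" unfolding lc_def[of n "\<lambda>i. lc n \<beta>' (X i)"] lc_def[of n ev] using X(2) by simp
        also have "\<dots> = x" by (rule supported_lc_ev[OF x])
        finally show "x = lc n \<beta>' (lc n X x)" ..
      qed
      show "lc n \<beta>' m = \<delta>" by (rule L'm)
    qed (use m_pos m_supp in auto)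
  qed
  show ?thesis using unimodular_pi_system.permutation[OF unimod] that by blast
qed

section \<open>Real roots are roots of the Kac-Moody algebra\<close>

text \<open>The Verma module of highest weight \<open>h \<mapsto> fst h $ r\<close> shows that the simple coroots do not vanish.
  Its basis are the words in the \<open>f\<^sub>i\<close>. Operators act on functions on words, i.e. on the dual space,
  so that the interpretation reverses brackets.\<close>

definition word_weight :: "int mat \<Rightarrow> nat \<Rightarrow> cvec \<Rightarrow> nat list \<Rightarrow> complex" where
  "word_weight A r h w = fst h $ r - (\<Sum>k\<leftarrow>w. if k < dim_row A then simple_root A k h else 0)"

text \<open>The transpose of e_i. Moving e_i past the first letter f_j of a word leaves [e_i, f_j],
  which for i = j acts on the rest of the word by its weight at the simple coroot.\<close>

fun raise_op :: "int mat \<Rightarrow> nat \<Rightarrow> nat \<Rightarrow> (nat list \<Rightarrow> complex) \<Rightarrow> nat list \<Rightarrow> complex" where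
  "raise_op A r i \<phi> [] = 0"
| "raise_op A r i \<phi> (j # w) = raise_op A r i (\<lambda>u. \<phi> (j # u)) w
     + (if i = j then word_weight A r (simple_coroot A i) w * \<phi> w else 0)"

primrec interp :: "int mat \<Rightarrow> nat \<Rightarrow> lie_term \<Rightarrow> (nat list \<Rightarrow> complex) \<Rightarrow> nat list \<Rightarrow> complex" where
  "interp A r (Gen_e i) = raise_op A r i"
| "interp A r (Gen_f i) = (\<lambda>\<phi> w. \<phi> (i # w))"
| "interp A r (Gen_h h) = (\<lambda>\<phi> w. word_weight A r h w * \<phi> w)"
| "interp A r Zero = (\<lambda>\<phi> w. 0)"
| "interp A r (Add x y) = (\<lambda>\<phi> w. interp A r x \<phi> w + interp A r y \<phi> w)"
| "interp A r (Smult c x) = (\<lambda>\<phi> w. c * interp A r x \<phi> w)"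
| "interp A r (Bracket x y) =
     (\<lambda>\<phi> w. interp A r y (interp A r x \<phi>) w - interp A r x (interp A r y \<phi>) w)"

lemma raise_op_linear:
  "raise_op A r i (\<lambda>w. c * \<phi> w + \<psi> w) w = c * raise_op A r i \<phi> w + raise_op A r i \<psi> w"
  by (induction w arbitrary: \<phi> \<psi>) (auto simp: algebra_simps)

lemma interp_linear:
  "interp A r x (\<lambda>w. c * \<phi> w + \<psi> w) w = c * interp A r x \<phi> w + interp A r x \<psi> w"
proof (induction x arbitrary: \<phi> \<psi> w)
  case (Bracket x y)
  have "interp A r z (\<lambda>w. c * \<phi> w + \<psi> w) = (\<lambda>w. c * interp A r z \<phi> w + interp A r z \<psi> w)"
    if "z \<in> {x, y}" for z \<phi> \<psi> using Bracket that by (intro ext) auto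
  then show ?case by (simp add: algebra_simps)
qed (auto simp: raise_op_linear, auto simp: algebra_simps)

lemma interp_diff: "interp A r x (\<lambda>w. \<phi> w - \<psi> w) w = interp A r x \<phi> w - interp A r x \<psi> w"
  using interp_linear[of A r x "-1" \<psi> \<phi> w] by (simp add: algebra_simps)

lemma interp_add: "interp A r x (\<lambda>w. \<phi> w + \<psi> w) w = interp A r x \<phi> w + interp A r x \<psi> w"
  using interp_linear[of A r x 1 \<phi> \<psi> w] by simp

lemma interp_zero: "interp A r x (\<lambda>w. 0) w = 0"
  using interp_diff[of A r x "\<lambda>_. 0" "\<lambda>_. 0" w] by simp

lemma interp_scale: "interp A r x (\<lambda>w. c * \<phi> w) w = c * interp A r x \<phi> w"
  using interp_linear[of A r x c \<phi> "\<lambda>_. 0" w] by (simp add: interp_zero)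

lemma simple_root_add:
  assumes "h \<in> cartan A" "h' \<in> cartan A" "j < dim_row A"
  shows "simple_root A j (cartan_add h h') = simple_root A j h + simple_root A j h'"
  using assms by (cases h; cases h') (auto simp: cartan_def sum.distrib algebra_simps)

lemma simple_root_smult:
  assumes "h \<in> cartan A" "j < dim_row A"
  shows "simple_root A j (cartan_smult c h) = c * simple_root A j h"
  using assms by (cases h) (auto simp: cartan_def sum_distrib_left algebra_simps)

lemma word_weight_add:
  assumes "h \<in> cartan A" "h' \<in> cartan A" "r < dim_row A"
  shows "word_weight A r (cartan_add h h') w = word_weight A r h w + word_weight A r h' w"
proof -
  have "fst (cartan_add h h') $ r = fst h $ r + fst h' $ r"
    using assms by (cases h; cases h') (auto simp: cartan_def)
  then show ?thesis
    by (induction w) (auto simp: word_weight_def simple_root_add[OF assms(1,2)] algebra_simps)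
qed

lemma word_weight_smult:
  assumes "h \<in> cartan A" "r < dim_row A"
  shows "word_weight A r (cartan_smult c h) w = c * word_weight A r h w"
proof -
  have "fst (cartan_smult c h) $ r = c * fst h $ r"
    using assms by (cases h) (auto simp: cartan_def)
  then show ?thesis
    by (induction w) (auto simp: word_weight_def simple_root_smult[OF assms(1)] algebra_simps)
qed

lemma word_weight_Cons:
  "word_weight A r h (j # w) = word_weight A r h w - (if j < dim_row A then simple_root A j h else 0)"
  by (simp add: word_weight_def)

lemma raise_op_weight:
  assumes "i < dim_row A"
  shows "raise_op A r i (\<lambda>w. word_weight A r h w * \<phi> w) w
    = (word_weight A r h w + simple_root A i h) * raise_op A r i \<phi> w"
proof (induction w arbitrary: \<phi>)
  case (Cons j w)
  define t where "t = (if j < dim_row A then simple_root A j h else 0)"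
  have wj: "word_weight A r h (j # u) = word_weight A r h u - t" for u
    by (simp add: word_weight_Cons t_def)
  have "(\<lambda>u. word_weight A r h (j # u) * \<phi> (j # u))
      = (\<lambda>u. (- t) * \<phi> (j # u) + word_weight A r h u * \<phi> (j # u))"
    by (auto simp: wj algebra_simps)
  then have "raise_op A r i (\<lambda>u. word_weight A r h (j # u) * \<phi> (j # u)) w
      = (word_weight A r h (j # w) + simple_root A i h) * raise_op A r i (\<lambda>u. \<phi> (j # u)) w"
    by (simp only: raise_op_linear Cons) (simp add: wj algebra_simps)
  then have "raise_op A r i (\<lambda>w. word_weight A r h w * \<phi> w) (j # w)
      = (word_weight A r h (j # w) + simple_root A i h) * raise_op A r i (\<lambda>u. \<phi> (j # u)) w
        + (if i = j then word_weight A r (simple_coroot A i) w * (word_weight A r h w * \<phi> w) else 0)"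
    by (simp only: raise_op.simps)
  moreover have "t = simple_root A i h" if "i = j" using assms that by (simp add: t_def)
  ultimately show ?case by (cases "i = j") (simp_all add: wj algebra_simps)
qed simp

lemma interp_tilde_eq:
  assumes "r < dim_row A" "tilde_eq A x y"
  shows "interp A r x = interp A r y"
  using assms(2)
proof induction
  case (e_f i j)
  then show ?case by (auto simp: fun_eq_iff)
next
  case (h_e h i)
  then show ?case by (intro ext) (simp add: raise_op_weight ring_distribs)
next
  case (h_f h i)
  then show ?case by (intro ext) (simp add: word_weight_Cons algebra_simps)
next
  case (Bracket_cong x x' y y')
  then show ?case by simp
qed (auto simp: fun_eq_iff interp_diff interp_add interp_scale interp_zero word_weight_add
  word_weight_smult assms(1) algebra_simps)

lemma simple_coroot_nonzero: "i < dim_row A \<Longrightarrow> \<not> tilde_eq A (Gen_h (simple_coroot A i)) Zero"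
proof
  assume "i < dim_row A" "tilde_eq A (Gen_h (simple_coroot A i)) Zero"
  then have "interp A i (Gen_h (simple_coroot A i)) (\<lambda>_. 1) [] = interp A i Zero (\<lambda>_. 1) []"
    using interp_tilde_eq by metis
  then show False using \<open>i < dim_row A\<close> by (simp add: word_weight_def simple_coroot_def)
qed

lemma cartan_add_closed:
  assumes "h \<in> cartan A" "h' \<in> cartan A"
  shows "cartan_add h h' \<in> cartan A"
proof -
  obtain x d x' d' where h: "h = (x, d)" "h' = (x', d')" by (metis surj_pair)
  have "map_mat complex_of_int A *\<^sub>v (d + d') = 0\<^sub>v (dim_row A)"
  proof (rule eq_vecI)
    fix i assume "i < dim_vec (0\<^sub>v (dim_row A) :: complex vec)"
    then have i: "i < dim_row A" by simp
    have "(map_mat complex_of_int A *\<^sub>v d) $ i = 0" "(map_mat complex_of_int A *\<^sub>v d') $ i = 0"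
      using assms i by (auto simp: h cartan_def)
    then show "(map_mat complex_of_int A *\<^sub>v (d + d')) $ i = 0\<^sub>v (dim_row A) $ i"
      using assms i by (auto simp: h cartan_def scalar_prod_def algebra_simps sum.distrib)
  qed simp
  then show ?thesis using assms by (auto simp: h cartan_def)
qed

lemma cartan_smult_closed:
  assumes "h \<in> cartan A"
  shows "cartan_smult c h \<in> cartan A"
proof -
  obtain x d where h: "h = (x, d)" by (metis surj_pair)
  have "map_mat complex_of_int A *\<^sub>v (c \<cdot>\<^sub>v d) = 0\<^sub>v (dim_row A)"
  proof (rule eq_vecI)
    fix i assume "i < dim_vec (0\<^sub>v (dim_row A) :: complex vec)"
    then have i: "i < dim_row A" by simp
    have "(map_mat complex_of_int A *\<^sub>v d) $ i = 0" using assms i by (auto simp: h cartan_def)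
    then have "c * (\<Sum>k = 0..<dim_vec d. row (map_mat complex_of_int A) i $ k * d $ k) = 0"
      using assms i by (auto simp: h cartan_def scalar_prod_def)
    then show "(map_mat complex_of_int A *\<^sub>v (c \<cdot>\<^sub>v d)) $ i = 0\<^sub>v (dim_row A) $ i"
      using assms i by (auto simp: h cartan_def scalar_prod_def sum_distrib_left algebra_simps)
  qed simp
  then show ?thesis using assms by (auto simp: h cartan_def)
qed

lemma simple_coroot_cartan: "i < dim_row A \<Longrightarrow> simple_coroot A i \<in> cartan A"
proof -
  have "map_mat complex_of_int A *\<^sub>v 0\<^sub>v (dim_row A) = 0\<^sub>v (dim_row A)"
    by (rule eq_vecI) (auto simp: scalar_prod_def)
  then show ?thesis by (simp add: simple_coroot_def cartan_def)
qed

lemma tilde_eq_terms: "tilde_eq A x y \<Longrightarrow> x \<in> lie_terms A \<and> y \<in> lie_terms A"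
proof (induction rule: tilde_eq.induct)
  case (e_f i j)
  then show ?case by (auto intro: lie_terms.intros simple_coroot_cartan)
qed (auto intro: lie_terms.intros cartan_add_closed cartan_smult_closed)

section \<open>Calculation in the Lie algebra before passing to the quotient\<close>

context
  fixes A :: "int mat"
begin

abbreviation teq (infix "\<approx>" 50) where "x \<approx> y \<equiv> tilde_eq A x y"
abbreviation L where "L \<equiv> lie_terms A"
abbreviation neg where "neg x \<equiv> Smult (- 1) x"

lemmas [trans] = tilde_eq.trans
lemmas L_intros = lie_terms.intros

lemma teqD: "x \<approx> y \<Longrightarrow> x \<in> L" "x \<approx> y \<Longrightarrow> y \<in> L"
  using tilde_eq_terms by auto

lemma Add_Zero_left: "x \<in> L \<Longrightarrow> Add Zero x \<approx> x"
  by (meson L_intros tilde_eq.Add_Zero tilde_eq.Add_commute tilde_eq.trans)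

lemma neg_Add: "x \<in> L \<Longrightarrow> Add (neg x) x \<approx> Zero"
  by (meson L_intros tilde_eq.Add_neg tilde_eq.Add_commute tilde_eq.trans)

lemma Add_left_cancel:
  assumes "u \<in> L" "v \<in> L" "w \<in> L" "Add u v \<approx> Add u w"
  shows "v \<approx> w"
proof -
  have *: "x \<approx> Add (neg u) (Add u x)" if "x \<in> L" for x
  proof -
    have "Add (neg u) (Add u x) \<approx> Add (Add (neg u) u) x"
      using assms that by (intro tilde_eq.sym[OF tilde_eq.Add_assoc] L_intros)
    also have "\<dots> \<approx> Add Zero x"
      using assms that by (intro tilde_eq.Add_cong neg_Add tilde_eq.refl)
    also have "\<dots> \<approx> x" using that by (rule Add_Zero_left)
    finally show ?thesis by (rule tilde_eq.sym)
  qed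
  have "v \<approx> Add (neg u) (Add u v)" by (rule *[OF assms(2)])
  also have "\<dots> \<approx> Add (neg u) (Add u w)"
    by (rule tilde_eq.Add_cong[OF tilde_eq.refl assms(4)]) (intro L_intros assms(1))
  also have "\<dots> \<approx> w" by (rule tilde_eq.sym[OF *[OF assms(3)]])
  finally show ?thesis .
qed

lemma Add_self_Zero:
  assumes "u \<in> L" "Add u u \<approx> u"
  shows "u \<approx> Zero"
proof (rule Add_left_cancel[OF assms(1,1)])
  show "Add u u \<approx> Add u Zero"
    using assms by (meson tilde_eq.trans tilde_eq.sym tilde_eq.Add_Zero)
qed (rule L_intros)

lemma Smult_0: "x \<in> L \<Longrightarrow> Smult 0 x \<approx> Zero"
  using tilde_eq.Smult_add_left[of x A 0 0] by (intro Add_self_Zero) (auto intro: L_intros tilde_eq.sym)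

lemma Smult_Zero: "Smult c Zero \<approx> Zero"
proof (rule Add_self_Zero)
  have "Add (Smult c Zero) (Smult c Zero) \<approx> Smult c (Add Zero Zero)"
    by (intro tilde_eq.sym[OF tilde_eq.Smult_add_right] L_intros)
  also have "\<dots> \<approx> Smult c Zero" by (intro tilde_eq.Smult_cong tilde_eq.Add_Zero L_intros)
  finally show "Add (Smult c Zero) (Smult c Zero) \<approx> Smult c Zero" .
qed (intro L_intros)

lemma Bracket_Zero_right:
  assumes "x \<in> L"
  shows "Bracket x Zero \<approx> Zero"
proof (rule Add_self_Zero)
  have "Add (Bracket x Zero) (Bracket x Zero) \<approx> Bracket x (Add Zero Zero)"
    using assms by (intro tilde_eq.sym[OF tilde_eq.Bracket_Add_right] L_intros)
  also have "\<dots> \<approx> Bracket x Zero"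
    using assms by (intro tilde_eq.Bracket_cong tilde_eq.refl tilde_eq.Add_Zero L_intros)
  finally show "Add (Bracket x Zero) (Bracket x Zero) \<approx> Bracket x Zero" .
qed (use assms in \<open>intro L_intros\<close>)

lemma Bracket_Zero_left:
  assumes "x \<in> L"
  shows "Bracket Zero x \<approx> Zero"
proof (rule Add_self_Zero)
  have "Add (Bracket Zero x) (Bracket Zero x) \<approx> Bracket (Add Zero Zero) x"
    using assms by (intro tilde_eq.sym[OF tilde_eq.Bracket_Add_left] L_intros)
  also have "\<dots> \<approx> Bracket Zero x"
    using assms by (intro tilde_eq.Bracket_cong tilde_eq.refl tilde_eq.Add_Zero L_intros)
  finally show "Add (Bracket Zero x) (Bracket Zero x) \<approx> Bracket Zero x" .
qed (use assms in \<open>intro L_intros\<close>)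

lemma neg_unique:
  assumes "x \<in> L" "y \<in> L" "Add x y \<approx> Zero"
  shows "y \<approx> neg x"
proof (rule Add_left_cancel[OF assms(1,2)])
  show "Add x y \<approx> Add x (neg x)"
    using assms by (meson tilde_eq.trans tilde_eq.sym tilde_eq.Add_neg)
qed (use assms in \<open>intro L_intros\<close>)

lemma Bracket_antisym:
  assumes "x \<in> L" "y \<in> L"
  shows "Bracket y x \<approx> neg (Bracket x y)"
proof (rule neg_unique)
  have "Add (Bracket x y) (Bracket y x) \<approx> Add (Add Zero (Bracket x y)) (Add (Bracket y x) Zero)"
    using assms by (intro tilde_eq.sym[OF tilde_eq.Add_cong] Add_Zero_left tilde_eq.Add_Zero L_intros)
  also have "\<dots> \<approx> Add (Add (Bracket x x) (Bracket x y)) (Add (Bracket y x) (Bracket y y))"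
    using assms
    by (intro tilde_eq.Add_cong tilde_eq.refl tilde_eq.sym[OF tilde_eq.Bracket_self] L_intros)
  also have "\<dots> \<approx> Add (Bracket x (Add x y)) (Bracket y (Add x y))"
    using assms by (intro tilde_eq.Add_cong tilde_eq.sym[OF tilde_eq.Bracket_Add_right] L_intros)
  also have "\<dots> \<approx> Bracket (Add x y) (Add x y)"
    using assms by (intro tilde_eq.sym[OF tilde_eq.Bracket_Add_left] L_intros)
  also have "\<dots> \<approx> Zero" using assms by (intro tilde_eq.Bracket_self L_intros)
  finally show "Add (Bracket x y) (Bracket y x) \<approx> Zero" .
qed (use assms in \<open>auto intro: L_intros\<close>)

lemma Bracket_derivation:
  assumes "x \<in> L" "y \<in> L" "z \<in> L"
  shows "Bracket x (Bracket y z) \<approx> Add (Bracket (Bracket x y) z) (Bracket y (Bracket x z))"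
proof -
  let ?b = "Bracket y (Bracket z x)" and ?c = "Bracket z (Bracket x y)"
  have L: "?b \<in> L" "?c \<in> L" "Bracket x (Bracket y z) \<in> L" "Bracket x z \<in> L" "Bracket z x \<in> L"
    "Bracket x y \<in> L"
    using assms by (auto intro: L_intros)
  have "Bracket x (Bracket y z) \<approx> neg (Add ?b ?c)"
  proof (rule neg_unique)
    have "Add (Add ?b ?c) (Bracket x (Bracket y z)) \<approx> Add (Bracket x (Bracket y z)) (Add ?b ?c)"
      using L assms by (intro tilde_eq.Add_commute L_intros)
    also have "\<dots> \<approx> Zero" using assms by (rule tilde_eq.Jacobi)
    finally show "Add (Add ?b ?c) (Bracket x (Bracket y z)) \<approx> Zero" .
  qed (use L in \<open>auto intro: L_intros\<close>)
  also have "\<dots> \<approx> Add (neg ?b) (neg ?c)" using L assms by (intro tilde_eq.Smult_add_right)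
  also have "\<dots> \<approx> Add (neg ?c) (neg ?b)" using L assms by (intro tilde_eq.Add_commute L_intros)
  also have "\<dots> \<approx> Add (Bracket (Bracket x y) z) (Bracket y (Bracket x z))"
  proof (rule tilde_eq.Add_cong)
    show "neg ?c \<approx> Bracket (Bracket x y) z"
      using assms L by (intro tilde_eq.sym[OF Bracket_antisym])
    have "neg ?b \<approx> Bracket y (neg (Bracket z x))"
      using assms L by (intro tilde_eq.sym[OF tilde_eq.Bracket_Smult_right])
    also have "\<dots> \<approx> Bracket y (Bracket x z)"
      using assms L by (intro tilde_eq.Bracket_cong tilde_eq.refl tilde_eq.sym[OF Bracket_antisym])
    finally show "neg ?b \<approx> Bracket y (Bracket x z)" .
  qed
  finally show ?thesis .
qed

definition wt :: "(nat \<Rightarrow> int) \<Rightarrow> cvec \<Rightarrow> complex" where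
  "wt b h = (\<Sum>j<dim_row A. of_int (b j) * simple_root A j h)"

lemma wt_add: "wt (b + c) h = wt b h + wt c h"
  by (simp add: wt_def algebra_simps sum.distrib)

lemma wt_ev: "i < dim_row A \<Longrightarrow> wt (ev i) h = simple_root A i h"
proof -
  assume "i < dim_row A"
  moreover have "wt (ev i) h = (\<Sum>j<dim_row A. if j = i then simple_root A j h else 0)"
    unfolding wt_def by (intro sum.cong) (auto simp: ev_def)
  ultimately show ?thesis by simp
qed

text \<open>The part of weight \<open>b\<close> in the subalgebra generated by the e_i, spanned by
  right-nested brackets. Each bracket adds a single generator, so claims can be proved letter by
  letter.\<close>

inductive upper :: "(nat \<Rightarrow> int) \<Rightarrow> lie_term \<Rightarrow> bool" where
  upper_e: "i < dim_row A \<Longrightarrow> upper (ev i) (Gen_e i)"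
| upper_Zero: "upper b Zero"
| upper_Add: "upper b x \<Longrightarrow> upper b y \<Longrightarrow> upper b (Add x y)"
| upper_Smult: "upper b x \<Longrightarrow> upper b (Smult c x)"
| upper_eq: "upper b x \<Longrightarrow> x \<approx> y \<Longrightarrow> upper b y"
| upper_Bracket: "i < dim_row A \<Longrightarrow> upper b x \<Longrightarrow> upper (b + ev i) (Bracket (Gen_e i) x)"

lemma upper_terms: "upper b x \<Longrightarrow> x \<in> L"
  by (induction rule: upper.induct) (auto intro: L_intros teqD)

lemma upper_weight:
  assumes "h \<in> cartan A"
  shows "upper b x \<Longrightarrow> Bracket (Gen_h h) x \<approx> Smult (wt b h) x"
proof (induction rule: upper.induct)
  case (upper_e i)
  show ?case unfolding wt_ev[OF upper_e] using assms upper_e by (rule tilde_eq.h_e)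
next
  case (upper_Zero b)
  have "Bracket (Gen_h h) Zero \<approx> Zero" using assms by (intro Bracket_Zero_right L_intros)
  also have "Zero \<approx> Smult (wt b h) Zero" by (rule tilde_eq.sym[OF Smult_Zero])
  finally show ?case .
next
  case (upper_Add b x y)
  note L = upper_terms[OF upper_Add.hyps(1)] upper_terms[OF upper_Add.hyps(2)]
  have "Bracket (Gen_h h) (Add x y) \<approx> Add (Bracket (Gen_h h) x) (Bracket (Gen_h h) y)"
    using assms L by (intro tilde_eq.Bracket_Add_right L_intros)
  also have "\<dots> \<approx> Add (Smult (wt b h) x) (Smult (wt b h) y)"
    by (intro tilde_eq.Add_cong upper_Add.IH)
  also have "\<dots> \<approx> Smult (wt b h) (Add x y)" using L by (intro tilde_eq.sym[OF tilde_eq.Smult_add_right])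
  finally show ?case .
next
  case (upper_Smult b x c)
  note L = upper_terms[OF upper_Smult.hyps]
  have "Bracket (Gen_h h) (Smult c x) \<approx> Smult c (Bracket (Gen_h h) x)"
    using assms L by (intro tilde_eq.Bracket_Smult_right L_intros)
  also have "\<dots> \<approx> Smult c (Smult (wt b h) x)" by (intro tilde_eq.Smult_cong upper_Smult.IH)
  also have "\<dots> \<approx> Smult (c * wt b h) x" using L by (intro tilde_eq.sym[OF tilde_eq.Smult_mult])
  also have "c * wt b h = wt b h * c" by simp
  also have "Smult (wt b h * c) x \<approx> Smult (wt b h) (Smult c x)" using L by (rule tilde_eq.Smult_mult)
  finally show ?case .
next
  case (upper_eq b x y)
  have "Bracket (Gen_h h) y \<approx> Bracket (Gen_h h) x"
    using assms upper_eq.hyps by (intro tilde_eq.Bracket_cong tilde_eq.refl tilde_eq.sym[OF upper_eq.hyps(2)] L_intros)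
  also have "\<dots> \<approx> Smult (wt b h) x" by (rule upper_eq.IH)
  also have "\<dots> \<approx> Smult (wt b h) y" using upper_eq.hyps by (intro tilde_eq.Smult_cong)
  finally show ?case .
next
  case (upper_Bracket i b x)
  note L = upper_terms[OF upper_Bracket.hyps(2)] L_intros(1)[OF upper_Bracket.hyps(1)] L_intros(3)[OF assms]
  let ?e = "Gen_e i" and ?h = "Gen_h h"
  have Lex: "Bracket ?e x \<in> L" using L by (intro lie_terms.intros(7))
  have "Bracket ?h (Bracket ?e x) \<approx> Add (Bracket (Bracket ?h ?e) x) (Bracket ?e (Bracket ?h x))"
    using L by (intro Bracket_derivation)
  also have "\<dots> \<approx> Add (Bracket (Smult (simple_root A i h) ?e) x) (Bracket ?e (Smult (wt b h) x))"
    using L assms upper_Bracket by (intro tilde_eq.Add_cong tilde_eq.Bracket_cong tilde_eq.refl tilde_eq.h_e)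
  also have "\<dots> \<approx> Add (Smult (simple_root A i h) (Bracket ?e x)) (Smult (wt b h) (Bracket ?e x))"
    using L by (intro tilde_eq.Add_cong tilde_eq.Bracket_Smult_left tilde_eq.Bracket_Smult_right)
  also have "\<dots> \<approx> Smult (simple_root A i h + wt b h) (Bracket ?e x)"
    using Lex by (rule tilde_eq.sym[OF tilde_eq.Smult_add_left])
  also have "simple_root A i h + wt b h = wt (b + ev i) h"
    using upper_Bracket.hyps(1) by (simp add: wt_add wt_ev)
  finally show ?case .
qed

lemma upper_vanish:
  "upper b x \<Longrightarrow> \<not> (nonneg b \<and> height (dim_row A) b \<ge> 1) \<Longrightarrow> x \<approx> Zero"
proof (induction rule: upper.induct)
  case (upper_e i)
  then show ?case using sum_mult_ev[of i "dim_row A" "\<lambda>_. 1"] by (simp add: height_def)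
next
  case (upper_Zero b)
  show ?case by (intro tilde_eq.refl L_intros)
next
  case (upper_Add b x y)
  have "Add x y \<approx> Add Zero Zero" using upper_Add by (intro tilde_eq.Add_cong)
  also have "\<dots> \<approx> Zero" by (intro tilde_eq.Add_Zero L_intros)
  finally show ?case .
next
  case (upper_Smult b x c)
  have "Smult c x \<approx> Smult c Zero" using upper_Smult by (intro tilde_eq.Smult_cong)
  also have "\<dots> \<approx> Zero" by (rule Smult_Zero)
  finally show ?case .
next
  case (upper_eq b x y)
  then show ?case by (meson tilde_eq.sym tilde_eq.trans)
next
  case (upper_Bracket i b x)
  have "height (dim_row A) (b + ev i) = height (dim_row A) b + 1"
    using upper_Bracket.hyps(1) sum_mult_ev[of i "dim_row A" "\<lambda>_. 1"] by (simp add: height_def sum.distrib)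
  moreover have "nonneg b \<Longrightarrow> nonneg (b + ev i)" by (simp add: nonneg_def ev_def)
  ultimately have "\<not> (nonneg b \<and> height (dim_row A) b \<ge> 1)" using upper_Bracket.prems by linarith
  then have "Bracket (Gen_e i) x \<approx> Bracket (Gen_e i) Zero"
    using upper_Bracket by (intro tilde_eq.Bracket_cong tilde_eq.refl L_intros)
  also have "\<dots> \<approx> Zero" using upper_Bracket.hyps(1) by (intro Bracket_Zero_right L_intros)
  finally show ?case .
qed

lemma upper_simple:
  assumes i: "i < dim_row A"
  shows "upper b x \<Longrightarrow> b = ev i \<Longrightarrow> \<exists>c. x \<approx> Smult c (Gen_e i)"
proof (induction rule: upper.induct)
  case (upper_e j)
  then show ?case using i by (intro exI[of _ 1]) (auto intro: tilde_eq.sym tilde_eq.Smult_one L_intros)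
next
  case (upper_Zero b)
  show ?case by (rule exI[of _ 0], rule tilde_eq.sym[OF Smult_0]) (intro L_intros i)
next
  case (upper_Add b x y)
  then obtain c d where "x \<approx> Smult c (Gen_e i)" "y \<approx> Smult d (Gen_e i)" by blast
  then have "Add x y \<approx> Add (Smult c (Gen_e i)) (Smult d (Gen_e i))" by (rule tilde_eq.Add_cong)
  also have "\<dots> \<approx> Smult (c + d) (Gen_e i)" by (intro tilde_eq.sym[OF tilde_eq.Smult_add_left] L_intros i)
  finally show ?case by blast
next
  case (upper_Smult b x c)
  then obtain d where "x \<approx> Smult d (Gen_e i)" by blast
  then have "Smult c x \<approx> Smult c (Smult d (Gen_e i))" by (rule tilde_eq.Smult_cong)
  also have "\<dots> \<approx> Smult (c * d) (Gen_e i)" by (intro tilde_eq.sym[OF tilde_eq.Smult_mult] L_intros i)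
  finally show ?case by blast
next
  case (upper_eq b x y)
  then show ?case by (meson tilde_eq.sym tilde_eq.trans)
next
  case (upper_Bracket j b x)
  then have "height (dim_row A) b + 1 = 1"
    using i sum_mult_ev[of i "dim_row A" "\<lambda>_. 1"] sum_mult_ev[of j "dim_row A" "\<lambda>_. 1"]
    by (metis (no_types, lifting) height_def plus_fun_apply sum.cong sum.distrib mult_1)
  then have "x \<approx> Zero" using upper_vanish[OF upper_Bracket.hyps(2)] by simp
  then have "Bracket (Gen_e j) x \<approx> Bracket (Gen_e j) Zero"
    using upper_Bracket by (intro tilde_eq.Bracket_cong tilde_eq.refl L_intros)
  also have "\<dots> \<approx> Zero" using upper_Bracket.hyps(1) by (intro Bracket_Zero_right L_intros)
  also have "Zero \<approx> Smult 0 (Gen_e i)" by (rule tilde_eq.sym[OF Smult_0]) (intro L_intros i)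
  finally show ?case by blast
qed

lemma Bracket_f_e:
  assumes "i < dim_row A" "j < dim_row A"
  shows "Bracket (Gen_f i) (Gen_e j) \<approx> (if i = j then neg (Gen_h (simple_coroot A i)) else Zero)"
proof -
  have "Bracket (Gen_f i) (Gen_e j) \<approx> neg (Bracket (Gen_e j) (Gen_f i))"
    using assms by (intro Bracket_antisym L_intros)
  also have "\<dots> \<approx> neg (if j = i then Gen_h (simple_coroot A j) else Zero)"
    using assms by (intro tilde_eq.Smult_cong tilde_eq.e_f)
  finally show ?thesis using Smult_Zero[of "-1"] by (auto intro: tilde_eq.trans)
qed

text \<open>Each exchange of f_i with a letter e_i leaves a scalar multiple of the remaining
  element. The weight \<alpha>_i is excluded because [f_i, e_i] lies in the Cartan
  subalgebra.\<close>

lemma upper_lower: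
  assumes i: "i < dim_row A"
  shows "upper b x \<Longrightarrow> b \<noteq> ev i \<Longrightarrow> upper (b - ev i) (Bracket (Gen_f i) x)"
proof (induction rule: upper.induct)
  case (upper_e j)
  then have "Bracket (Gen_f i) (Gen_e j) \<approx> Zero" using Bracket_f_e[OF i, of j] by auto
  then show ?case by (rule upper_eq[OF upper_Zero tilde_eq.sym])
next
  case (upper_Zero b)
  show ?case by (rule upper_eq[OF upper.upper_Zero tilde_eq.sym]) (intro Bracket_Zero_right L_intros i)
next
  case (upper_Add b x y)
  note L = upper_terms[OF upper_Add.hyps(1)] upper_terms[OF upper_Add.hyps(2)]
  show ?case
    by (rule upper_eq[OF upper.upper_Add tilde_eq.sym[OF tilde_eq.Bracket_Add_right]])
      (use upper_Add L i in \<open>auto intro: L_intros\<close>)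
next
  case (upper_Smult b x c)
  show ?case
    by (rule upper_eq[OF upper.upper_Smult tilde_eq.sym[OF tilde_eq.Bracket_Smult_right]])
      (use upper_Smult upper_terms[OF upper_Smult.hyps] i in \<open>auto intro: L_intros\<close>)
next
  case (upper_eq b x y)
  show ?case
    by (rule upper.upper_eq[OF upper_eq.IH[OF upper_eq.prems] tilde_eq.Bracket_cong])
      (use upper_eq i in \<open>auto intro: tilde_eq.refl L_intros\<close>)
next
  case (upper_Bracket j b x)
  let ?f = "Gen_f i" and ?e = "Gen_e j" and ?h = "Gen_h (simple_coroot A i)"
  note L = upper_terms[OF upper_Bracket.hyps(2)] L_intros(1)[OF upper_Bracket.hyps(1)] L_intros(2)[OF i]
    L_intros(3)[OF simple_coroot_cartan[OF i]]
  have eq: "Bracket ?f (Bracket ?e x) \<approx> Add (Bracket (Bracket ?f ?e) x) (Bracket ?e (Bracket ?f x))"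
    using L by (intro Bracket_derivation)
  have 1: "upper (b + ev j - ev i) (Bracket (Bracket ?f ?e) x)"
  proof (cases "i = j")
    case True
    have "Bracket (Bracket ?f ?e) x \<approx> Bracket (neg ?h) x"
      using Bracket_f_e[OF i upper_Bracket.hyps(1)] True L by (intro tilde_eq.Bracket_cong tilde_eq.refl) auto
    also have "\<dots> \<approx> neg (Bracket ?h x)" using L by (intro tilde_eq.Bracket_Smult_left)
    also have "\<dots> \<approx> neg (Smult (wt b (simple_coroot A i)) x)"
      by (intro tilde_eq.Smult_cong upper_weight simple_coroot_cartan i upper_Bracket.hyps)
    finally have "Bracket (Bracket ?f ?e) x \<approx> neg (Smult (wt b (simple_coroot A i)) x)" .
    moreover have "upper b (neg (Smult (wt b (simple_coroot A i)) x))"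
      using upper_Bracket.hyps by (intro upper_Smult)
    moreover have "b + ev j - ev i = b" using True by simp
    ultimately show ?thesis by (metis upper_eq tilde_eq.sym)
  next
    case False
    have "Bracket (Bracket ?f ?e) x \<approx> Bracket Zero x"
      using Bracket_f_e[OF i upper_Bracket.hyps(1)] False L by (intro tilde_eq.Bracket_cong tilde_eq.refl) auto
    also have "\<dots> \<approx> Zero" using L by (intro Bracket_Zero_left)
    finally show ?thesis by (rule upper_eq[OF upper_Zero tilde_eq.sym])
  qed
  have 2: "upper (b + ev j - ev i) (Bracket ?e (Bracket ?f x))"
  proof (cases "b = ev i")
    case True
    \<comment> \<open>Here [f_i, x] leaves the positive part, but bracketing e_j with a multiple of
      the simple coroot gives a multiple of e_j again.\<close>
    obtain c where c: "x \<approx> Smult c (Gen_e i)" using upper_simple[OF i upper_Bracket.hyps(2) True] by blast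
    have "Bracket ?f x \<approx> Bracket ?f (Smult c (Gen_e i))"
      using c L by (intro tilde_eq.Bracket_cong tilde_eq.refl)
    also have "\<dots> \<approx> Smult c (Bracket ?f (Gen_e i))" using L i by (intro tilde_eq.Bracket_Smult_right L_intros)
    also have "\<dots> \<approx> Smult c (neg ?h)" using Bracket_f_e[OF i i] by (intro tilde_eq.Smult_cong) simp
    also have "\<dots> \<approx> Smult (c * -1) ?h" using L by (intro tilde_eq.sym[OF tilde_eq.Smult_mult])
    finally have "Bracket ?e (Bracket ?f x) \<approx> Bracket ?e (Smult (c * -1) ?h)"
      using L by (intro tilde_eq.Bracket_cong tilde_eq.refl)
    also have "\<dots> \<approx> Smult (c * -1) (Bracket ?e ?h)" using L by (intro tilde_eq.Bracket_Smult_right)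
    also have "\<dots> \<approx> Smult (c * -1) (neg (Bracket ?h ?e))" using L by (intro tilde_eq.Smult_cong Bracket_antisym)
    also have "\<dots> \<approx> Smult (c * -1) (neg (Smult (simple_root A j (simple_coroot A i)) ?e))"
      using i upper_Bracket.hyps(1) by (intro tilde_eq.Smult_cong tilde_eq.h_e simple_coroot_cartan)
    finally have "Bracket ?e (Bracket ?f x) \<approx> Smult (c * -1) (neg (Smult (simple_root A j (simple_coroot A i)) ?e))" .
    moreover have "upper (ev j) (Smult (c * -1) (neg (Smult (simple_root A j (simple_coroot A i)) ?e)))"
      using upper_Bracket.hyps(1) by (intro upper_Smult upper_e)
    moreover have "b + ev j - ev i = ev j" using True by simp
    ultimately show ?thesis by (metis upper_eq tilde_eq.sym)
  next
    case False
    then have "upper (b - ev i + ev j) (Bracket ?e (Bracket ?f x))"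
      by (intro upper.upper_Bracket upper_Bracket.hyps(1) upper_Bracket.IH)
    moreover have "b - ev i + ev j = b + ev j - ev i" by simp
    ultimately show ?thesis by metis
  qed
  show ?case by (rule upper_eq[OF upper_Add[OF 1 2] tilde_eq.sym[OF eq]])
qed

end

lemma gcm_system_mat: "gcm A \<Longrightarrow> gcm_system (dim_row A) (\<lambda>i j. A $$ (i, j))"
  by unfold_locales (auto simp: gcm_def)

section \<open>Root vectors by the \<ss>\<ll>_2-argument\<close>

context
  fixes A :: "int mat"
begin

lemma Add_neg_cancel:
  assumes "u \<in> lie_terms A" "x \<in> lie_terms A"
  shows "tilde_eq A (Add (Smult (-1) u) (Add u x)) x"
proof -
  have "tilde_eq A (Add (Smult (-1) u) (Add u x)) (Add (Add (Smult (-1) u) u) x)"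
    using assms by (intro tilde_eq.sym[OF tilde_eq.Add_assoc] lie_terms.intros)
  also have "tilde_eq A \<dots> (Add Zero x)"
    by (intro tilde_eq.Add_cong neg_Add tilde_eq.refl assms)
  also have "tilde_eq A \<dots> x" using assms(2) by (rule Add_Zero_left)
  finally show ?thesis .
qed

lemma collect:
  assumes "u \<in> lie_terms A" "y \<in> lie_terms A"
  shows "tilde_eq A (Add (Smult s y) (Add u (Smult c y))) (Add u (Smult (c + s) y))"
proof -
  have "tilde_eq A (Add (Smult s y) (Add u (Smult c y))) (Add (Add u (Smult c y)) (Smult s y))"
    using assms by (intro tilde_eq.Add_commute lie_terms.intros)
  also have "tilde_eq A \<dots> (Add u (Add (Smult c y) (Smult s y)))"
    using assms by (intro tilde_eq.Add_assoc lie_terms.intros)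
  also have "tilde_eq A \<dots> (Add u (Smult (c + s) y))"
    by (intro tilde_eq.Add_cong tilde_eq.refl tilde_eq.sym[OF tilde_eq.Smult_add_left] assms)
  finally show ?thesis .
qed

abbreviation "ade i k \<equiv> (Bracket (Gen_e i) ^^ k)"
abbreviation "adf i k \<equiv> (Bracket (Gen_f i) ^^ k)"

lemma ade_upper:
  assumes "i < dim_row A" "upper A b x"
  shows "upper A (b + (\<lambda>l. int k * ev i l)) (ade i k x)"
proof (induction k)
  case 0
  have "b + (\<lambda>l. int 0 * ev i l) = b" by auto
  then show ?case using assms(2) by simp
next
  case (Suc k)
  have "upper A (b + (\<lambda>l. int k * ev i l) + ev i) (Bracket (Gen_e i) (ade i k x))"
    using assms(1) Suc by (rule upper.upper_Bracket)
  moreover have "b + (\<lambda>l. int k * ev i l) + ev i = b + (\<lambda>l. int (Suc k) * ev i l)"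
    by (auto simp: algebra_simps)
  ultimately show ?case by (metis funpow.simps(2) comp_apply)
qed

lemma wt_simple_coroot:
  assumes "gcm A" "i < dim_row A"
  shows "wt A b (simple_coroot A i) = of_int (gcm_system.pr (dim_row A) (\<lambda>i j. A $$ (i, j)) i b)"
proof -
  interpret gcm_system "dim_row A" "\<lambda>i j. A $$ (i, j)" using assms(1) by (rule gcm_system_mat)
  show ?thesis using assms(2)
    by (simp add: wt_def pr_def simple_root_simple_coroot mult.commute)
qed

text \<open>Each exchange of f_i with e_i leaves minus the coroot, which acts on the l-th power by
  \<mu> + 2 l, and the sum over l < k is k (\<mu> + k - 1). For k = 0 this coefficient is 0, so the
  truncated \<open>k - 1\<close> does no harm.\<close>

lemma adf_ade_commute:
  assumes A: "gcm A" and i: "i < dim_row A" and x: "upper A b x"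
    and mu: "wt A b (simple_coroot A i) = \<mu>" and Fx: "Bracket (Gen_f i) x \<in> lie_terms A"
  shows "tilde_eq A (Bracket (Gen_f i) (ade i k x))
    (Add (ade i k (Bracket (Gen_f i) x)) (Smult (- (of_nat k * (\<mu> + of_nat k - 1))) (ade i (k - 1) x)))"
proof (induction k)
  have L: "Gen_e i \<in> lie_terms A" "Gen_f i \<in> lie_terms A" "Gen_h (simple_coroot A i) \<in> lie_terms A"
    "x \<in> lie_terms A"
    using i x by (auto intro: lie_terms.intros simple_coroot_cartan upper_terms)
  have LE: "ade i k y \<in> lie_terms A" if "y \<in> lie_terms A" for k y
    using that by (induction k) (auto intro: lie_terms.intros L)
  case 0
  have "tilde_eq A (Bracket (Gen_f i) x) (Add (Bracket (Gen_f i) x) Zero)"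
    by (rule tilde_eq.sym[OF tilde_eq.Add_Zero[OF Fx]])
  also have "tilde_eq A \<dots> (Add (Bracket (Gen_f i) x) (Smult 0 x))"
    by (intro tilde_eq.Add_cong tilde_eq.refl Fx tilde_eq.sym[OF Smult_0] L)
  finally show ?case by simp
next
  case (Suc k)
  have L: "Gen_e i \<in> lie_terms A" "Gen_f i \<in> lie_terms A" "Gen_h (simple_coroot A i) \<in> lie_terms A"
    "x \<in> lie_terms A"
    using i x by (auto intro: lie_terms.intros simple_coroot_cartan upper_terms)
  have LE: "ade i k y \<in> lie_terms A" if "y \<in> lie_terms A" for k y
    using that by (induction k) (auto intro: lie_terms.intros L)
  define y u c s where "y = ade i k x" and "u = ade i k (Bracket (Gen_f i) x)"
    and "c = - (of_nat k * (\<mu> + of_nat k - 1))" and "s = - (\<mu> + 2 * of_nat k)"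
  have Ly: "y \<in> lie_terms A" "u \<in> lie_terms A" "ade i (k - 1) x \<in> lie_terms A"
    using LE L Fx by (auto simp: y_def u_def)
  note L = L Ly
  let ?e = "Gen_e i" and ?f = "Gen_f i" and ?h = "Gen_h (simple_coroot A i)"
  have "tilde_eq A (Bracket ?f (Bracket ?e y)) (Add (Bracket (Bracket ?f ?e) y) (Bracket ?e (Bracket ?f y)))"
    using L by (intro Bracket_derivation)
  also have "tilde_eq A \<dots> (Add (Smult s y) (Add (Bracket ?e u) (Smult c y)))"
  proof (rule tilde_eq.Add_cong)
    have wt: "wt A (b + (\<lambda>l. int k * ev i l)) (simple_coroot A i) = \<mu> + 2 * of_nat k"
    proof -
      interpret gcm_system "dim_row A" "\<lambda>i j. A $$ (i, j)" using A by (rule gcm_system_mat)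
      show ?thesis using i diag[OF i] by (simp add: wt_add mu)
        (simp add: wt_simple_coroot[OF A i] pr_scale)
    qed
    have "tilde_eq A (Bracket (Bracket ?f ?e) y) (Bracket (Smult (-1) ?h) y)"
      using Bracket_f_e[OF i i] L by (intro tilde_eq.Bracket_cong tilde_eq.refl) auto
    also have "tilde_eq A \<dots> (Smult (-1) (Bracket ?h y))" using L by (intro tilde_eq.Bracket_Smult_left)
    also have "tilde_eq A \<dots> (Smult (-1) (Smult (\<mu> + 2 * of_nat k) y))"
      using upper_weight[OF simple_coroot_cartan[OF i] ade_upper[OF i x, of k]] wt
      by (intro tilde_eq.Smult_cong) (simp add: y_def)
    also have "tilde_eq A \<dots> (Smult ((-1) * (\<mu> + 2 * of_nat k)) y)"
      using L by (intro tilde_eq.sym[OF tilde_eq.Smult_mult])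
    finally show "tilde_eq A (Bracket (Bracket ?f ?e) y) (Smult s y)" by (simp add: s_def)
    have "tilde_eq A (Bracket ?e (Bracket ?f y)) (Bracket ?e (Add u (Smult c (ade i (k - 1) x))))"
      using Suc.IH L by (intro tilde_eq.Bracket_cong tilde_eq.refl) (simp_all add: y_def u_def c_def)
    also have "tilde_eq A \<dots> (Add (Bracket ?e u) (Bracket ?e (Smult c (ade i (k - 1) x))))"
      by (intro tilde_eq.Bracket_Add_right L lie_terms.intros(6))
    also have "tilde_eq A \<dots> (Add (Bracket ?e u) (Smult c (Bracket ?e (ade i (k - 1) x))))"
      by (intro tilde_eq.Add_cong tilde_eq.refl tilde_eq.Bracket_Smult_right L lie_terms.intros(7))
    also have "tilde_eq A \<dots> (Add (Bracket ?e u) (Smult c y))"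
    proof (rule tilde_eq.Add_cong[OF tilde_eq.refl])
      show "Bracket ?e u \<in> lie_terms A" using L by (intro lie_terms.intros(7))
      show "tilde_eq A (Smult c (Bracket ?e (ade i (k - 1) x))) (Smult c y)"
      proof (cases k)
        case 0
        have "tilde_eq A (Smult 0 (Bracket ?e x)) (Smult 0 x)"
          using Smult_0[of "Bracket ?e x" A] Smult_0[of x A] L
          by (meson lie_terms.intros(7) tilde_eq.sym tilde_eq.trans)
        then show ?thesis using 0 by (simp add: c_def y_def)
      next
        case (Suc l)
        then show ?thesis using L by (intro tilde_eq.Smult_cong) (auto simp: y_def intro: tilde_eq.refl)
      qed
    qed
    finally show "tilde_eq A (Bracket ?e (Bracket ?f y)) (Add (Bracket ?e u) (Smult c y))" .
  qed
  also have "tilde_eq A \<dots> (Add (Bracket ?e u) (Smult (c + s) y))"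
    using L by (intro collect lie_terms.intros(7))
  also have "c + s = - (of_nat (Suc k) * (\<mu> + of_nat (Suc k) - 1))"
    by (simp add: c_def s_def algebra_simps)
  finally show ?case by (simp add: y_def u_def)
qed

lemma ideal_closed:
  assumes "lie_ideal A J"
  shows "x \<in> J \<Longrightarrow> x \<in> lie_terms A" "x \<in> J \<Longrightarrow> tilde_eq A x y \<Longrightarrow> y \<in> J"
    "x \<in> J \<Longrightarrow> y \<in> J \<Longrightarrow> Add x y \<in> J" "x \<in> J \<Longrightarrow> Smult c x \<in> J"
    "y \<in> lie_terms A \<Longrightarrow> x \<in> J \<Longrightarrow> Bracket y x \<in> J" "Zero \<in> J"
  using assms unfolding lie_ideal_def by blast+

lemma ideal_Add_right:
  assumes J: "lie_ideal A J" and "u \<in> J" "v \<in> J" "w \<in> lie_terms A" "tilde_eq A u (Add v w)"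
  shows "w \<in> J"
proof -
  have "Add (Smult (-1) v) (Add v w) \<in> J"
    using assms(2,3,5) ideal_closed[OF J] by blast
  then show ?thesis
    using Add_neg_cancel[of v w] ideal_closed[OF J] assms(3,4) by blast
qed

lemma ideal_Smult_cancel:
  assumes J: "lie_ideal A J" and "Smult c x \<in> J" "c \<noteq> 0" "x \<in> lie_terms A"
  shows "x \<in> J"
proof -
  have "Smult (1 / c) (Smult c x) \<in> J" using ideal_closed(4)[OF J] assms(2) .
  moreover have "tilde_eq A (Smult (1 / c) (Smult c x)) (Smult (1 / c * c) x)"
    using assms(4) by (rule tilde_eq.sym[OF tilde_eq.Smult_mult])
  moreover have "tilde_eq A (Smult (1 / c * c) x) x"
    using tilde_eq.Smult_one[OF assms(4)] assms(3) by simp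
  ultimately show ?thesis using ideal_closed(2)[OF J] by blast
qed

lemma ideal_Add_left:
  assumes J: "lie_ideal A J" and "u \<in> J" "w \<in> J" "v \<in> lie_terms A" "tilde_eq A u (Add v w)"
  shows "v \<in> J"
proof (rule ideal_Add_right[OF J assms(2,3,4)])
  show "tilde_eq A u (Add w v)"
    using assms ideal_closed(1)[OF J] by (blast intro: tilde_eq.trans tilde_eq.Add_commute)
qed

text \<open>The \<open>\<ss>\<ll>\<^sub>2\<close>-argument: \<open>e\<^sub>i\<^sup>m\<close> is injective on the vectors of \<open>\<alpha>\<^sub>i\<^sup>\<or>\<close>-weight \<open>- m\<close> on which \<open>f\<^sub>i\<close> is
  locally nilpotent. The coordinate \<open>b j > 0\<close> ensures that the weights stay away from \<open>\<int> \<alpha>\<^sub>i\<close>.\<close>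

lemma ade_injective:
  assumes A: "gcm A" and J: "lie_ideal A J" and i: "i < dim_row A" and ji: "j \<noteq> i"
  shows "upper A b x \<Longrightarrow> b j > 0 \<Longrightarrow> wt A b (simple_coroot A i) = - of_nat m \<Longrightarrow>
    adf i p x \<in> J \<Longrightarrow> ade i m x \<in> J \<Longrightarrow> x \<in> J"
proof (induction p arbitrary: b x m)
  case (Suc p)
  define y where "y = Bracket (Gen_f i) x"
  have Le: "Gen_e i \<in> lie_terms A" and Lf: "Gen_f i \<in> lie_terms A" using i by (auto intro: lie_terms.intros)
  have Lx: "x \<in> lie_terms A" using Suc.prems(1) by (rule upper_terms)
  have Ly: "y \<in> lie_terms A" unfolding y_def using Lf Lx by (rule lie_terms.intros(7))
  have LE: "ade i k z \<in> lie_terms A" if "z \<in> lie_terms A" for k z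
    using that by (induction k) (auto intro: lie_terms.intros(7) Le)
  have JE: "ade i k z \<in> J" if "z \<in> J" for k z
    using that by (induction k) (auto intro: ideal_closed(5)[OF J] Le)
  have "b \<noteq> ev i" using Suc.prems(2) ji by auto
  then have yu: "upper A (b - ev i) y" unfolding y_def by (rule upper_lower[OF i Suc.prems(1)])
  have ywt: "wt A (b - ev i) (simple_coroot A i) = - of_nat (m + 2)"
  proof -
    interpret gcm_system "dim_row A" "\<lambda>i j. A $$ (i, j)" using A by (rule gcm_system_mat)
    show ?thesis using Suc.prems(3) i diag[OF i]
      by (simp add: wt_simple_coroot[OF A i] pr_diff)
  qed
  note comm = adf_ade_commute[OF A i Suc.prems(1,3) Ly[unfolded y_def], folded y_def]
  have up: "ade i (m + l) x \<in> J" for l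
    using JE[OF Suc.prems(5), of l] by (simp add: add.commute[of m] funpow_add)
  \<comment> \<open>\<open>y\<close> has weight -(m + 2), so the induction hypothesis calls for the
    power m + 2.\<close>
  have "ade i (m + 2) y \<in> J"
  proof (rule ideal_Add_left[OF J _ _ _ comm])
    show "Bracket (Gen_f i) (ade i (m + 2) x) \<in> J" by (rule ideal_closed(5)[OF J Lf up])
    show "Smult (- (of_nat (m + 2) * (- of_nat m + of_nat (m + 2) - 1))) (ade i (m + 2 - 1) x) \<in> J"
      using up[of 1] by (intro ideal_closed(4)[OF J]) simp
  qed (rule LE[OF Ly])
  moreover have "(b - ev i) j > 0" using Suc.prems(2) ji by simp
  moreover have "adf i p y \<in> J" using Suc.prems(4) by (simp add: y_def funpow_swap1)
  ultimately have yJ: "y \<in> J" using Suc.IH[OF yu _ ywt] by blast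
  \<comment> \<open>Modulo \<open>J\<close> the vector \<open>y\<close> is 0, so f_i applied to
    e_i^k x gives k (m - k + 1) e_i^(k - 1) x, with nonzero factor for 1 \<le> k \<le> m. This leads
    down from e_i^m x to \<open>x\<close>.\<close>
  have "ade i (m - l) x \<in> J" if "l \<le> m" for l
    using that
  proof (induction l)
    case 0
    then show ?case using Suc.prems(5) by simp
  next
    case (Suc l)
    define k where "k = m - l"
    have k: "k \<ge> 1" "k \<le> m" "m - Suc l = k - 1" using Suc.prems by (auto simp: k_def)
    have "Smult (- (of_nat k * (- of_nat m + of_nat k - 1))) (ade i (k - 1) x) \<in> J"
    proof (rule ideal_Add_right[OF J _ _ _ comm])
      show "Bracket (Gen_f i) (ade i k x) \<in> J"
        using Suc by (intro ideal_closed(5)[OF J Lf]) (simp add: k_def)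
      show "ade i k y \<in> J" by (rule JE[OF yJ])
      show "Smult (- (of_nat k * (- of_nat m + of_nat k - 1))) (ade i (k - 1) x) \<in> lie_terms A"
        by (intro lie_terms.intros(6) LE Lx)
    qed
    moreover have "- (of_nat k * (- of_nat m + of_nat k - 1)) \<noteq> (0 :: complex)"
    proof -
      have "- (of_nat k * (- of_nat m + of_nat k - 1)) = (of_int (int k * (int m - int k + 1)) :: complex)"
        by (simp add: algebra_simps)
      moreover have "int k * (int m - int k + 1) \<noteq> 0" using k by simp
      ultimately show ?thesis by (metis of_int_eq_0_iff)
    qed
    ultimately show ?case unfolding k(3) by (rule ideal_Smult_cancel[OF J _ _ LE[OF Lx]])
  qed
  from this[of m] show ?case by simp
qed simp

text \<open>Nonzero in the Kac-Moody algebra. The condition is put on each ideal separately, so that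
  arguments work within one ideal instead of the union.\<close>

definition essential :: "lie_term \<Rightarrow> bool" where
  "essential x \<longleftrightarrow> (\<forall>J. lie_ideal A J \<and> (\<forall>h\<in>cartan A. Gen_h h \<in> J \<longrightarrow> tilde_eq A (Gen_h h) Zero) \<longrightarrow> x \<notin> J)"

lemma Gen_e_essential:
  assumes i: "i < dim_row A"
  shows "essential (Gen_e i)"
  unfolding essential_def
proof (intro allI impI notI)
  fix J assume *: "lie_ideal A J \<and> (\<forall>h\<in>cartan A. Gen_h h \<in> J \<longrightarrow> tilde_eq A (Gen_h h) Zero)" and e: "Gen_e i \<in> J"
  then have J: "lie_ideal A J" by blast
  let ?h = "Gen_h (simple_coroot A i)"
  have "Bracket (Gen_f i) (Gen_e i) \<in> J" using e i by (intro ideal_closed(5)[OF J] lie_terms.intros)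
  then have "Smult (-1) ?h \<in> J" using Bracket_f_e[OF i i] ideal_closed(2)[OF J] by simp
  then have "?h \<in> J"
    by (rule ideal_Smult_cancel[OF J]) (auto intro: lie_terms.intros simple_coroot_cartan i)
  then show False using * simple_coroot_nonzero[OF i] simple_coroot_cartan[OF i] by blast
qed

text \<open>A root vector for r_i b arises by applying e_i exactly -pr i b times;
  \<open>ade_injective\<close> keeps it outside every admissible ideal.\<close>

lemma ascending_upper:
  assumes A: "gcm A"
    and "b \<in> gcm_system.asc (dim_row A) (\<lambda>i j. A $$ (i, j))"
  shows "\<exists>x. upper A b x \<and> essential x"
proof -
  interpret gcm_system "dim_row A" "\<lambda>i j. A $$ (i, j)" using A by (rule gcm_system_mat)
  from assms(2) show ?thesis
  proof induction
    case (asc_simple i)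
    then show ?case using upper_e Gen_e_essential by blast
  next
    case (asc_refl b i)
    then obtain x where x: "upper A b x" "essential x" by blast
    define m where "m = nat (- pr i b)"
    have m: "pr i b = - int m" using asc_refl.hyps(3) by (simp add: m_def)
    note b = asc_props[OF asc_refl.hyps(1)]
    have "\<exists>j. j \<noteq> i \<and> b j > 0"
    proof (rule ccontr)
      assume "\<not> ?thesis"
      then have "b j = b i * ev i j" for j
        using nonnegD[OF b(1), of j] by (cases "j = i") (auto simp: not_less)
      then have "b = (\<lambda>j. b i * ev i j)" by (rule ext)
      then have "pr i b = b i * 2" using asc_refl.hyps(2) by (metis pr_scale pr_ev diag)
      then show False using asc_refl.hyps(3) nonnegD[OF b(1), of i] by simp
    qed
    then obtain j where j: "j \<noteq> i" "b j > 0" by blast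
    \<comment> \<open>b - p \<alpha>_i has a negative coordinate at \<open>i\<close>, so f_i^p kills
      \<open>x\<close>.\<close>
    define p where "p = Suc (nat (b i))"
    have low: "upper A (b - (\<lambda>l. int k * ev i l)) (adf i k x)" for k
    proof (induction k)
      case 0
      have "b - (\<lambda>l. int 0 * ev i l) = b" by auto
      then show ?case using x by simp
    next
      case (Suc k)
      have "(b - (\<lambda>l. int k * ev i l)) j \<noteq> ev i j" using j by simp
      then have "b - (\<lambda>l. int k * ev i l) \<noteq> ev i" by metis
      then have "upper A (b - (\<lambda>l. int k * ev i l) - ev i) (Bracket (Gen_f i) (adf i k x))"
        using upper_lower[OF asc_refl.hyps(2) Suc] by blast
      moreover have "b - (\<lambda>l. int k * ev i l) - ev i = b - (\<lambda>l. int (Suc k) * ev i l)"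
        by (auto simp: algebra_simps)
      ultimately show ?case by (metis funpow.simps(2) comp_apply)
    qed
    have "(b - (\<lambda>l. int p * ev i l)) i < 0" using nonnegD[OF b(1), of i] by (simp add: p_def)
    then have "\<not> nonneg (b - (\<lambda>l. int p * ev i l))" by (metis nonnegD not_less)
    then have nil: "tilde_eq A (adf i p x) Zero" using upper_vanish[OF low[of p]] by blast
    have "essential (ade i m x)"
      unfolding essential_def
    proof (intro allI impI notI)
      fix J assume *: "lie_ideal A J \<and> (\<forall>h\<in>cartan A. Gen_h h \<in> J \<longrightarrow> tilde_eq A (Gen_h h) Zero)"
        and e: "ade i m x \<in> J"
      then have J: "lie_ideal A J" by blast
      have "adf i p x \<in> J" using ideal_closed(2,6)[OF J] tilde_eq.sym[OF nil] by blast
      then have "x \<in> J"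
        using ade_injective[OF A J asc_refl.hyps(2) j(1) x(1) j(2), of m p] e m
        by (simp add: wt_simple_coroot[OF A asc_refl.hyps(2)])
      then show False using x(2) * by (auto simp: essential_def)
    qed
    moreover have "b + (\<lambda>l. int m * ev i l) = refl i b" using m by (auto simp: refl_eq)
    ultimately show ?case using ade_upper[OF asc_refl.hyps(2) x(1), of m] by metis
  qed
qed

lemma lie_ideal_Zero: "lie_ideal A {x. tilde_eq A x Zero}"
  unfolding lie_ideal_def
proof (intro conjI ballI allI impI subsetI)
  fix x y c
  assume x: "x \<in> {x. tilde_eq A x Zero}"
  show "x \<in> lie_terms A" using x teqD by auto
  show "y \<in> {x. tilde_eq A x Zero}" if "tilde_eq A x y"
    using x that by (auto intro: tilde_eq.trans tilde_eq.sym)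
  show "Add x y \<in> {x. tilde_eq A x Zero}" if "y \<in> {x. tilde_eq A x Zero}"
    using tilde_eq.Add_cong[of A x Zero y Zero] tilde_eq.Add_Zero[of Zero A] x that
    by (auto intro: tilde_eq.trans lie_terms.intros)
  show "Smult c x \<in> {x. tilde_eq A x Zero}"
    using tilde_eq.Smult_cong[of A x Zero c] Smult_Zero[of A c] x by (auto intro: tilde_eq.trans)
next
  fix x y assume "x \<in> lie_terms A" "y \<in> {x. tilde_eq A x Zero}"
  then show "Bracket x y \<in> {x. tilde_eq A x Zero}"
    using tilde_eq.Bracket_cong[of A x x y Zero] Bracket_Zero_right[of x A]
    by (auto intro: tilde_eq.trans tilde_eq.refl)
qed (auto intro: tilde_eq.refl lie_terms.intros)

lemma ascending_root:
  assumes A: "gcm A" and b: "b \<in> gcm_system.asc (dim_row A) (\<lambda>i j. A $$ (i, j))"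
  shows "vec (dim_row A) b \<in> roots A"
proof -
  interpret gcm_system "dim_row A" "\<lambda>i j. A $$ (i, j)" using A by (rule gcm_system_mat)
  obtain x where x: "upper A b x" "essential x" using ascending_upper[OF A b] by blast
  have Lx: "x \<in> lie_terms A" using x(1) by (rule upper_terms)
  obtain k where k: "b k \<noteq> 0" using asc_props(3)[OF b] by (metis ext zero_fun_apply)
  then have "k < dim_row A" using asc_props(2)[OF b] by (meson not_le supportedD)
  then have nz: "vec (dim_row A) b \<noteq> 0\<^sub>v (dim_row A)" using k by (metis index_vec index_zero_vec(1))
  have "x \<in> root_space A (vec (dim_row A) b)"
    unfolding root_space_def
  proof (intro CollectI conjI ballI Lx)
    fix h assume h: "h \<in> cartan A"
    let ?u = "Bracket (Gen_h h) x" and ?v = "Smult (wt A b h) x"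
    have Lu: "?u \<in> lie_terms A" "?v \<in> lie_terms A" using h Lx by (auto intro: lie_terms.intros)
    have "functional A (vec (dim_row A) b) h = wt A b h"
      by (simp add: functional_def wt_def)
    moreover have "tilde_eq A (Add ?u (Smult (-1) ?v)) Zero"
    proof -
      have "tilde_eq A (Add ?u (Smult (-1) ?v)) (Add ?v (Smult (-1) ?v))"
        by (rule tilde_eq.Add_cong[OF upper_weight[OF h x(1)] tilde_eq.refl])
          (intro lie_terms.intros(6) Lx)
      also have "tilde_eq A \<dots> Zero" using Lu(2) by (rule tilde_eq.Add_neg)
      finally show ?thesis .
    qed
    then have "Add ?u (Smult (-1) ?v) \<in> max_ideal A"
      unfolding max_ideal_def using lie_ideal_Zero by blast
    ultimately show "km_eq A ?u (Smult (functional A (vec (dim_row A) b) h) x)"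
      using Lu by (simp add: km_eq_def)
  qed
  moreover have "\<not> km_eq A x Zero"
  proof
    assume "km_eq A x Zero"
    then obtain J where J: "lie_ideal A J" "\<forall>h\<in>cartan A. Gen_h h \<in> J \<longrightarrow> tilde_eq A (Gen_h h) Zero"
      "Add x (Smult (-1) Zero) \<in> J"
      by (auto simp: km_eq_def max_ideal_def)
    have "tilde_eq A (Add x (Smult (-1) Zero)) (Add x Zero)"
      by (rule tilde_eq.Add_cong[OF tilde_eq.refl[OF Lx] Smult_Zero])
    also have "tilde_eq A \<dots> x" using Lx by (rule tilde_eq.Add_Zero)
    finally have "x \<in> J" using J(3) ideal_closed(2)[OF J(1)] by blast
    then show False using x(2) J by (auto simp: essential_def)
  qed
  ultimately show ?thesis using nz by (auto simp: roots_def)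
qed

end

section \<open>Untwisted affine diagrams\<close>

text \<open>The negative of the off-diagonal part of row \<open>i\<close> of A \<delta>, read off
  the edge list; for a null vector it equals 2 \<delta>_i.\<close>

definition row_sum :: "edge list \<Rightarrow> (nat \<Rightarrow> int) \<Rightarrow> nat \<Rightarrow> int" where
  "row_sum es \<delta> i = (\<Sum>(k,l,p,q)\<leftarrow>es. (if k = i then p * \<delta> l else 0) + (if l = i then q * \<delta> k else 0))"

lemma row_sum_simps [simp]:
  "row_sum [] \<delta> i = 0"
  "row_sum ((k, l, p, q) # es) \<delta> i
    = (if k = i then p * \<delta> l else 0) + (if l = i then q * \<delta> k else 0) + row_sum es \<delta> i"
  "row_sum (es @ es') \<delta> i = row_sum es \<delta> i + row_sum es' \<delta> i"
  by (simp_all add: row_sum_def)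

lemma chain_Suc: "a \<le> b \<Longrightarrow> chain a (Suc b) = chain a b @ [(b, Suc b, 1, 1)]"
  by (simp add: chain_def)

lemma row_sum_chain:
  assumes "a \<le> b"
  shows "row_sum (chain a b) \<delta> i
    = (if a \<le> i \<and> i < b then \<delta> (Suc i) else 0) + (if a < i \<and> i \<le> b then \<delta> (i - 1) else 0)"
  using assms
proof (induction b rule: dec_induct)
  case (step b)
  then show ?case by (auto simp: chain_Suc)
qed (simp add: chain_def)

lemma ball_chain: "(\<forall>e\<in>set (chain a b). P e) \<longleftrightarrow> (\<forall>i. a \<le> i \<and> i < b \<longrightarrow> P (i, Suc i, 1, 1))"
  by (auto simp: chain_def)

lemma chain_connected:
  assumes "\<forall>i. a \<le> i \<and> i < b \<longrightarrow> (i \<in> S \<longleftrightarrow> Suc i \<in> S)" "a \<le> i" "i \<le> b"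
  shows "i \<in> S \<longleftrightarrow> a \<in> S"
  using assms(2,3)
proof (induction i rule: dec_induct)
  case (step i)
  then show ?case using assms(1) by auto
qed simp

text \<open>\<open>\<delta>\<close> are the marks of the affine diagram and \<open>D\<close> is the symmetrizer with \<open>D i = (\<alpha>\<^sub>i, \<alpha>\<^sub>i) / 2\<close>.\<close>

definition affine_data :: "nat \<Rightarrow> edge list \<Rightarrow> (nat \<Rightarrow> int) \<Rightarrow> (nat \<Rightarrow> int) \<Rightarrow> bool" where
  "affine_data n es \<delta> D \<longleftrightarrow> 0 < n \<and> \<delta> 0 = 1 \<and>
     (\<forall>i<n. \<delta> i > 0 \<and> D i > 0) \<and> (\<forall>i<n. \<forall>j<n. D i dvd D j * \<delta> j) \<and>
     (\<forall>(k,l,p,q)\<in>set es. k < n \<and> l < n \<and> k \<noteq> l \<and> p > 0 \<and> q > 0 \<and> D k * p = D l * q) \<and>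
     (\<forall>i<n. row_sum es \<delta> i = 2 * \<delta> i) \<and>
     (\<forall>S. (\<forall>(k,l,p,q)\<in>set es. k \<in> S \<longleftrightarrow> l \<in> S) \<longrightarrow> (\<forall>i<n. i \<in> S \<longleftrightarrow> 0 \<in> S))"

lemma affine_dataI:
  assumes "0 < n" "\<delta> 0 = 1" "\<And>i. i < n \<Longrightarrow> \<delta> i > 0" "\<And>i. i < n \<Longrightarrow> D i > 0"
    and "\<And>i j. i < n \<Longrightarrow> j < n \<Longrightarrow> D i dvd D j * \<delta> j"
    and "\<forall>(k,l,p,q)\<in>set es. k < n \<and> l < n \<and> k \<noteq> l \<and> p > 0 \<and> q > 0 \<and> D k * p = D l * q"
    and "\<And>i. i < n \<Longrightarrow> row_sum es \<delta> i = 2 * \<delta> i"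
    and "\<And>S i. \<forall>(k,l,p,q)\<in>set es. k \<in> S \<longleftrightarrow> l \<in> S \<Longrightarrow> i < n \<Longrightarrow> i \<in> S \<longleftrightarrow> 0 \<in> S"
  shows "affine_data n es \<delta> D"
  unfolding affine_data_def by (intro conjI allI impI assms)

lemma all_less_Suc: "(\<forall>i<Suc n. P i) \<longleftrightarrow> P n \<and> (\<forall>i<n. P i)"
  by (auto simp: less_Suc_eq)

lemma all_less_numeral: "(\<forall>i<numeral k. P i) \<longleftrightarrow> P (pred_numeral k) \<and> (\<forall>i<pred_numeral k. P i)"
  by (simp add: numeral_eq_Suc all_less_Suc)

lemmas unroll = affine_data_def all_less_numeral all_less_Suc chain_def upt_rec

lemma untwisted_affine_data:
  assumes "(n, es) \<in> untwisted_affine_diagrams"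
  shows "\<exists>\<delta> D. affine_data n es \<delta> D"
  using assms
proof cases
  case A1
  have "affine_data n es (\<lambda>_. 1) (\<lambda>_. 1)" by (simp add: A1 unroll)
  then show ?thesis by (intro exI)
next
  case (A l)
  have "affine_data n es (\<lambda>_. 1) (\<lambda>_. 1)"
  proof (rule affine_dataI)
    fix S i
    assume e: "\<forall>(k,l,p,q)\<in>set es. k \<in> S \<longleftrightarrow> l \<in> S" and "i < n"
    show "i \<in> S \<longleftrightarrow> 0 \<in> S"
      by (rule chain_connected[of 0 l]) (use e \<open>i < n\<close> A in \<open>simp_all add: ball_chain ball_Un\<close>)
  qed (use A in \<open>auto simp: ball_chain ball_Un row_sum_chain\<close>)
  then show ?thesis by (intro exI)
next
  case (B l)
  have "affine_data n es (\<lambda>i. if i \<le> 1 then 1 else 2) (\<lambda>i. if i < l then 2 else 1)"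
  proof (rule affine_dataI)
    fix S i
    assume e: "\<forall>(k,l,p,q)\<in>set es. k \<in> S \<longleftrightarrow> l \<in> S" and "i < n"
    have *: "0 \<in> S \<longleftrightarrow> 2 \<in> S" "l - 1 \<in> S \<longleftrightarrow> l \<in> S" "\<forall>i. 1 \<le> i \<and> i < l - 1 \<longrightarrow> (i \<in> S \<longleftrightarrow> Suc i \<in> S)"
      using e by (simp_all add: B ball_chain ball_Un)
    have c: "k \<in> S \<longleftrightarrow> 1 \<in> S" if "1 \<le> k" "k \<le> l - 1" for k
      using chain_connected[OF *(3) that] .
    have cs: "2 \<in> S \<longleftrightarrow> 1 \<in> S" "l - 1 \<in> S \<longleftrightarrow> 1 \<in> S" by (rule c; use B in simp)+
    from \<open>i < n\<close> consider "i = 0" | "i = l" | "1 \<le> i" "i \<le> l - 1" using B by linarith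
    then show "i \<in> S \<longleftrightarrow> 0 \<in> S"
    proof cases
      case 1
      then show ?thesis by simp
    next
      case 2
      then show ?thesis using cs *(1,2) by metis
    next
      case 3
      then show ?thesis using c[of i] cs *(1,2) by metis
    qed
  next
    fix i assume "i < n"
    \<comment> \<open>Writing l = m + 3 removes the subtractions. For m = 0 the branch vertex 2 is
      also the end of the chain, so the case i = m + 2 is stated for m > 0.\<close>
    obtain m where "l = 3 + m" using le_Suc_ex[of 3 l] B by auto
    then have m: "l = m + 3" by simp
    consider "i = 0" | "i = 1" | "i = 2" | "3 \<le> i" "i \<le> m + 1" | "i = m + 2" "m > 0" | "i = m + 3"
      using \<open>i < n\<close>[unfolded B(1) m] by linarith
    then show "row_sum es (\<lambda>i. if i \<le> 1 then 1 else 2) i = 2 * (\<lambda>i. if i \<le> 1 then 1 else 2) i"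
      unfolding B(2) m by cases (auto simp: row_sum_chain)
  next
    show "\<forall>(k,l',p,q)\<in>set es. k < n \<and> l' < n \<and> k \<noteq> l' \<and> p > 0 \<and> q > 0 \<and> (\<lambda>i. if i < l then 2 else 1) k * p = (\<lambda>i. if i < l then 2 else 1) l' * q"
      using B by (auto simp: ball_chain ball_Un)
  qed (use B in auto)
  then show ?thesis by (intro exI)
next
  case (C l)
  have "affine_data n es (\<lambda>i. if i = 0 \<or> i = l then 1 else 2) (\<lambda>i. if i = 0 \<or> i = l then 2 else 1)"
  proof (rule affine_dataI)
    fix S i
    assume e: "\<forall>(k,l,p,q)\<in>set es. k \<in> S \<longleftrightarrow> l \<in> S" and "i < n"
    have *: "0 \<in> S \<longleftrightarrow> 1 \<in> S" "l - 1 \<in> S \<longleftrightarrow> l \<in> S" "\<forall>i. 1 \<le> i \<and> i < l - 1 \<longrightarrow> (i \<in> S \<longleftrightarrow> Suc i \<in> S)"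
      using e by (simp_all add: C ball_chain ball_Un)
    have c: "k \<in> S \<longleftrightarrow> 1 \<in> S" if "1 \<le> k" "k \<le> l - 1" for k
      using chain_connected[OF *(3) that] .
    have cs: "l - 1 \<in> S \<longleftrightarrow> 1 \<in> S" by (rule c; use C in simp)+
    from \<open>i < n\<close> consider "i = 0" | "i = l" | "1 \<le> i" "i \<le> l - 1" using C by linarith
    then show "i \<in> S \<longleftrightarrow> 0 \<in> S"
    proof cases
      case 1
      then show ?thesis by simp
    next
      case 2
      then show ?thesis using cs *(1,2) by metis
    next
      case 3
      then show ?thesis using c[of i] cs *(1,2) by metis
    qed
  next
    fix i assume "i < n"
    obtain m where "l = 2 + m" using le_Suc_ex[of 2 l] C by auto
    then have m: "l = m + 2" by simp
    consider "i = 0" | "i = 1" | "2 \<le> i" "i \<le> m" | "i = m + 1" "m > 0" | "i = m + 2"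
      using \<open>i < n\<close>[unfolded C(1) m] by linarith
    then show "row_sum es (\<lambda>i. if i = 0 \<or> i = l then 1 else 2) i = 2 * (\<lambda>i. if i = 0 \<or> i = l then 1 else 2) i"
      unfolding C(2) m by cases (auto simp: row_sum_chain)
  next
    show "\<forall>(k,l',p,q)\<in>set es. k < n \<and> l' < n \<and> k \<noteq> l' \<and> p > 0 \<and> q > 0 \<and> (\<lambda>i. if i = 0 \<or> i = l then 2 else 1) k * p = (\<lambda>i. if i = 0 \<or> i = l then 2 else 1) l' * q"
      using C by (auto simp: ball_chain ball_Un)
  qed (use C in auto)
  then show ?thesis by (intro exI)
next
  case (D l)
  have "affine_data n es (\<lambda>i. if i \<le> 1 \<or> i \<ge> l - 1 then 1 else 2) (\<lambda>_. 1)"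
  proof (rule affine_dataI)
    fix S i
    assume e: "\<forall>(k,l,p,q)\<in>set es. k \<in> S \<longleftrightarrow> l \<in> S" and "i < n"
    have *: "0 \<in> S \<longleftrightarrow> 2 \<in> S" "l - 2 \<in> S \<longleftrightarrow> l \<in> S" "\<forall>i. 1 \<le> i \<and> i < l - 1 \<longrightarrow> (i \<in> S \<longleftrightarrow> Suc i \<in> S)"
      using e by (simp_all add: D ball_chain ball_Un)
    have c: "k \<in> S \<longleftrightarrow> 1 \<in> S" if "1 \<le> k" "k \<le> l - 1" for k
      using chain_connected[OF *(3) that] .
    have cs: "2 \<in> S \<longleftrightarrow> 1 \<in> S" "l - 2 \<in> S \<longleftrightarrow> 1 \<in> S" by (rule c; use D in simp)+
    from \<open>i < n\<close> consider "i = 0" | "i = l" | "1 \<le> i" "i \<le> l - 1" using D by linarith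
    then show "i \<in> S \<longleftrightarrow> 0 \<in> S"
    proof cases
      case 1
      then show ?thesis by simp
    next
      case 2
      then show ?thesis using cs *(1,2) by metis
    next
      case 3
      then show ?thesis using c[of i] cs *(1,2) by metis
    qed
  next
    fix i assume "i < n"
    obtain m where "l = 4 + m" using le_Suc_ex[of 4 l] D by auto
    then have m: "l = m + 4" by simp
    consider "i = 0" | "i = 1" | "i = 2" | "3 \<le> i" "i \<le> m + 1" | "i = m + 2" "m > 0" | "i = m + 3" | "i = m + 4"
      using \<open>i < n\<close>[unfolded D(1) m] by linarith
    then show "row_sum es (\<lambda>i. if i \<le> 1 \<or> i \<ge> l - 1 then 1 else 2) i = 2 * (\<lambda>i. if i \<le> 1 \<or> i \<ge> l - 1 then 1 else 2) i"
      unfolding D(2) m by cases (auto simp: row_sum_chain)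
  next
    show "\<forall>(k,l',p,q)\<in>set es. k < n \<and> l' < n \<and> k \<noteq> l' \<and> p > 0 \<and> q > 0 \<and> (\<lambda>_. 1) k * p = (\<lambda>_. 1) l' * q"
      using D by (auto simp: ball_chain ball_Un)
  qed (use D in auto)
  then show ?thesis by (intro exI)
next
  case E6
  have "affine_data n es (\<lambda>i. [1, 2, 3, 2, 1, 2, 1] ! i) (\<lambda>_. 1)"
    by (simp add: E6 unroll, simp add: eval_nat_numeral, blast?)
  then show ?thesis by (intro exI)
next
  case E7
  have "affine_data n es (\<lambda>i. [1, 2, 3, 4, 3, 2, 1, 2] ! i) (\<lambda>_. 1)"
    by (simp add: E7 unroll, simp add: eval_nat_numeral, blast?)
  then show ?thesis by (intro exI)
next
  case E8
  have "affine_data n es (\<lambda>i. [1, 2, 3, 4, 5, 6, 4, 2, 3] ! i) (\<lambda>_. 1)"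
    by (simp add: E8 unroll, simp add: eval_nat_numeral, blast?)
  then show ?thesis by (intro exI)
next
  case F4
  have "affine_data n es (\<lambda>i. [1, 2, 3, 4, 2] ! i) (\<lambda>i. [2, 2, 2, 1, 1] ! i)"
    by (simp add: F4 unroll, simp add: eval_nat_numeral, blast?)
  then show ?thesis by (intro exI)
next
  case G2
  have "affine_data n es (\<lambda>i. [1, 2, 3] ! i) (\<lambda>i. [3, 3, 1] ! i)"
    by (simp add: G2 unroll)
  then show ?thesis by (intro exI)
qed

definition edge_weight :: "edge list \<Rightarrow> nat \<Rightarrow> nat \<Rightarrow> int" where
  "edge_weight es i j = (\<Sum>(k,l,p,q)\<leftarrow>es. if (k,l) = (i,j) then p else if (k,l) = (j,i) then q else 0)"

lemma diagram_mat_eq: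
  "i < n \<Longrightarrow> j < n \<Longrightarrow> diagram_mat n es $$ (i, j) = (if i = j then 2 else - edge_weight es i j)"
  by (simp add: diagram_mat_def edge_weight_def)

lemma edge_weight_symmetrized:
  assumes "\<forall>(k,l,p,q)\<in>set es. D k * p = D l * q" "i \<noteq> j"
  shows "D i * edge_weight es i j = D j * (edge_weight es j i :: int)"
  using assms by (induction es) (auto simp: edge_weight_def algebra_simps)

lemma edge_weight_row_sum:
  assumes "\<forall>(k,l,p,q)\<in>set es. k < n \<and> l < n \<and> k \<noteq> l" "i < n"
  shows "(\<Sum>j\<in>{..<n} - {i}. edge_weight es i j * \<delta> j) = row_sum es \<delta> i"
  using assms(1)
proof (induction es)
  case (Cons e es)
  obtain k l p q where e: "e = (k, l, p, q)" by (metis prod_cases4)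
  have kl: "k < n" "l < n" "k \<noteq> l" using Cons.prems by (auto simp: e)
  define w where "w j = (if (k,l) = (i,j) then p else if (k,l) = (j,i) then q else 0)" for j
  have "(\<Sum>j\<in>{..<n} - {i}. w j * \<delta> j)
      = (\<Sum>j\<in>{..<n} - {i}. (if j = l then (if k = i then p * \<delta> l else 0) else 0)
          + (if j = k then (if l = i then q * \<delta> k else 0) else 0))"
    using kl by (intro sum.cong) (auto simp: w_def)
  also have "\<dots> = (if k = i then p * \<delta> l else 0) + (if l = i then q * \<delta> k else 0)"
    using kl by (auto simp: sum.distrib)
  finally have w: "(\<Sum>j\<in>{..<n} - {i}. w j * \<delta> j) = (if k = i then p * \<delta> l else 0) + (if l = i then q * \<delta> k else 0)" .
  have "edge_weight (e # es) i j = w j + edge_weight es i j" for j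
    by (simp add: edge_weight_def e w_def)
  then have "(\<Sum>j\<in>{..<n} - {i}. edge_weight (e # es) i j * \<delta> j)
      = (\<Sum>j\<in>{..<n} - {i}. w j * \<delta> j) + (\<Sum>j\<in>{..<n} - {i}. edge_weight es i j * \<delta> j)"
    by (simp add: distrib_right sum.distrib)
  also have "\<dots> = row_sum (e # es) \<delta> i" using Cons w by (simp add: e)
  finally show ?case .
qed (simp add: edge_weight_def)

lemma edge_weight_nonneg:
  assumes "\<forall>(k,l,p,q)\<in>set es. p > 0 \<and> q > 0"
  shows "edge_weight es i j \<ge> 0"
  unfolding edge_weight_def using assms by (intro sum_list_nonneg) (auto simp: less_imp_le)

lemma edge_weight_pos:
  assumes "\<forall>(k,l,p,q)\<in>set es. p > 0 \<and> q > 0" "(k, l, p, q) \<in> set es"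
  shows "edge_weight es k l > 0" "edge_weight es l k > 0"
proof -
  obtain xs ys where es: "es = xs @ (k, l, p, q) # ys" using assms(2) by (meson split_list)
  have "edge_weight xs i j \<ge> 0" "edge_weight ys i j \<ge> 0" for i j
    using assms(1) edge_weight_nonneg[of xs] edge_weight_nonneg[of ys] by (simp_all add: es ball_Un)
  moreover have "p > 0" "q > 0" using assms by auto
  moreover have "edge_weight es i j
      = edge_weight xs i j + (if (k,l) = (i,j) then p else if (k,l) = (j,i) then q else 0) + edge_weight ys i j" for i j
    by (simp add: es edge_weight_def)
  ultimately show "edge_weight es k l > 0" "edge_weight es l k > 0"
    by (simp_all add: add_nonneg_pos add_pos_nonneg)
qed

lemma untwisted_affine_type_gcm:
  assumes A: "gcm A" and "untwisted_affine_type A"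
  shows "\<exists>D \<delta> o'. untwisted_gcm (dim_row A) (\<lambda>i j. A $$ (i, j)) D \<delta> o'"
proof -
  obtain n es where es: "(n, es) \<in> untwisted_affine_diagrams" "permutation_equivalent A (diagram_mat n es)"
    using assms(2) by (auto simp: untwisted_affine_type_def)
  obtain \<delta> D where ad: "affine_data n es \<delta> D" using untwisted_affine_data[OF es(1)] by blast
  have d1: "0 < n" "\<delta> 0 = 1" and c2: "\<forall>i<n. \<delta> i > 0 \<and> D i > 0"
    and c3: "\<forall>i<n. \<forall>j<n. D i dvd D j * \<delta> j"
    and d4: "\<forall>(k,l,p,q)\<in>set es. k < n \<and> l < n \<and> k \<noteq> l \<and> p > 0 \<and> q > 0 \<and> D k * p = D l * q"
    and c5: "\<forall>i<n. row_sum es \<delta> i = 2 * \<delta> i"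
    and c6: "\<forall>S. (\<forall>(k,l,p,q)\<in>set es. k \<in> S \<longleftrightarrow> l \<in> S) \<longrightarrow> (\<forall>i<n. i \<in> S \<longleftrightarrow> 0 \<in> S)"
    using ad unfolding affine_data_def by - (elim conjE, assumption)+
  note d2 = c2[rule_format, THEN conjunct1] c2[rule_format, THEN conjunct2]
    and d3 = c3[rule_format] and d5 = c5[rule_format]
    and d6 = c6[THEN spec, THEN mp, THEN spec, THEN mp]
  obtain p where p: "p permutes {..<n}" and Ap: "A = mat n n (\<lambda>(i,j). diagram_mat n es $$ (p i, p j))"
    using es(2) by (auto simp: permutation_equivalent_def diagram_mat_def)
  have n: "dim_row A = n" using Ap by simp
  have pn: "p i < n \<longleftrightarrow> i < n" for i using permutes_in_image[OF p, of i] by simp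
  have pinj: "p i = p j \<longleftrightarrow> i = j" for i j using permutes_inj[OF p] by (auto simp: inj_eq)
  have Aij: "A $$ (i, j) = (if i = j then 2 else - edge_weight es (p i) (p j))" if "i < n" "j < n" for i j
    using that by (simp add: Ap diagram_mat_eq pn pinj)
  \<comment> \<open>The vertex that the permutation sends to 0, a vertex of mark 1 in every
    diagram.\<close>
  define o' where "o' = inv_into UNIV p 0"
  have po: "p o' = 0" using permutes_inverses(1)[OF p] by (simp add: o'_def)
  then have on: "o' < n" using pn[of o'] d1 by simp
  define \<delta>' where "\<delta>' i = (if i < n then \<delta> (p i) else 0)" for i
  interpret gcm_system n "\<lambda>i j. A $$ (i, j)" using gcm_system_mat[OF A] by (simp add: n)
  have "untwisted_gcm n (\<lambda>i j. A $$ (i, j)) (\<lambda>i. D (p i)) \<delta>' o'"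
  proof unfold_locales
    show "D (p i) > 0" if "i < n" for i using d2 pn that by blast
    show "\<delta>' i > 0" if "i < n" for i using d2 pn that by (simp add: \<delta>'_def)
    show "supported n \<delta>'" by (simp add: supported_def \<delta>'_def)
    show "o' < n" by (rule on)
    show "\<delta>' o' = 1" using d1 on po by (simp add: \<delta>'_def)
    show "D (p i) dvd D (p j) * \<delta>' j" if "i < n" "j < n" for i j
      using d3 pn that by (simp add: \<delta>'_def)
    show "D (p i) * A $$ (i, j) = D (p j) * A $$ (j, i)" if ij: "i < n" "j < n" for i j
    proof (cases "i = j")
      case False
      have "\<forall>(k,l,p,q)\<in>set es. D k * p = D l * q" using d4 by auto
      then have "D (p i) * edge_weight es (p i) (p j) = D (p j) * edge_weight es (p j) (p i)"
        by (rule edge_weight_symmetrized) (simp add: pinj False)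
      then show ?thesis using ij False by (simp add: Aij)
    qed simp
    show "pr i \<delta>' = 0" if i: "i < n" for i
    proof -
      have "pr i \<delta>' = 2 * \<delta> (p i) + (\<Sum>j\<in>{..<n} - {i}. - edge_weight es (p i) (p j) * \<delta> (p j))"
        unfolding pr_def using i by (subst sum.remove[of _ i]) (auto simp: Aij \<delta>'_def intro!: sum.cong)
      also have "(\<Sum>j\<in>{..<n} - {i}. - edge_weight es (p i) (p j) * \<delta> (p j))
          = (\<Sum>j\<in>p ` ({..<n} - {i}). - edge_weight es (p i) j * \<delta> j)"
        by (subst sum.reindex) (auto simp: inj_on_def pinj)
      also have "p ` ({..<n} - {i}) = {..<n} - {p i}"
        using permutes_image[OF p] permutes_inj[OF p] by (simp add: image_set_diff)
      also have "(\<Sum>j\<in>{..<n} - {p i}. - edge_weight es (p i) j * \<delta> j) = - row_sum es \<delta> (p i)"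
      proof -
        have "\<forall>(k,l,p,q)\<in>set es. k < n \<and> l < n \<and> k \<noteq> l" using d4 by auto
        then show ?thesis using edge_weight_row_sum[of es n "p i" \<delta>] i pn by (simp add: sum_negf)
      qed
      finally show ?thesis using d5 i pn by simp
    qed
    show "connected_matrix n (\<lambda>i j. A $$ (i, j))"
      unfolding connected_matrix_def
    proof (intro allI impI, rule ccontr)
      fix S assume S: "S \<subset> {..<n}" "S \<noteq> {}" "\<not> (\<exists>i\<in>S. \<exists>j\<in>{..<n} - S. A $$ (i, j) \<noteq> 0)"
      have pos: "\<forall>(k,l,p,q)\<in>set es. p > 0 \<and> q > 0" using d4 by auto
      have "\<forall>(k,l,a,b)\<in>set es. k \<in> p ` S \<longleftrightarrow> l \<in> p ` S"
      proof (rule ballI, clarify)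
        fix k l a b assume e: "(k, l, a, b) \<in> set es"
        then have kl: "k < n" "l < n" "k \<noteq> l" using d4 by auto
        obtain i j where ij: "k = p i" "l = p j" "i < n" "j < n"
          using kl permutes_surj[OF p] pn by (metis surjD)
        have "i \<noteq> j" using kl ij by auto
        have "A $$ (i, j) \<noteq> 0" "A $$ (j, i) \<noteq> 0"
          using edge_weight_pos[OF pos e] ij \<open>i \<noteq> j\<close> by (simp_all add: Aij)
        then have "i \<in> S \<longleftrightarrow> j \<in> S" using S(3) ij by blast
        then show "k \<in> p ` S \<longleftrightarrow> l \<in> p ` S" using permutes_inj[OF p] by (simp add: ij inj_image_mem_iff)
      qed
      then have all: "\<forall>i<n. i \<in> p ` S \<longleftrightarrow> 0 \<in> p ` S" using d6 by blast
      obtain s t where st: "s \<in> S" "t < n" "t \<notin> S" using S(1,2) by auto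
      have "s < n" using st S(1) by auto
      then have "p s < n" "p t < n" using pn st(2) by simp_all
      then have "p s \<in> p ` S \<longleftrightarrow> p t \<in> p ` S"
        using all[rule_format, of "p s"] all[rule_format, of "p t"] by simp
      then show False using st permutes_inj[OF p] by (simp add: inj_image_mem_iff)
    qed
  qed
  then show ?thesis unfolding n by blast
qed

section \<open>Transfer to Kac-Moody algebras\<close>

definition vfun :: "int vec \<Rightarrow> nat \<Rightarrow> int" where
  "vfun v = (\<lambda>k. if k < dim_vec v then v $ k else 0)"

lemma vfun_unit_vec: "i < n \<Longrightarrow> vfun (unit_vec n i) = ev i"
  by (auto simp: vfun_def ev_def)

lemma mult_mat_vec_vfun:
  assumes "gcm A" "b \<in> carrier_vec (dim_row A)" "i < dim_row A"
  shows "(A *\<^sub>v b) $ i = gcm_system.pr (dim_row A) (\<lambda>i j. A $$ (i, j)) i (vfun b)"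
proof -
  interpret gcm_system "dim_row A" "\<lambda>i j. A $$ (i, j)" using assms(1) by (rule gcm_system_mat)
  show ?thesis
    using assms by (auto simp: pr_def vfun_def scalar_prod_def gcm_def atLeast0LessThan intro!: sum.cong)
qed

lemma reflect_carrier: "b \<in> carrier_vec (dim_row A) \<Longrightarrow> reflect A i b \<in> carrier_vec (dim_row A)"
  by (simp add: reflect_def)

lemma vfun_reflect:
  assumes "gcm A" "b \<in> carrier_vec (dim_row A)" "i < dim_row A"
  shows "vfun (reflect A i b) = gcm_system.refl (dim_row A) (\<lambda>i j. A $$ (i, j)) i (vfun b)"
proof -
  interpret gcm_system "dim_row A" "\<lambda>i j. A $$ (i, j)" using assms(1) by (rule gcm_system_mat)
  have "reflect A i b $ k = (if k = i then b $ i - pr i (vfun b) else b $ k)" if "k < dim_row A" for k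
    unfolding reflect_def mult_mat_vec_vfun[OF assms] using that assms(2,3) by auto
  then show ?thesis
    using assms(2,3) reflect_carrier[OF assms(2), of i] by (auto simp: refl_def vfun_def[of b] vfun_def[of "reflect A i b"])
qed

lemma coreflect_carrier: "c \<in> carrier_vec (dim_row A) \<Longrightarrow> coreflect A i c \<in> carrier_vec (dim_row A)"
  by (simp add: coreflect_def)

text \<open>Reflections of roots and coroots are intertwined by D_i c_k = D_k b_k. As 2 D_i is the
  norm of \<open>b\<close>, this determines \<open>c\<close> from \<open>b\<close>, which makes
  \<open>coroot\<close> well defined.\<close>

lemma reflected_root:
  assumes A: "gcm A" and D: "sym_gcm (dim_row A) (\<lambda>i j. A $$ (i, j)) D"
    and w: "set w \<subseteq> {..<dim_row A}" and i: "i < dim_row A"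
  defines "b \<equiv> foldr (reflect A) w (unit_vec (dim_row A) i)"
    and "c \<equiv> foldr (coreflect A) w (unit_vec (dim_row A) i)"
  shows "b \<in> carrier_vec (dim_row A)" "c \<in> carrier_vec (dim_row A)"
    "vfun b \<in> gcm_system.rts (dim_row A) (\<lambda>i j. A $$ (i, j))"
    "sym_gcm.form (dim_row A) (\<lambda>i j. A $$ (i, j)) D (vfun b) (vfun b) = 2 * D i"
    "\<And>k. k < dim_row A \<Longrightarrow> D i * c $ k = D k * b $ k"
proof -
  interpret sym_gcm "dim_row A" "\<lambda>i j. A $$ (i, j)" D by (rule D)
  have "b \<in> carrier_vec (dim_row A) \<and> c \<in> carrier_vec (dim_row A) \<and> vfun b \<in> rts
      \<and> form (vfun b) (vfun b) = 2 * D i \<and> (\<forall>k<dim_row A. D i * c $ k = D k * b $ k)"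
    unfolding b_def c_def using w
  proof (induction w)
    case Nil
    show ?case using i by (auto simp: vfun_unit_vec rts_simple diag)
  next
    case (Cons j w)
    define b c where "b = foldr (reflect A) w (unit_vec (dim_row A) i)"
      and "c = foldr (coreflect A) w (unit_vec (dim_row A) i)"
    have IH: "b \<in> carrier_vec (dim_row A)" "c \<in> carrier_vec (dim_row A)" "vfun b \<in> rts"
      "form (vfun b) (vfun b) = 2 * D i" "\<And>k. k < dim_row A \<Longrightarrow> D i * c $ k = D k * b $ k"
      and j: "j < dim_row A"
      using Cons by (auto simp: b_def c_def)
    have vr: "vfun (reflect A j b) = refl j (vfun b)" by (rule vfun_reflect[OF A IH(1) j])
    have "D i * (transpose_mat A *\<^sub>v c) $ j = (\<Sum>k<dim_row A. A $$ (k, j) * (D i * c $ k))"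
      using A IH(2) j by (simp add: scalar_prod_def gcm_def atLeast0LessThan sum_distrib_left algebra_simps)
    also have "\<dots> = (\<Sum>k<dim_row A. D j * (A $$ (j, k) * vfun b k))"
    proof (rule sum.cong)
      fix k assume k: "k \<in> {..<dim_row A}"
      then have "D k * A $$ (k, j) = D j * A $$ (j, k)" using D_sym[of k j] j by simp
      moreover have "vfun b k = b $ k" using IH(1) k by (simp add: vfun_def)
      ultimately show "A $$ (k, j) * (D i * c $ k) = D j * (A $$ (j, k) * vfun b k)"
        using IH(5)[of k] k by (simp add: algebra_simps)
    qed simp
    also have "\<dots> = D j * (A *\<^sub>v b) $ j"
      by (simp add: mult_mat_vec_vfun[OF A IH(1) j] pr_def sum_distrib_left)
    finally have T: "D i * (transpose_mat A *\<^sub>v c) $ j = D j * (A *\<^sub>v b) $ j" .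
    have "D i * coreflect A j c $ k = D k * reflect A j b $ k" if "k < dim_row A" for k
      using IH(1,2) IH(5)[OF that] T that j
      by (cases "k = j") (simp_all add: reflect_def coreflect_def right_diff_distrib)
    moreover have "refl j (vfun b) \<in> rts" using IH(3) j by (rule rts_refl)
    moreover have "form (refl j (vfun b)) (refl j (vfun b)) = 2 * D i" using IH(4) j by (simp add: form_refl)
    ultimately have "reflect A j b \<in> carrier_vec (dim_row A) \<and> coreflect A j c \<in> carrier_vec (dim_row A)
      \<and> vfun (reflect A j b) \<in> rts \<and> form (vfun (reflect A j b)) (vfun (reflect A j b)) = 2 * D i
      \<and> (\<forall>k<dim_row A. D i * coreflect A j c $ k = D k * reflect A j b $ k)"
      using IH(1,2) reflect_carrier coreflect_carrier by (simp only: vr) blast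
    then show ?case by (simp add: b_def c_def)
  qed
  then show "b \<in> carrier_vec (dim_row A)" "c \<in> carrier_vec (dim_row A)" "vfun b \<in> rts"
    "form (vfun b) (vfun b) = 2 * D i" "\<And>k. k < dim_row A \<Longrightarrow> D i * c $ k = D k * b $ k"
    by blast+
qed

lemma pairing_coroot:
  assumes A: "gcm A" and D: "sym_gcm (dim_row A) (\<lambda>i j. A $$ (i, j)) D"
    and b: "b \<in> real_roots A" and y: "y \<in> carrier_vec (dim_row A)"
  shows "2 * sym_gcm.form (dim_row A) (\<lambda>i j. A $$ (i, j)) D (vfun b) (vfun y)
    = sym_gcm.form (dim_row A) (\<lambda>i j. A $$ (i, j)) D (vfun b) (vfun b) * pairing A (coroot A b) y"
proof -
  interpret sym_gcm "dim_row A" "\<lambda>i j. A $$ (i, j)" D by (rule D)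
  obtain w i where wi: "set w \<subseteq> {..<dim_row A}" "i < dim_row A"
    and bw: "b = foldr (reflect A) w (unit_vec (dim_row A) i)"
    using b by (auto simp: real_roots_def)
  define c where "c = foldr (coreflect A) w (unit_vec (dim_row A) i)"
  note r = reflected_root[OF A D wi, folded bw c_def]
  have "coroot A b = c"
    unfolding coroot_def
  proof (rule the_equality)
    show "\<exists>w i. set w \<subseteq> {..<dim_row A} \<and> i < dim_row A \<and>
      b = foldr (reflect A) w (unit_vec (dim_row A) i) \<and> c = foldr (coreflect A) w (unit_vec (dim_row A) i)"
      using wi bw c_def by blast
    fix c'
    assume "\<exists>w i. set w \<subseteq> {..<dim_row A} \<and> i < dim_row A \<and>
      b = foldr (reflect A) w (unit_vec (dim_row A) i) \<and> c' = foldr (coreflect A) w (unit_vec (dim_row A) i)"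
    then obtain w' i' where wi': "set w' \<subseteq> {..<dim_row A}" "i' < dim_row A"
      and bw': "b = foldr (reflect A) w' (unit_vec (dim_row A) i')"
      and c': "c' = foldr (coreflect A) w' (unit_vec (dim_row A) i')" by blast
    note r' = reflected_root[OF A D wi', folded bw' c']
    have "D i' = D i" using r(4) r'(4) by simp
    then have "D i * c' $ k = D i * c $ k" if "k < dim_row A" for k using r(5)[OF that] r'(5)[OF that] by simp
    then show "c' = c" using r(2) r'(2) D_pos[OF wi(2)] by (intro eq_vecI) auto
  qed
  have Ay: "A *\<^sub>v y \<in> carrier_vec (dim_row A)" by (rule carrier_vecI) simp
  have "D i * pairing A (coroot A b) y = (\<Sum>k<dim_row A. D i * c $ k * (A *\<^sub>v y) $ k)"
    unfolding \<open>coroot A b = c\<close> pairing_def using r(2) Ay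
    by (simp add: scalar_prod_def atLeast0LessThan sum_distrib_left mult.assoc)
  also have "\<dots> = (\<Sum>k<dim_row A. D k * vfun b k * pr k (vfun y))"
    using r(1,5) mult_mat_vec_vfun[OF A y] by (intro sum.cong) (auto simp: vfun_def)
  also have "\<dots> = form (vfun b) (vfun y)" by (simp add: form_def)
  finally show ?thesis by (simp add: r(4))
qed

lemma real_root_carrier:
  assumes "gcm A" "b \<in> real_roots A"
  shows "b \<in> carrier_vec (dim_row A)"
proof -
  have "foldr (reflect A) w (unit_vec (dim_row A) i) \<in> carrier_vec (dim_row A)" for w i
    by (induction w) (auto intro: reflect_carrier)
  then show ?thesis using assms(2) by (auto simp: real_roots_def)
qed

lemma pi_system_root_embedding:
  assumes A: "gcm A" and D: "sym_gcm (dim_row A) (\<lambda>i j. A $$ (i, j)) D" and B: "gcm B"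
    and bs: "pi_system A bs" "lin_independent A bs" "pi_type A bs = B"
  shows "root_embedding (dim_row A) (\<lambda>i j. A $$ (i, j)) D (dim_row B) (\<lambda>i j. B $$ (i, j)) (\<lambda>j. vfun (bs ! j))"
proof -
  interpret A: sym_gcm "dim_row A" "\<lambda>i j. A $$ (i, j)" D by (rule D)
  interpret B: gcm_system "dim_row B" "\<lambda>i j. B $$ (i, j)" using B by (rule gcm_system_mat)
  have len: "dim_row B = length bs" using bs(3) by (auto simp: pi_type_def)
  have real: "bs ! j \<in> real_roots A" if "j < length bs" for j
    using bs(1) that by (auto simp: pi_system_def)
  note carrier = real_root_carrier[OF A real]
  show ?thesis
  proof unfold_locales
    show "vfun (bs ! j) \<in> A.rts" if "j < dim_row B" for j
      using real[of j] that reflected_root(3)[OF A D] by (auto simp: real_roots_def len)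
    show "2 * A.form (vfun (bs ! i)) (vfun (bs ! j)) = A.form (vfun (bs ! i)) (vfun (bs ! i)) * B $$ (i, j)"
      if "i < dim_row B" "j < dim_row B" for i j
      using pairing_coroot[OF A D real carrier, of i j] that by (simp add: len bs(3)[symmetric] pi_type_def)
    show "x = 0" if x: "supported (dim_row B) x" "lc (dim_row B) (\<lambda>j. vfun (bs ! j)) x = 0" for x
    proof -
      \<comment> \<open>An integral relation between coordinate vectors is a relation between the
        functionals, to which complex independence applies.\<close>
      have "(\<Sum>i<length bs. of_int (x i) * functional A (bs ! i) h) = 0" for h
      proof -
        have "(\<Sum>i<length bs. of_int (x i) * functional A (bs ! i) h)
            = (\<Sum>i<length bs. \<Sum>k<dim_row A. of_int (x i * vfun (bs ! i) k) * simple_root A k h)"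
          unfolding functional_def sum_distrib_left
        proof (intro sum.cong HOL.refl)
          fix i k assume ik: "i \<in> {..<length bs}" "k \<in> {..<dim_row A}"
          then have "vfun (bs ! i) k = bs ! i $ k" using carrier[of i] by (simp add: vfun_def)
          then show "of_int (x i) * (of_int (bs ! i $ k) * simple_root A k h)
            = of_int (x i * vfun (bs ! i) k) * simple_root A k h" by simp
        qed
        also have "\<dots> = (\<Sum>k<dim_row A. of_int (lc (dim_row B) (\<lambda>j. vfun (bs ! j)) x k) * simple_root A k h)"
          by (subst sum.swap) (simp add: lc_def len sum_distrib_right)
        finally show ?thesis using x(2) by simp
      qed
      then have "\<forall>i<length bs. complex_of_int (x i) = 0"
        using bs(2)[unfolded lin_independent_def, THEN spec, of "\<lambda>i. of_int (x i)"] by blast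
      then show "x = 0" using x(1) by (auto simp: fun_eq_iff supported_def len) (metis not_le)
    qed
  qed
qed

lemma common_denominator:
  fixes d :: "nat \<Rightarrow> rat"
  shows "\<exists>N>0. \<forall>i<n. \<exists>z. of_int N * d i = of_int z"
proof (induction n)
  case 0
  show ?case by (intro exI[of _ 1]) simp
next
  case (Suc n)
  then obtain N where N: "N > 0" "\<forall>i<n. \<exists>z. of_int N * d i = of_int z" by blast
  obtain p q where pq: "quotient_of (d n) = (p, q)" by (metis surj_pair)
  have q: "q > 0" "d n = of_int p / of_int q"
    using quotient_of_denom_pos[OF pq] quotient_of_div[OF pq] by auto
  have "\<exists>z. of_int (N * q) * d i = of_int z" if "i < Suc n" for i
  proof (cases "i = n")
    case True
    then have "of_int (N * q) * d i = of_int (N * p)" using q by simp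
    then show ?thesis by blast
  next
    case False
    then have "i < n" using that by simp
    then obtain z where "of_int N * d i = of_int z" using N(2) by blast
    then have "of_int (N * q) * d i = of_int (z * q)" by (simp add: mult.commute mult.left_commute)
    then show ?thesis by blast
  qed
  then show ?case using N(1) q(1) by (intro exI[of _ "N * q"]) simp
qed

lemma symmetrizable_sym_gcm:
  assumes A: "gcm A" and "symmetrizable A"
  shows "\<exists>D. sym_gcm (dim_row A) (\<lambda>i j. A $$ (i, j)) D"
proof -
  interpret gcm_system "dim_row A" "\<lambda>i j. A $$ (i, j)" using A by (rule gcm_system_mat)
  define n where "n = dim_row A"
  have dc: "dim_col A = n" using A by (simp add: gcm_def n_def)
  obtain E :: "rat mat" where E: "E \<in> carrier_mat n n" "diagonal_mat E" "\<forall>i<n. E $$ (i,i) > 0"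
    "transpose_mat (E * map_mat rat_of_int A) = E * map_mat rat_of_int A"
    using assms(2) by (auto simp: symmetrizable_def n_def)
  have prod: "(E * map_mat rat_of_int A) $$ (i, j) = E $$ (i, i) * of_int (A $$ (i, j))"
    if "i < n" "j < n" for i j
  proof -
    have "(E * map_mat rat_of_int A) $$ (i, j) = (\<Sum>k<n. E $$ (i, k) * of_int (A $$ (k, j)))"
      using that E(1) dc by (simp add: scalar_prod_def atLeast0LessThan n_def)
    also have "\<dots> = (\<Sum>k<n. if k = i then E $$ (i, i) * of_int (A $$ (i, j)) else 0)"
      using that E(1,2) by (intro sum.cong) (auto simp: diagonal_mat_def)
    finally show ?thesis using that by simp
  qed
  have sym: "E $$ (i, i) * of_int (A $$ (i, j)) = E $$ (j, j) * of_int (A $$ (j, i))" if "i < n" "j < n" for i j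
  proof -
    have "transpose_mat (E * map_mat rat_of_int A) $$ (i, j) = (E * map_mat rat_of_int A) $$ (j, i)"
      using that E(1) dc by simp
    then show ?thesis using E(4) prod[OF that] prod[OF that(2,1)] by simp
  qed
  obtain N z where N: "N > 0" "\<And>i. i < n \<Longrightarrow> of_int N * E $$ (i, i) = of_int (z i)"
    using common_denominator[of n "\<lambda>i. E $$ (i, i)"] by metis
  have "sym_gcm n (\<lambda>i j. A $$ (i, j)) z"
  proof (intro sym_gcm.intro sym_gcm_axioms.intro)
    show "gcm_system n (\<lambda>i j. A $$ (i, j))" using gcm_system_axioms by (simp add: n_def)
    show "z i > 0" if "i < n" for i
    proof -
      have "of_int (z i) > (0 :: rat)" using N E(3) that by (metis mult_pos_pos of_int_0_less_iff)
      then show ?thesis by simp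
    qed
    show "z i * A $$ (i, j) = z j * A $$ (j, i)" if "i < n" "j < n" for i j
    proof -
      have "rat_of_int (z i * A $$ (i, j)) = rat_of_int (z j * A $$ (j, i))"
        using sym[OF that] by (simp add: N(2)[OF that(1), symmetric] N(2)[OF that(2), symmetric] mult.assoc)
      then show ?thesis by (simp only: of_int_eq_iff)
    qed
  qed
  then show ?thesis by (auto simp: n_def)
qed

lemma real_mat_mult_index:
  assumes "dim_col A = dim_row A" "v \<in> carrier_vec (dim_row A)" "i < dim_row A"
  shows "(real_mat A *\<^sub>v v) $ i = (\<Sum>j<dim_row A. real_of_int (A $$ (i, j)) * v $ j)"
  using assms by (simp add: scalar_prod_def atLeast0LessThan)

lemma indecomposable_connected:
  assumes A: "gcm A" and "indecomposable A"
  shows "connected_matrix (dim_row A) (\<lambda>i j. A $$ (i, j))"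
  unfolding connected_matrix_def
proof (intro allI impI)
  interpret gcm_system "dim_row A" "\<lambda>i j. A $$ (i, j)" using A by (rule gcm_system_mat)
  fix S assume S: "S \<subset> {..<dim_row A}" "S \<noteq> {}"
  then obtain i j where ij: "i \<in> S" "j \<in> {..<dim_row A} - S" "\<not> (A $$ (i, j) = 0 \<and> A $$ (j, i) = 0)"
    using assms(2) unfolding indecomposable_def by blast
  then have "A $$ (i, j) \<noteq> 0" using zero_sym[of j i] S(1) by auto
  then show "\<exists>i\<in>S. \<exists>j\<in>{..<dim_row A} - S. A $$ (i, j) \<noteq> 0" using ij by blast
qed

lemma pick_bij_betw:
  assumes "finite S"
  shows "bij_betw (pick S) {..<card S} S"
proof (rule bij_betw_imageI)
  show inj: "inj_on (pick S) {..<card S}"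
    by (rule inj_onI) (metis lessThan_iff less_irrefl nat_neq_iff pick_mono_le)
  have "pick S ` {..<card S} \<subseteq> S" using pick_in_set_le by blast
  then show "pick S ` {..<card S} = S" using assms inj by (intro card_subset_eq) (simp_all add: card_image)
qed

text \<open>A connected subdiagram has such a vector by (Fin) or (Aff). A disconnected one splits
  into two smaller parts without edges between them, and their vectors are put together.\<close>

lemma hyperbolic_subdiagram:
  assumes A: "hyperbolic_type A"
  shows "S \<subset> {..<dim_row A} \<Longrightarrow>
    \<exists>u. (\<forall>i\<in>S. u i > (0::real)) \<and> (\<forall>i\<in>S. (\<Sum>j\<in>S. real_of_int (A $$ (i, j)) * u j) \<ge> 0)"
proof (induction "card S" arbitrary: S rule: less_induct)
  case less
  have gA: "gcm A" using A by (simp add: hyperbolic_type_def indefinite_type_def)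
  have dc: "dim_col A = dim_row A" using gA by (simp add: gcm_def)
  interpret gcm_system "dim_row A" "\<lambda>i j. A $$ (i, j)" using gA by (rule gcm_system_mat)
  have fin: "finite S" using less.prems finite_subset by blast
  define C where "C = submatrix A S S"
  have S_eq: "{i. i < dim_row A \<and> i \<in> S} = S" "{i. i < dim_col A \<and> i \<in> S} = S"
    using less.prems dc by auto
  have dimC: "dim_row C = card S" "dim_col C = card S"
    by (simp_all add: C_def dim_submatrix S_eq)
  have Cij: "C $$ (s, t) = A $$ (pick S s, pick S t)" if "s < card S" "t < card S" for s t
    unfolding C_def by (rule submatrix_index) (use that S_eq in simp_all)
  note bij = pick_bij_betw[OF fin]
  show ?case
  proof (cases "S = {}")
    case False
    show ?thesis
    proof (cases "indecomposable C")
      case True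
      then have "finite_type C \<or> affine_type C"
        using A False less.prems by (auto simp: hyperbolic_type_def C_def)
      then have "\<exists>v\<in>carrier_vec (card S). pos_vec v \<and> (\<forall>s<card S. (real_mat C *\<^sub>v v) $ s \<ge> 0)"
      proof
        assume "finite_type C"
        then obtain v where v: "v \<in> carrier_vec (card S)" "pos_vec v" "pos_vec (real_mat C *\<^sub>v v)"
          by (auto simp: finite_type_def dimC Let_def)
        then show ?thesis by (intro bexI[of _ v]) (auto simp: pos_vec_def dimC less_imp_le)
      next
        assume "affine_type C"
        then obtain v where v: "v \<in> carrier_vec (card S)" "pos_vec v" "real_mat C *\<^sub>v v = 0\<^sub>v (card S)"
          by (auto simp: affine_type_def dimC Let_def)
        then show ?thesis by (intro bexI[of _ v]) auto
      qed
      then obtain v where v: "v \<in> carrier_vec (card S)" "pos_vec v"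
        "\<And>s. s < card S \<Longrightarrow> (real_mat C *\<^sub>v v) $ s \<ge> 0" by blast
      define q where "q = the_inv_into {..<card S} (pick S)"
      have q: "q (pick S s) = s" if "s < card S" for s
        unfolding q_def using that bij by (intro the_inv_into_f_f) (auto simp: bij_betw_def)
      have val: "(\<Sum>j\<in>S. real_of_int (A $$ (pick S s, j)) * v $ q j) = (real_mat C *\<^sub>v v) $ s" if s: "s < card S" for s
      proof -
        have "(\<Sum>j\<in>S. real_of_int (A $$ (pick S s, j)) * v $ q j)
            = (\<Sum>t<card S. real_of_int (A $$ (pick S s, pick S t)) * v $ q (pick S t))"
          by (rule sum.reindex_bij_betw[OF bij, symmetric])
        also have "\<dots> = (\<Sum>t<card S. real_of_int (C $$ (s, t)) * v $ t)"
          using s by (intro sum.cong) (auto simp: Cij q)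
        also have "\<dots> = (real_mat C *\<^sub>v v) $ s"
          using s v(1) dimC by (subst real_mat_mult_index) auto
        finally show ?thesis .
      qed
      have onto: "\<exists>s<card S. i = pick S s" if "i \<in> S" for i
        using bij that by (auto simp: bij_betw_def)
      show ?thesis
      proof (intro exI conjI ballI)
        fix i assume "i \<in> S"
        then obtain s where s: "s < card S" "i = pick S s" using onto by blast
        show "v $ q i > 0" using v(1,2) s by (simp add: q pos_vec_def)
        show "(\<Sum>j\<in>S. real_of_int (A $$ (i, j)) * v $ q j) \<ge> 0" using val[OF s(1)] v(3)[OF s(1)] s(2) by simp
      qed
    next
      case nind: False
      have "card S > 0" using False fin by (simp add: card_gt_0_iff)
      then obtain T where T: "T \<noteq> {}" "T \<subset> {..<card S}"
        "\<forall>i\<in>T. \<forall>j\<in>{..<card S} - T. C $$ (i,j) = 0 \<and> C $$ (j,i) = 0"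
        using nind unfolding indecomposable_def dimC by blast
      define P Q where "P = pick S ` T" and "Q = pick S ` ({..<card S} - T)"
      have inj: "inj_on (pick S) {..<card S}" and img: "pick S ` {..<card S} = S"
        using bij by (auto simp: bij_betw_def)
      have PQ: "P \<union> Q = S" "P \<inter> Q = {}"
      proof -
        have "P \<union> Q = pick S ` (T \<union> ({..<card S} - T))" by (simp only: P_def Q_def image_Un)
        also have "T \<union> ({..<card S} - T) = {..<card S}" using T(2) by auto
        finally show "P \<union> Q = S" using img by simp
        have "pick S ` (T \<inter> ({..<card S} - T)) = P \<inter> Q"
          unfolding P_def Q_def using T(2) by (intro inj_on_image_Int[OF inj]) auto
        then show "P \<inter> Q = {}" by auto
      qed
      have ne: "P \<noteq> {}" "Q \<noteq> {}" using T(1,2) by (auto simp: P_def Q_def)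
      have zero: "A $$ (i, j) = 0" "A $$ (j, i) = 0" if ij: "i \<in> P" "j \<in> Q" for i j
      proof -
        obtain s where s: "i = pick S s" "s \<in> T" using ij(1) unfolding P_def by blast
        obtain t where t: "j = pick S t" "t \<in> {..<card S} - T" using ij(2) unfolding Q_def by blast
        note st = s t
        have "s < card S" "t < card S" using st T(2) by auto
        then show "A $$ (i, j) = 0" "A $$ (j, i) = 0"
          using T(3) st Cij[of s t] Cij[of t s] by simp_all
      qed
      have finPQ: "finite P" "finite Q" using PQ(1) fin by (metis finite_Un)+
      have "P \<subset> S" "Q \<subset> S" using PQ ne by blast+
      then have lt: "card P < card S" "card Q < card S" using fin by (simp_all add: psubset_card_mono)
      obtain u where u: "\<forall>i\<in>P. u i > (0::real)" "\<forall>i\<in>P. (\<Sum>j\<in>P. real_of_int (A $$ (i, j)) * u j) \<ge> 0"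
        using less.hyps[OF lt(1)] \<open>P \<subset> S\<close> less.prems by (meson psubset_trans)
      obtain w where w: "\<forall>i\<in>Q. w i > (0::real)" "\<forall>i\<in>Q. (\<Sum>j\<in>Q. real_of_int (A $$ (i, j)) * w j) \<ge> 0"
        using less.hyps[OF lt(2)] \<open>Q \<subset> S\<close> less.prems by (meson psubset_trans)
      define x where "x i = (if i \<in> P then u i else w i)" for i
      have split: "(\<Sum>j\<in>S. real_of_int (A $$ (i, j)) * x j)
          = (\<Sum>j\<in>P. real_of_int (A $$ (i, j)) * x j) + (\<Sum>j\<in>Q. real_of_int (A $$ (i, j)) * x j)" for i
        unfolding PQ(1)[symmetric] using finPQ PQ(2) by (rule sum.union_disjoint)
      have xP: "x j = u j" if "j \<in> P" for j using that by (simp add: x_def)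
      have xQ: "x j = w j" if "j \<in> Q" for j using that PQ(2) by (auto simp: x_def)
      show ?thesis
      proof (intro exI conjI ballI)
        fix i assume i: "i \<in> S"
        then consider "i \<in> P" | "i \<in> Q" using PQ(1) by blast
        then have "x i > 0 \<and> (\<Sum>j\<in>S. real_of_int (A $$ (i, j)) * x j) \<ge> 0"
        proof cases
          case 1
          then have "(\<Sum>j\<in>Q. real_of_int (A $$ (i, j)) * x j) = 0"
            using zero(1) by (intro sum.neutral) auto
          moreover have "(\<Sum>j\<in>P. real_of_int (A $$ (i, j)) * x j) = (\<Sum>j\<in>P. real_of_int (A $$ (i, j)) * u j)"
            by (intro sum.cong) (auto simp: xP)
          ultimately show ?thesis using u 1 by (simp add: split xP)
        next
          case 2
          then have "(\<Sum>j\<in>P. real_of_int (A $$ (i, j)) * x j) = 0"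
            using zero(2) by (intro sum.neutral) auto
          moreover have "(\<Sum>j\<in>Q. real_of_int (A $$ (i, j)) * x j) = (\<Sum>j\<in>Q. real_of_int (A $$ (i, j)) * w j)"
            by (intro sum.cong) (auto simp: xQ)
          ultimately show ?thesis using w 2 by (simp add: split xQ)
        qed
        then show "x i > 0" "(\<Sum>j\<in>S. real_of_int (A $$ (i, j)) * x j) \<ge> 0" by auto
      qed
    qed
  qed simp
qed

lemma supported_zeroI:
  assumes x: "supported n x" and 0: "\<And>i. i < n \<Longrightarrow> x i = 0"
  shows "x = 0"
proof
  fix i show "x i = 0 i" using x 0[of i] by (cases "i < n") (simp_all add: supported_def)
qed

lemma real_vec_nonneg_image:
  assumes A: "gcm A" and v: "\<And>i. i < dim_row A \<Longrightarrow> gcm_system.pr (dim_row A) (\<lambda>i j. A $$ (i, j)) i v \<ge> 0"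
  shows "real_mat A *\<^sub>v vec (dim_row A) (\<lambda>i. real_of_int (v i)) \<ge> 0\<^sub>v (dim_row A)"
  unfolding less_eq_vec_def
proof (intro conjI allI impI)
  interpret gcm_system "dim_row A" "\<lambda>i j. A $$ (i, j)" using A by (rule gcm_system_mat)
  have dc: "dim_col A = dim_row A" using A by (simp add: gcm_def)
  fix i assume "i < dim_vec (real_mat A *\<^sub>v vec (dim_row A) (\<lambda>i. real_of_int (v i)))"
  then have i: "i < dim_row A" by simp
  have "(real_mat A *\<^sub>v vec (dim_row A) (\<lambda>i. real_of_int (v i))) $ i = real_of_int (pr i v)"
    using i by (subst real_mat_mult_index[OF dc]) (simp_all add: pr_def)
  then show "0\<^sub>v (dim_row A) $ i \<le> (real_mat A *\<^sub>v vec (dim_row A) (\<lambda>i. real_of_int (v i))) $ i"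
    using v[OF i] i by simp
qed simp

lemma hyperbolic_type_gcm:
  assumes A: "hyperbolic_type A" and D: "sym_gcm (dim_row A) (\<lambda>i j. A $$ (i, j)) D"
  shows "hyperbolic_gcm (dim_row A) (\<lambda>i j. A $$ (i, j)) D"
    and "\<exists>u. (\<forall>i<dim_row A. u i \<ge> (0::real)) \<and> (\<forall>i<dim_row A. (\<Sum>j<dim_row A. real_of_int (A $$ (i, j)) * u j) < 0)"
proof -
  interpret sym_gcm "dim_row A" "\<lambda>i j. A $$ (i, j)" D by (rule D)
  have gA: "gcm A" and ind: "indecomposable A" using A by (auto simp: hyperbolic_type_def indefinite_type_def)
  have dc: "dim_col A = dim_row A" using gA by (simp add: gcm_def)
  obtain v where v: "v \<in> carrier_vec (dim_row A)" "pos_vec v" "pos_vec (- (real_mat A *\<^sub>v v))"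
    using A by (auto simp: hyperbolic_type_def indefinite_type_def Let_def)
  have pos: "v $ i > 0" if "i < dim_row A" for i using v(1,2) that by (simp add: pos_vec_def)
  have neg: "(\<Sum>j<dim_row A. real_of_int (A $$ (i, j)) * v $ j) < 0" if "i < dim_row A" for i
  proof -
    have "(- (real_mat A *\<^sub>v v)) $ i > 0" using v(3) that by (simp add: pos_vec_def)
    then show ?thesis using that real_mat_mult_index[OF dc v(1) that] by simp
  qed
  show "\<exists>u. (\<forall>i<dim_row A. u i \<ge> (0::real)) \<and> (\<forall>i<dim_row A. (\<Sum>j<dim_row A. real_of_int (A $$ (i, j)) * u j) < 0)"
    using pos neg by (intro exI[of _ "\<lambda>i. v $ i"]) (auto simp: less_imp_le)
  show "hyperbolic_gcm (dim_row A) (\<lambda>i j. A $$ (i, j)) D"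
  proof unfold_locales
    have "dim_row A > 0" using ind by (simp add: indecomposable_def)
    \<comment> \<open>The only candidate, the matrix (2), maps positive vectors to positive
      ones.\<close>
    moreover have "dim_row A \<noteq> 1"
    proof
      assume 1: "dim_row A = 1"
      then have "(\<Sum>j<dim_row A. real_of_int (A $$ (0, j)) * v $ j) = 2 * v $ 0"
        using diag[of 0] by simp
      then show False using neg[of 0] pos[of 0] 1 by simp
    qed
    ultimately show "2 \<le> dim_row A" by linarith
    show "connected_matrix (dim_row A) (\<lambda>i j. A $$ (i, j))" using gA ind by (rule indecomposable_connected)
    show "form x x \<ge> 0" if k: "k < dim_row A" "x k = 0" for k x
    proof -
      have "{..<dim_row A} - {k} \<subset> {..<dim_row A}" using k(1) by auto
      then obtain u where "\<forall>i\<in>{..<dim_row A} - {k}. u i > (0::real)"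
        "\<forall>i\<in>{..<dim_row A} - {k}. (\<Sum>j\<in>{..<dim_row A} - {k}. real_of_int (A $$ (i, j)) * u j) \<ge> 0"
        using hyperbolic_subdiagram[OF A] by blast
      then show ?thesis using k by (intro form_nonneg_on[of "{..<dim_row A} - {k}" u]) auto
    qed
    show "x = 0" if x: "nonneg x" "supported (dim_row A) x" "\<And>i. i < dim_row A \<Longrightarrow> pr i x \<ge> 0" for x
    proof -
      let ?x = "vec (dim_row A) (\<lambda>i. real_of_int (x i))"
      have "?x \<ge> 0\<^sub>v (dim_row A)" using nonnegD[OF x(1)] by (simp add: less_eq_vec_def)
      then have "?x = 0\<^sub>v (dim_row A)"
        using A real_vec_nonneg_image[OF gA x(3)]
        unfolding hyperbolic_type_def indefinite_type_def Let_def by (meson vec_carrier)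
      then have "?x $ i = 0\<^sub>v (dim_row A) $ i" for i by simp
      then have "x i = 0" if "i < dim_row A" for i
        using that by (metis index_vec index_zero_vec(1) of_int_eq_0_iff)
      then show ?thesis using supported_zeroI[OF x(2)] by blast
    qed
  qed
qed

theorem proposition4p1:
  fixes A B :: "int mat"
  assumes "gcm A"
    and "finite_type A \<or> untwisted_affine_type A \<or> hyperbolic_type A"
    and "gcm B" and "symmetrizable B"
    and "A \<preceq>\<^sub>\<pi> B" and "B \<preceq>\<^sub>\<pi> A"
  shows "permutation_equivalent B A"
proof -
  obtain bs where bs: "pi_system A bs" "lin_independent A bs" "pi_type A bs = B"
    and symA: "symmetrizable A"
    using assms(6) by (auto simp: gcm_preceq_def)
  obtain cs where cs: "pi_system B cs" "lin_independent B cs" "pi_type B cs = A"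
    using assms(5) by (auto simp: gcm_preceq_def)
  define n where "n = dim_row A"
  define a b where "a = (\<lambda>i j. A $$ (i, j))" and "b = (\<lambda>i j. B $$ (i, j))"
  define \<beta> \<gamma> where "\<beta> j = vfun (bs ! j)" and "\<gamma> j = vfun (cs ! j)" for j
  obtain D E where D: "sym_gcm n a D" and E: "sym_gcm (dim_row B) b E"
    using symmetrizable_sym_gcm[OF assms(1) symA] symmetrizable_sym_gcm[OF assms(3,4)]
    by (auto simp: n_def a_def b_def)
  note P0 = pi_system_root_embedding[OF assms(1) _ assms(3) bs, folded n_def a_def b_def \<beta>_def]
  note Q0 = pi_system_root_embedding[OF assms(3) _ assms(1) cs, folded n_def a_def b_def \<gamma>_def]
  \<comment> \<open>Each of the two independent families bounds one size by the other.\<close>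
  have nB: "dim_row B = n"
    using root_embedding.card_le[OF P0[OF D]] root_embedding.card_le[OF Q0[OF E]] by simp
  have P: "root_embedding n a D n b \<beta>" if "sym_gcm n a D" for D using P0[OF that] by (simp add: nB)
  have Q: "root_embedding n b N n a \<gamma>" if "sym_gcm n b N" for N using Q0 that by (simp add: nB)
  have "\<exists>p. p permutes {..<n} \<and> (\<forall>i<n. \<forall>j<n. b i j = a (p i) (p j))"
    using assms(2)
  proof (elim disjE)
    assume fin: "finite_type A"
    have dc: "dim_col A = n" using assms(1) by (simp add: gcm_def n_def)
    obtain u where u: "u \<in> carrier_vec n" "pos_vec u" "pos_vec (real_mat A *\<^sub>v u)"
      using fin by (auto simp: finite_type_def n_def Let_def)
    have pos: "u $ i > 0" if "i < n" for i using u(1,2) that by (simp add: pos_vec_def)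
    have image: "(\<Sum>j<n. real_of_int (a i j) * u $ j) \<ge> 0" if "i < n" for i
    proof -
      have "(real_mat A *\<^sub>v u) $ i > 0" using u(3) that by (simp add: pos_vec_def n_def)
      then show ?thesis using real_mat_mult_index[of A u i] u(1) that dc by (simp add: a_def n_def)
    qed
    have definite: "(\<forall>i<n. v i > 0) \<or> v = 0"
      if v: "supported n v" "\<And>i. i < n \<Longrightarrow> gcm_system.pr n a i v \<ge> 0" for v
    proof -
      let ?v = "vec n (\<lambda>i. real_of_int (v i))"
      have "real_mat A *\<^sub>v ?v \<ge> 0\<^sub>v n"
        using real_vec_nonneg_image[OF assms(1), of v] v(2) by (simp add: n_def a_def)
      then have "pos_vec ?v \<or> ?v = 0\<^sub>v n"
        using fin unfolding finite_type_def Let_def n_def by (meson vec_carrier)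
      then show ?thesis
      proof
        assume "?v = 0\<^sub>v n"
        then have "?v $ i = 0\<^sub>v n $ i" for i by simp
        then have "v i = 0" if "i < n" for i
          using that by (metis index_vec index_zero_vec(1) of_int_eq_0_iff)
        then have "v = 0" using supported_zeroI[OF v(1)] by blast
        then show ?thesis ..
      qed (simp add: pos_vec_def)
    qed
    obtain p where "p permutes {..<n}" "\<And>i j. i < n \<Longrightarrow> j < n \<Longrightarrow> b i j = a (p i) (p j)"
      using finite_mutual_embedding[OF P[OF D] Q pos image definite] by blast
    then show ?thesis by blast
  next
    assume "untwisted_affine_type A"
    then obtain D' \<delta> o' where U: "untwisted_gcm n a D' \<delta> o'"
      using untwisted_affine_type_gcm[OF assms(1)] by (auto simp: n_def a_def)
    interpret untwisted_gcm n a D' \<delta> o' by (rule U)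
    have len: "length bs = n" using bs(3) nB by (auto simp: pi_type_def)
    have carrier: "bs ! i \<in> carrier_vec n" if "i < n" for i
    proof -
      have "bs ! i \<in> real_roots A" using bs(1) that len nth_mem[of i bs] by (auto simp: pi_system_def)
      then show ?thesis using real_root_carrier[OF assms(1)] by (simp add: n_def)
    qed
    have no_root: "\<beta> i - \<beta> j \<notin> rts" if ij: "i < n" "j < n" "i \<noteq> j" for i j
    proof
      assume "\<beta> i - \<beta> j \<in> rts"
      \<comment> \<open>A real root or its negative is ascending, hence a root of the Lie algebra,
        and the \<pi>-system excludes both differences.\<close>
      then have "\<beta> i - \<beta> j \<in> asc \<or> - (\<beta> i - \<beta> j) \<in> asc" by (rule rts_asc)
      then have "vec n (\<beta> i - \<beta> j) \<in> roots A \<or> vec n (\<beta> j - \<beta> i) \<in> roots A"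
        using ascending_root[OF assms(1)] by (auto simp: n_def a_def)
      moreover have "vec n (\<beta> k - \<beta> l) = bs ! k - bs ! l" if "k < n" "l < n" for k l
        using carrier[OF that(1)] carrier[OF that(2)] by (intro eq_vecI) (auto simp: \<beta>_def vfun_def)
      ultimately show False using bs(1) ij len by (auto simp: pi_system_def)
    qed
    obtain p where "p permutes {..<n}" "\<And>i j. i < n \<Longrightarrow> j < n \<Longrightarrow> b i j = a (p i) (p j)"
      using untwisted_mutual_embedding[OF U P[OF sym_gcm_axioms] Q no_root] by blast
    then show ?thesis by blast
  next
    assume hyp: "hyperbolic_type A"
    note H = hyperbolic_type_gcm[OF hyp, folded n_def a_def, OF D]
    obtain u where u: "\<forall>i<n. u i \<ge> (0::real)" "\<forall>i<n. (\<Sum>j<n. real_of_int (a i j) * u j) < 0"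
      using H(2) by (auto simp: n_def a_def)
    have u': "\<And>i. i < n \<Longrightarrow> u i \<ge> 0" "\<And>i. i < n \<Longrightarrow> (\<Sum>j<n. real_of_int (a i j) * u j) < 0"
      using u by simp_all
    obtain p where "p permutes {..<n}" "\<And>i j. i < n \<Longrightarrow> j < n \<Longrightarrow> b i j = a (p i) (p j)"
      using hyperbolic_mutual_embedding[OF H(1) P[OF D] Q u'] by blast
    then show ?thesis by blast
  qed
  then obtain p where p: "p permutes {..<n}" "\<And>i j. i < n \<Longrightarrow> j < n \<Longrightarrow> b i j = a (p i) (p j)" by blast
  have "B = mat (dim_row A) (dim_col A) (\<lambda>(i,j). A $$ (p i, p j))"
    using assms(1,3) nB p(2) by (intro eq_matI) (auto simp: gcm_def n_def a_def b_def)
  then show ?thesis using p(1) by (auto simp: permutation_equivalent_def n_def)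
qed

end
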